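(* There exist topologically numerically transitive operators that are not subspace supercyclic. Furthermore, there exist C*-transitive operators on $\tilde\ell_2(B_0(H))$ that are not subspace hypercyclic, and there exist subspace supercyclic operators on $\tilde\ell_2(B_0(H))$ that are not C*-transitive.
   Context: $T\in\mathcal B(X)$, $X$ a complex Banach space, is subspace hypercyclic (respectively subspace supercyclic) if there exist a closed subspace $M\subseteq X$ with $\dim M\ge2$ and some $x\in X$ such that $\{T^nx:n\ge0\}\cap M$ (respectively $\{\lambda T^nx:n\ge0,\lambda\in\mathbb C\}\cap M$) is dense in $M$. $\Pi(X):=\{(x,x^* )\in S_X\times S_{X^*}:x^*(x)=1\}$ ($S_X,S_{X^*}$ unit spheres) has the topology induced by the norm $\max\{\|x\|,\|x^*\|\}$; $T\in\mathcal B(X)$ is topologically numerically transitive if for every nonempty open $U\subset\Pi(X)$ and nonempty open $V\subset\mathbb C$ there exist $n\ge0$ and $(x,x^* )\in U$ with $x^*(T^nx)\in V$. $H$ is a complex separable Hilbert space with an orthonormal basis $\{e_j\}_{j\in\mathbb Z}$, $B_0(H)$ is the C*-algebra of compact operators on $H$. $\tilde\ell_2(B_0(H))$ is the standard Hilbert module over $B_0(H)$: sequences $x=(x_j)_{j\in\mathbb N}$ in $B_0(H)$ with $\sum_j x_j^*x_j$ norm convergent, with $\varphi(x,y)=\sum_{j}y_j^*x_j$ and norm $\|x\|=\|\varphi(x,x)\|^{1/2}$. With $X=\tilde\ell_2(B_0(H))$ and unit sphere $S(X)$, $T\in\mathcal B(X)$ is C*-transitive if for every nonempty open $W\subseteq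 S(X)\times S(X)$ and nonempty open $O\subseteq B_0(H)$ there exist $n\in\mathbb N$ and $(x,y)\in W$ with $\varphi(T^nx,y)\in O$. *)

theory Defs
  imports "HOL-Analysis.Analysis" "HOL-Library.Function_Algebras"
begin

section \<open>Complex normed spaces as sets inside an additive group\<close>

text \<open>
  HOL-Analysis has type classes for real normed spaces only, and a type class would not allow
  quantification over spaces inside a formula.  A complex normed space is therefore a record:
  the vectors form a subset of a type whose addition is used, with its own scalar
  multiplication and norm.  The conditions on such a record are in \<open>complex_banach\<close>.
\<close>

record 'a cns =
  carrier :: "'a set"
  cscale :: "complex \<Rightarrow> 'a \<Rightarrow> 'a"
  nrm :: "'a \<Rightarrow> real"

text \<open>
  The locale \<open>Metric_space\<close> demands symmetry and nonnegativity on the whole type; hence the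
  value 0 outside the carrier, which affects neither topology nor completeness.
\<close>

definition cns_dist :: "('a::ab_group_add) cns \<Rightarrow> 'a \<Rightarrow> 'a \<Rightarrow> real" where
  "cns_dist X x y = (if x \<in> carrier X \<and> y \<in> carrier X then nrm X (x - y) else 0)"

abbreviation norm_topology :: "('a::ab_group_add) cns \<Rightarrow> 'a topology" where
  "norm_topology X \<equiv> Metric_space.mtopology (carrier X) (cns_dist X)"

definition complex_banach :: "('a::ab_group_add) cns \<Rightarrow> bool" where
  "complex_banach X \<longleftrightarrow>
     vector_space (cscale X) \<and>
     module.subspace (cscale X) (carrier X) \<and>
     (\<forall>x\<in>carrier X. nrm X x \<ge> 0 \<and> (nrm X x = 0 \<longleftrightarrow> x = 0)) \<and>
     (\<forall>x\<in>carrier X. \<forall>y\<in>carrier X. nrm X (x + y) \<le> nrm X x + nrm X y) \<and>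
     (\<forall>c. \<forall>x\<in>carrier X. nrm X (cscale X c x) = cmod c * nrm X x) \<and>
     Metric_space.mcomplete (carrier X) (cns_dist X)"

lemma complex_banach_Metric_space:
  assumes "complex_banach X"
  shows "Metric_space (carrier X) (cns_dist X)"
proof -
  let ?C = "carrier X"
  interpret vector_space "cscale X"
    using assms by (simp add: complex_banach_def)
  have sub: "subspace ?C"
    and nonneg: "\<And>x. x \<in> ?C \<Longrightarrow> nrm X x \<ge> 0"
    and zero: "\<And>x. x \<in> ?C \<Longrightarrow> nrm X x = 0 \<longleftrightarrow> x = 0"
    and tri: "\<And>x y. x \<in> ?C \<Longrightarrow> y \<in> ?C \<Longrightarrow> nrm X (x + y) \<le> nrm X x + nrm X y"
    and hom: "\<And>c x. x \<in> ?C \<Longrightarrow> nrm X (cscale X c x) = cmod c * nrm X x"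
    using assms by (auto simp: complex_banach_def)
  note diff = subspace_diff[OF sub]
  have sym: "nrm X (x - y) = nrm X (y - x)" if "x \<in> ?C" "y \<in> ?C" for x y
    using hom[OF diff[OF that], of "-1"] by simp
  show ?thesis
  proof
    fix x y z assume "x \<in> ?C" "y \<in> ?C" "z \<in> ?C"
    then show "cns_dist X x z \<le> cns_dist X x y + cns_dist X y z"
      using tri[OF diff diff, of x y y z] by (simp add: cns_dist_def)
  qed (use nonneg zero sym diff in \<open>auto simp: cns_dist_def\<close>)
qed

definition unit_sphere :: "'a cns \<Rightarrow> 'a set" where
  "unit_sphere X = {x \<in> carrier X. nrm X x = 1}"

text \<open>The values of an operator outside the carrier are irrelevant.\<close>

definition bounded_operators :: "('a::ab_group_add) cns \<Rightarrow> ('a \<Rightarrow> 'a) set" where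
  "bounded_operators X =
     {T. (\<forall>x\<in>carrier X. T x \<in> carrier X) \<and>
         (\<forall>x\<in>carrier X. \<forall>y\<in>carrier X. T (x + y) = T x + T y) \<and>
         (\<forall>c. \<forall>x\<in>carrier X. T (cscale X c x) = cscale X c (T x)) \<and>
         (\<exists>K. \<forall>x\<in>carrier X. nrm X (T x) \<le> K * nrm X x)}"

text \<open>Functionals are extensional, so that each element of the dual is one function.\<close>

definition dual :: "('a::ab_group_add) cns \<Rightarrow> ('a \<Rightarrow> complex) set" where
  "dual X =
     {f \<in> extensional (carrier X).
         (\<forall>x\<in>carrier X. \<forall>y\<in>carrier X. f (x + y) = f x + f y) \<and>
         (\<forall>c. \<forall>x\<in>carrier X. f (cscale X c x) = c * f x) \<and>
         (\<exists>K. \<forall>x\<in>carrier X. cmod (f x) \<le> K * nrm X x)}"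

definition dual_norm :: "'a cns \<Rightarrow> ('a \<Rightarrow> complex) \<Rightarrow> real" where
  "dual_norm X f = (SUP x\<in>{x \<in> carrier X. nrm X x \<le> 1}. cmod (f x))"


section \<open>Subspace hypercyclicity and subspace supercyclicity\<close>

definition closed_subspace_dim_ge2 :: "('a::ab_group_add) cns \<Rightarrow> 'a set \<Rightarrow> bool" where
  "closed_subspace_dim_ge2 X M \<longleftrightarrow>
     module.subspace (cscale X) M \<and> closedin (norm_topology X) M \<and>
     (\<exists>B\<subseteq>M. card B = 2 \<and> \<not> module.dependent (cscale X) B)"

definition dense_in :: "('a::ab_group_add) cns \<Rightarrow> 'a set \<Rightarrow> 'a set \<Rightarrow> bool" where
  "dense_in X A M \<longleftrightarrow> A \<subseteq> M \<and> M \<subseteq> (norm_topology X) closure_of A"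

definition subspace_hypercyclic :: "('a::ab_group_add) cns \<Rightarrow> ('a \<Rightarrow> 'a) \<Rightarrow> bool" where
  "subspace_hypercyclic X T \<longleftrightarrow>
     (\<exists>M. closed_subspace_dim_ge2 X M \<and>
       (\<exists>x\<in>carrier X. dense_in X ({(T ^^ n) x | n. True} \<inter> M) M))"

definition subspace_supercyclic :: "('a::ab_group_add) cns \<Rightarrow> ('a \<Rightarrow> 'a) \<Rightarrow> bool" where
  "subspace_supercyclic X T \<longleftrightarrow>
     (\<exists>M. closed_subspace_dim_ge2 X M \<and>
       (\<exists>x\<in>carrier X. dense_in X ({cscale X c ((T ^^ n) x) | c n. True} \<inter> M) M))"


section \<open>Topological numerical transitivity\<close>

definition Pi_set :: "('a::ab_group_add) cns \<Rightarrow> ('a \<times> ('a \<Rightarrow> complex)) set" where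
  "Pi_set X = {(x, f). x \<in> unit_sphere X \<and> f \<in> dual X \<and> dual_norm X f = 1 \<and> f x = 1}"

definition Pi_dist ::
    "('a::ab_group_add) cns \<Rightarrow> 'a \<times> ('a \<Rightarrow> complex) \<Rightarrow> 'a \<times> ('a \<Rightarrow> complex) \<Rightarrow> real" where
  "Pi_dist X p q =
     (if p \<in> Pi_set X \<and> q \<in> Pi_set X
      then max (nrm X (fst p - fst q)) (dual_norm X (\<lambda>x. snd p x - snd q x)) else 0)"

definition topologically_numerically_transitive ::
    "('a::ab_group_add) cns \<Rightarrow> ('a \<Rightarrow> 'a) \<Rightarrow> bool" where
  "topologically_numerically_transitive X T \<longleftrightarrow>
     (\<forall>U V. openin (Metric_space.mtopology (Pi_set X) (Pi_dist X)) U \<and> U \<noteq> {} \<and>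
            open V \<and> V \<noteq> {} \<longrightarrow>
        (\<exists>n. \<exists>(x, f)\<in>U. f ((T ^^ n) x) \<in> V))"


section \<open>Complex Hilbert spaces and compact operators\<close>

text \<open>The inner product is linear in the first argument.\<close>

class complex_hilbert = banach +
  fixes scaleC :: "complex \<Rightarrow> 'a \<Rightarrow> 'a"
    and cinner :: "'a \<Rightarrow> 'a \<Rightarrow> complex"
  assumes scaleC_add_right: "scaleC a (x + y) = scaleC a x + scaleC a y"
    and scaleC_add_left: "scaleC (a + b) x = scaleC a x + scaleC b x"
    and scaleC_scaleC: "scaleC a (scaleC b x) = scaleC (a * b) x"
    and scaleC_of_real: "scaleC (complex_of_real r) x = r *\<^sub>R x"
    and cinner_commute: "cinner x y = cnj (cinner y x)"
    and cinner_add_left: "cinner (x + y) z = cinner x z + cinner y z"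
    and cinner_scaleC_left: "cinner (scaleC a x) y = a * cinner x y"
    and cinner_self: "cinner x x = complex_of_real ((norm x)\<^sup>2)"

definition orthonormal_basis :: "('i \<Rightarrow> 'h::complex_hilbert) \<Rightarrow> bool" where
  "orthonormal_basis e \<longleftrightarrow>
     (\<forall>i j. cinner (e i) (e j) = (if i = j then 1 else 0)) \<and>
     closure (module.span scaleC (range e)) = UNIV"

lemma norm_scaleC: "norm (scaleC a x) = cmod a * norm (x :: 'h::complex_hilbert)"
proof -
  have "complex_of_real ((norm (scaleC a x))\<^sup>2) = a * cnj (cinner (scaleC a x) x)"
    by (metis cinner_commute cinner_scaleC_left cinner_self)
  also have "\<dots> = complex_of_real ((cmod a * norm x)\<^sup>2)"
    by (simp add: cinner_scaleC_left cinner_self complex_norm_square power_mult_distrib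
        mult.assoc del: of_real_power)
  finally have "(norm (scaleC a x))\<^sup>2 = (cmod a * norm x)\<^sup>2"
    by (simp only: of_real_eq_iff)
  then show ?thesis
    by (simp add: power2_eq_iff_nonneg)
qed

text \<open>
  Elements of \<open>'h \<Rightarrow>\<^sub>L 'h\<close> are bounded and real-linear; complex linearity is imposed in
  \<open>compact_operators\<close>.  The norm is the operator norm.
\<close>

lift_definition blinfun_scaleC ::
    "complex \<Rightarrow> ('h::complex_hilbert \<Rightarrow>\<^sub>L 'h) \<Rightarrow> ('h \<Rightarrow>\<^sub>L 'h)"
  is "\<lambda>a f u. scaleC a (f u)"
proof -
  fix a :: complex and f :: "'h \<Rightarrow> 'h"
  assume f: "bounded_linear f"
  have "bounded_linear (scaleC a :: 'h \<Rightarrow> 'h)"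
  proof (rule bounded_linear_intro[where K = "cmod a"])
    fix r :: real and x :: 'h
    show "scaleC a (r *\<^sub>R x) = r *\<^sub>R scaleC a x"
      by (simp flip: scaleC_of_real add: scaleC_scaleC mult.commute)
  qed (simp_all add: scaleC_add_right norm_scaleC mult.commute)
  then show "bounded_linear (\<lambda>u. scaleC a (f u))"
    using f by (rule bounded_linear_compose)
qed

definition compact_operators :: "('h::complex_hilbert \<Rightarrow>\<^sub>L 'h) set" where
  "compact_operators =
     {A. (\<forall>c u. blinfun_apply A (scaleC c u) = scaleC c (blinfun_apply A u)) \<and>
         compact (closure (blinfun_apply A ` cball 0 1))}"

definition adj :: "('h::complex_hilbert \<Rightarrow>\<^sub>L 'h) \<Rightarrow> ('h \<Rightarrow>\<^sub>L 'h)" where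
  "adj A = (THE B. \<forall>u v. cinner (blinfun_apply A u) v = cinner u (blinfun_apply B v))"


section \<open>The standard Hilbert module over the compact operators\<close>

definition module_ip ::
    "(nat \<Rightarrow> ('h::complex_hilbert \<Rightarrow>\<^sub>L 'h)) \<Rightarrow> (nat \<Rightarrow> ('h \<Rightarrow>\<^sub>L 'h)) \<Rightarrow> ('h \<Rightarrow>\<^sub>L 'h)" where
  "module_ip x y = (\<Sum>j. adj (y j) o\<^sub>L x j)"

definition l2_B0 :: "(nat \<Rightarrow> ('h::complex_hilbert \<Rightarrow>\<^sub>L 'h)) cns" where
  "l2_B0 =
     \<lparr>carrier = {x. (\<forall>j. x j \<in> compact_operators) \<and> summable (\<lambda>j. adj (x j) o\<^sub>L x j)},
      cscale = (\<lambda>c x j. blinfun_scaleC c (x j)),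
      nrm = (\<lambda>x. sqrt (norm (module_ip x x)))\<rparr>"

definition Cstar_transitive ::
    "((nat \<Rightarrow> ('h::complex_hilbert \<Rightarrow>\<^sub>L 'h)) \<Rightarrow> (nat \<Rightarrow> ('h \<Rightarrow>\<^sub>L 'h))) \<Rightarrow> bool" where
  "Cstar_transitive T \<longleftrightarrow>
     (let S = subtopology (norm_topology l2_B0) (unit_sphere l2_B0) in
      \<forall>W Q. openin (prod_topology S S) W \<and> W \<noteq> {} \<and>
            openin (top_of_set compact_operators) Q \<and> Q \<noteq> {} \<longrightarrow>
        (\<exists>n. \<exists>(x, y)\<in>W. module_ip ((T ^^ n) x) y \<in> Q))"

end

theory Submission
  imports Defs
begin

text \<open>
  Twice the forward shift, \<open>T\<close>, on \<open>l2\<close> and on the standard Hilbert module, settles the first two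
  claims.  Given unit vectors of finite support, adding a tiny multiple of \<open>e\<^sub>N\<close> to one and a small
  multiple of \<open>e\<^sub>n\<^sub>+\<^sub>N\<close> to the other changes \<open>\<langle>T\<^sup>n x, y\<rangle>\<close> by an arbitrary amount for large \<open>n\<close>,
  because the factor \<open>2\<^sup>n\<close> compensates the first perturbation and all other terms have disjoint
  supports; in the module one perturbs by a compact operator \<open>C\<close> and a finite rank projection
  \<open>P\<close> with \<open>P C\<close> close to \<open>C\<close>.  On the other hand, the first nonzero coordinate of
  \<open>T\<^sup>n x\<close> moves to the right with \<open>n\<close>, which prevents multiples of the iterates from being dense in
  a subspace of dimension at least two.

  The backward shift is a contraction, hence not C*-transitive by the Cauchy-Schwarz inequality,
  but it is supercyclic on the closed subspace of columns of multiples of a fixed rank one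
  projection, which is a copy of \<open>l2\<close>.
\<close>


section \<open>Complex inner products and adjoints\<close>

text \<open>The set Pi imposes a coupling: over \<open>l2\<close>, a functional of norm one with
  value one at a unit vector x must be the inner product with x, so x and its functional cannot be
  moved separately. Both perturbations therefore go into one vector, whereas C*-transitivity lets
  two unit vectors move freely. In the module a projection stands in for the identity because
  entries have to be compact and the identity of an infinite-dimensional space is not; P C
  approximates C in norm because C is compact. The factor 2 supplies growth that outruns the inverse
  square of the perturbation size, yet it leaves zero coordinates zero, so the argument about first
  nonzero coordinates survives it. For the backward shift, scalar multiples compensate for
  contractivity: dividing by rapidly decaying weights restores the size of later blocks. The inner
  product lives on a carrier \<open>V\<close> so that both \<open>l2\<close> and the type class of
  Hilbert spaces are instances. Its lemma on norm-attaining functionals yields the description of Pi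
  as well as the Riesz representation, on which the existence of adjoints rests.\<close>

locale complex_inner_space = vector_space sc
  for sc :: "complex \<Rightarrow> 'a::ab_group_add \<Rightarrow> 'a" +
  fixes V :: "'a set" and ip :: "'a \<Rightarrow> 'a \<Rightarrow> complex" and N :: "'a \<Rightarrow> real"
  assumes sub: "subspace V"
    and ip_commute: "\<lbrakk>x \<in> V; y \<in> V\<rbrakk> \<Longrightarrow> ip x y = cnj (ip y x)"
    and ip_add_left: "\<lbrakk>x \<in> V; y \<in> V; z \<in> V\<rbrakk> \<Longrightarrow> ip (x + y) z = ip x z + ip y z"
    and ip_scale_left: "\<lbrakk>x \<in> V; y \<in> V\<rbrakk> \<Longrightarrow> ip (sc a x) y = a * ip x y"
    and ip_self: "x \<in> V \<Longrightarrow> ip x x = complex_of_real ((N x)\<^sup>2)"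
    and N_nonneg: "x \<in> V \<Longrightarrow> 0 \<le> N x"
    and N_eq_0: "x \<in> V \<Longrightarrow> N x = 0 \<Longrightarrow> x = 0"
begin

lemma V_closed [simp]:
  "x \<in> V \<Longrightarrow> y \<in> V \<Longrightarrow> x + y \<in> V" "x \<in> V \<Longrightarrow> y \<in> V \<Longrightarrow> x - y \<in> V"
  "x \<in> V \<Longrightarrow> sc a x \<in> V" "0 \<in> V"
  using sub by (auto simp: subspace_add subspace_diff subspace_scale subspace_0)

lemma ip_add_right: "\<lbrakk>x \<in> V; y \<in> V; z \<in> V\<rbrakk> \<Longrightarrow> ip x (y + z) = ip x y + ip x z"
  using ip_add_left[of y z x] ip_commute[of x] by simp

lemma ip_scale_right: "\<lbrakk>x \<in> V; y \<in> V\<rbrakk> \<Longrightarrow> ip x (sc a y) = cnj a * ip x y"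
  using ip_scale_left[of y x a] ip_commute[of x] by simp

text \<open>Both coefficients are kept general so that the Cauchy-Schwarz inequality, the
  perturbation argument for norm-attaining functionals and the parallelogram law are all
  instances.\<close>

lemma N_scale_add:
  assumes "x \<in> V" "y \<in> V"
  shows "(N (sc a x + sc b y))\<^sup>2
       = (cmod a)\<^sup>2 * (N x)\<^sup>2 + (cmod b)\<^sup>2 * (N y)\<^sup>2 + 2 * Re (a * cnj b * ip x y)"
proof -
  have "complex_of_real ((N (sc a x + sc b y))\<^sup>2) = ip (sc a x + sc b y) (sc a x + sc b y)"
    using assms by (simp add: ip_self)
  also have "\<dots> = a * cnj a * ip x x + b * cnj b * ip y y
      + (a * cnj b * ip x y + cnj (a * cnj b * ip x y))"
    using assms ip_commute[of y x]
    by (simp add: ip_add_left ip_add_right ip_scale_left ip_scale_right algebra_simps)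
  also have "\<dots> = complex_of_real ((cmod a)\<^sup>2 * (N x)\<^sup>2 + (cmod b)\<^sup>2 * (N y)\<^sup>2 + 2 * Re (a * cnj b * ip x y))"
    using assms by (simp only: ip_self complex_add_cnj) (simp add: complex_mult_cnj cmod_power2)
  finally show ?thesis by (simp only: of_real_eq_iff)
qed

lemma Cauchy_Schwarz:
  assumes "x \<in> V" "y \<in> V"
  shows "cmod (ip x y) \<le> N x * N y"
proof (cases "N y = 0")
  case True
  then have "sc 0 0 = y" using assms N_eq_0 by simp
  then have "ip x y = 0" using ip_scale_right[of x 0 0] assms by simp
  then show ?thesis using N_nonneg assms by simp
next
  case False
  \<comment> \<open>This vector is \<open>(N y)\<^sup>2\<close> times the component of x orthogonal
    to y; clearing the denominator avoids a division.\<close>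
  have "0 \<le> (N (sc (of_real ((N y)\<^sup>2)) x + sc (- ip x y) y))\<^sup>2" by simp
  also have "\<dots> = (N y)\<^sup>2 * ((N x * N y)\<^sup>2 - (cmod (ip x y))\<^sup>2)"
  proof -
    have "Re (complex_of_real ((N y)\<^sup>2) * cnj (- ip x y) * ip x y) = - ((N y)\<^sup>2 * (cmod (ip x y))\<^sup>2)"
      by (simp add: cmod_power2) (simp add: power2_eq_square algebra_simps)
    moreover have "cmod (complex_of_real ((N y)\<^sup>2)) = (N y)\<^sup>2"
      by (simp only: norm_of_real) simp
    ultimately show ?thesis
      unfolding N_scale_add[OF assms] by (simp only: norm_minus_cancel) (simp add: power2_eq_square algebra_simps)
  qed
  finally have "(cmod (ip x y))\<^sup>2 \<le> (N x * N y)\<^sup>2"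
    using False by (simp add: zero_le_mult_iff)
  then show ?thesis
    by (rule power2_le_imp_le) (use N_nonneg assms in auto)
qed

text \<open>First order variation of the norm at \<open>x\<close> in directions orthogonal to \<open>x\<close>.\<close>

lemma norm_attaining_functional:
  assumes f_add: "\<And>y z. y \<in> V \<Longrightarrow> z \<in> V \<Longrightarrow> f (y + z) = f y + f z"
    and f_scale: "\<And>c y. y \<in> V \<Longrightarrow> f (sc c y) = c * f y"
    and f_le: "\<And>y. y \<in> V \<Longrightarrow> cmod (f y) \<le> N y"
    and x: "x \<in> V" "N x = 1" "f x = 1" and y: "y \<in> V"
  shows "f y = ip y x"
proof -
  have ort: "f w = 0" if w: "w \<in> V" "ip w x = 0" for w
  proof (rule ccontr)
    assume "f w \<noteq> 0"
    define a where "a = (cmod (f w))\<^sup>2"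
    have a: "a > 0" using \<open>f w \<noteq> 0\<close> by (simp add: a_def)
    \<comment> \<open>Moving from x in the direction w with the phase of the conjugate of
      \<open>f w\<close> raises f linearly in s, while orthogonality makes the squared norm grow
      only quadratically.\<close>
    have ineq: "2 * s * a \<le> s\<^sup>2 * (a * (N w)\<^sup>2)" if "s > 0" for s :: real
    proof -
      let ?z = "sc 1 x + sc (of_real s * cnj (f w)) w"
      have "f ?z = f (sc 1 x) + f (sc (of_real s * cnj (f w)) w)"
        using x w by (intro f_add) auto
      also have "\<dots> = 1 * f x + of_real s * cnj (f w) * f w"
        using x w by (simp only: f_scale)
      also have "\<dots> = of_real (1 + s * a)"
        by (simp add: x a_def complex_norm_square mult_ac del: of_real_power)
      finally have "cmod (f ?z) = 1 + s * a"
        using a that by (simp only: norm_of_real) simp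
      then have "1 + s * a \<le> N ?z"
        using f_le[of ?z] x w by simp
      then have sq: "(1 + s * a)\<^sup>2 \<le> (N ?z)\<^sup>2"
        using a that by (intro power_mono) auto
      have "1 + 2 * s * a + (s * a)\<^sup>2 \<le> (N ?z)\<^sup>2"
        using sq by (simp add: power2_sum mult.assoc)
      moreover have "(N ?z)\<^sup>2 = 1 + s\<^sup>2 * (a * (N w)\<^sup>2)"
        unfolding N_scale_add[OF x(1) w(1)] using x w ip_commute[of x w]
        by (simp add: a_def norm_mult power_mult_distrib)
      ultimately show ?thesis
        using zero_le_power2[of "s * a"] by linarith
    qed
    \<comment> \<open>With this s the quadratic side of \<open>ineq\<close> is at most s a, which
      contradicts the linear side 2 s a.\<close>
    define s where "s = 1 / (1 + (N w)\<^sup>2)"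
    have s: "s > 0" "s * (N w)\<^sup>2 \<le> 1"
      by (simp_all add: s_def divide_le_eq add_pos_nonneg)
    have "a * (2 * s) \<le> a * (s * (s * (N w)\<^sup>2))"
      using ineq[OF s(1)] by (simp add: power2_eq_square algebra_simps)
    also have "\<dots> \<le> a * (s * 1)"
      using s a by (intro mult_left_mono) auto
    finally show False using s a by simp
  qed
  define w where "w = y - sc (ip y x) x"
  have w: "w \<in> V" using x y by (simp add: w_def)
  have y_eq: "y = w + sc (ip y x) x" by (simp add: w_def)
  have "ip w x = 0"
    using ip_add_left[of w "sc (ip y x) x" x] w x y
    by (simp add: y_eq[symmetric] ip_scale_left ip_self)
  then have "f w = 0" using ort w by blast
  then show ?thesis
    by (subst y_eq) (use w x in \<open>simp add: f_add f_scale\<close>)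
qed

end

section \<open>Elementary identities and the Riesz representation in Hilbert spaces\<close>

interpretation scaleC: vector_space "scaleC :: complex \<Rightarrow> 'h \<Rightarrow> 'h::complex_hilbert"
proof
  show "scaleC 1 x = x" for x :: 'h using scaleC_of_real[of 1 x] by simp
qed (auto simp: scaleC_add_right scaleC_add_left scaleC_scaleC)

interpretation cinner: complex_inner_space scaleC "UNIV :: 'h::complex_hilbert set" cinner norm
  by unfold_locales
    (auto simp: cinner_add_left cinner_scaleC_left cinner_self intro: cinner_commute)

lemma cinner_diff_left: "cinner (x - y) z = cinner x z - cinner y (z :: 'h::complex_hilbert)"
  using cinner_add_left[of "x - y" y z] by simp

lemma cinner_zero_left [simp]: "cinner 0 (z :: 'h::complex_hilbert) = 0"
  using cinner_diff_left[of 0 0 z] by simp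

lemma cinner_zero_right [simp]: "cinner (z :: 'h::complex_hilbert) 0 = 0"
  using cinner_commute[of z 0] by simp

lemma cinner_sum_left: "cinner (\<Sum>i\<in>F. g i) (z :: 'h::complex_hilbert) = (\<Sum>i\<in>F. cinner (g i) z)"
  by (induction F rule: infinite_finite_induct) (auto simp: cinner_add_left)

lemma cinner_sum_right: "cinner (z :: 'h::complex_hilbert) (\<Sum>i\<in>F. g i) = (\<Sum>i\<in>F. cinner z (g i))"
  by (induction F rule: infinite_finite_induct) (auto simp: cinner.ip_add_right)

lemma cinner_eqI:
  assumes "\<And>u. cinner u v = cinner u (w :: 'h::complex_hilbert)"
  shows "v = w"
proof -
  have "cinner (v - w) (v - w) = 0"
    using assms cinner_commute by (metis cinner_diff_left diff_self)
  then show ?thesis by (simp add: cinner_self)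
qed

lemma parallelogram:
  "(norm (u + v))\<^sup>2 + (norm (u - v))\<^sup>2 = 2 * (norm u)\<^sup>2 + 2 * (norm (v :: 'h::complex_hilbert))\<^sup>2"
  using cinner.N_scale_add[of u v 1 1] cinner.N_scale_add[of u v 1 "-1"] by simp

lemma scaleR_eq_scaleC: "r *\<^sub>R (x :: 'h::complex_hilbert) = scaleC (of_real r) x"
  by (simp add: scaleC_of_real)

lemma norm_le_cinnerI:
  assumes "c \<ge> 0" "\<And>v. cmod (cinner u v) \<le> c * norm v"
  shows "norm (u :: 'h::complex_hilbert) \<le> c"
proof (cases "u = 0")
  case False
  have "norm u * norm u \<le> c * norm u"
    using assms(2)[of u] by (simp add: cinner_self power2_eq_square norm_mult)
  then show ?thesis using False by simp
qed (use assms in simp)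

text \<open>A maximising sequence for \<open>f\<close> on the unit sphere is Cauchy by the parallelogram law.\<close>

lemma Riesz_representation:
  fixes f :: "'h::complex_hilbert \<Rightarrow> complex"
  assumes bl: "bounded_linear f" and f_scale: "\<And>c u. f (scaleC c u) = c * f u"
  shows "\<exists>w. \<forall>u. f u = cinner u w"
proof (cases "onorm f = 0")
  case True
  then have "f u = 0" for u using onorm_eq_0[OF bl] by simp
  then show ?thesis by (intro exI[of _ 0]) auto
next
  case False
  define K where "K = onorm f"
  have K: "K > 0" using False onorm_pos_le[OF bl] by (simp add: K_def)
  have f_le: "cmod (f u) \<le> K * norm u" for u
    using onorm[OF bl] by (simp add: K_def)
  have maximising: "\<exists>u. norm u = 1 \<and> f u = of_real (cmod (f u)) \<and> K - e < cmod (f u)" if e: "0 < e" "e \<le> K" for e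
  proof -
    have "\<exists>u. (K - e) * norm u < cmod (f u)"
    proof (rule ccontr)
      assume "\<not> ?thesis"
      then have "onorm f \<le> K - e" using e by (intro onorm_bound) (auto simp: not_less)
      then show False using e by (simp add: K_def)
    qed
    then obtain u where u: "(K - e) * norm u < cmod (f u)" by blast
    moreover have "0 \<le> (K - e) * norm u" using e by simp
    ultimately have fu: "f u \<noteq> 0" by auto
    then have u0: "norm u > 0" using f_le[of u] by (cases "u = 0") auto
    \<comment> \<open>The phase of \<open>a\<close> makes the value of f real and nonnegative, and
      its modulus normalises u.\<close>
    define a where "a = cnj (f u) / of_real (cmod (f u) * norm u)"
    have na: "cmod a = 1 / norm u" using fu u0 by (simp add: a_def norm_divide norm_mult)
    have fa: "f (scaleC a u) = of_real (cmod (f u) / norm u)"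
    proof -
      have "f (scaleC a u) = (f u * cnj (f u)) / of_real (cmod (f u) * norm u)"
        by (simp add: f_scale a_def)
      also have "f u * cnj (f u) = of_real (cmod (f u) * cmod (f u))"
        by (simp add: complex_norm_square[symmetric] power2_eq_square[symmetric])
      finally show ?thesis using fu by simp
    qed
    then have cfa: "cmod (f (scaleC a u)) = cmod (f u) / norm u"
      by (simp only: norm_of_real) simp
    show ?thesis
    proof (intro exI[of _ "scaleC a u"] conjI)
      show "norm (scaleC a u) = 1" using u0 na by (simp add: norm_scaleC)
      show "f (scaleC a u) = of_real (cmod (f (scaleC a u)))" unfolding cfa by (rule fa)
      show "K - e < cmod (f (scaleC a u))" using u u0 by (simp add: cfa less_divide_eq)
    qed
  qed
  have "\<forall>n. \<exists>u. norm u = 1 \<and> f u = of_real (cmod (f u)) \<and> K - K / real (Suc n) < cmod (f u)"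
  proof
    fix n
    have "K / real (Suc n) \<le> K" "K / real (Suc n) > 0" using K by (simp_all add: divide_le_eq)
    then show "\<exists>u. norm u = 1 \<and> f u = of_real (cmod (f u)) \<and> K - K / real (Suc n) < cmod (f u)"
      by (rule maximising[rotated])
  qed
  from choice[OF this] obtain U where U': "\<forall>n. norm (U n) = 1 \<and> f (U n) = of_real (cmod (f (U n)))
      \<and> K - K / real (Suc n) < cmod (f (U n))"
    by blast
  then have U: "norm (U n) = 1" "f (U n) = of_real (cmod (f (U n)))" "K - K / real (Suc n) < cmod (f (U n))" for n
    by blast+
  have fU: "(\<lambda>n. f (U n)) \<longlonglongrightarrow> of_real K"
  proof -
    have "(\<lambda>n. cmod (f (U n))) \<longlonglongrightarrow> K"
    proof (rule tendsto_sandwich)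
      show "\<forall>\<^sub>F n in sequentially. K - K / real (Suc n) \<le> cmod (f (U n))"
        using U(3) by (auto intro: always_eventually less_imp_le)
      show "\<forall>\<^sub>F n in sequentially. cmod (f (U n)) \<le> K"
      proof (intro always_eventually allI)
        show "cmod (f (U n)) \<le> K" for n using f_le[of "U n"] U(1)[of n] by simp
      qed
      have "(\<lambda>n. K - K / real (Suc n)) \<longlonglongrightarrow> K - 0"
        using LIMSEQ_Suc[OF lim_const_over_n[of K]] by (intro tendsto_intros) auto
      then show "(\<lambda>n. K - K / real (Suc n)) \<longlonglongrightarrow> K" by simp
    qed auto
    then have "(\<lambda>n. complex_of_real (cmod (f (U n)))) \<longlonglongrightarrow> of_real K" by (rule tendsto_of_real)
    then show ?thesis by (simp only: U(2)[symmetric])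
  qed
  have "Cauchy U"
  proof (rule CauchyI)
    fix e :: real assume e: "e > 0"
    \<comment> \<open>The parallelogram law turns the lower bound 4 - 8 d for the squared norm of
      the sum into an upper bound 8 d for that of the difference.\<close>
    define d where "d = e\<^sup>2 / 8"
    have d: "d > 0" using e by (simp add: d_def)
    obtain m where m: "inverse (real (Suc m)) < d"
      using reals_Archimedean[OF d] by blast
    have "norm (U p - U r) < e" if "p \<ge> m" "r \<ge> m" for p r
    proof -
      have lo: "K * (1 - d) \<le> cmod (f (U n))" if "n \<ge> m" for n
      proof -
        have "1 / real (Suc n) \<le> 1 / real (Suc m)" using that by (intro divide_left_mono) auto
        also have "\<dots> \<le> d" using m by (simp only: inverse_eq_divide less_imp_le)
        finally have "K * (1 / real (Suc n)) \<le> K * d" by (rule mult_left_mono) (use K in simp)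
        moreover have "K * (1 / real (Suc n)) = K / real (Suc n)" "K * (1 - d) = K - K * d"
          by (simp_all add: right_diff_distrib)
        ultimately show ?thesis using U(3)[of n] by linarith
      qed
      have "f (U p + U r) = of_real (cmod (f (U p)) + cmod (f (U r)))"
        using U(2)[of p] U(2)[of r] linear_add[OF bounded_linear.linear[OF bl], of "U p" "U r"] by simp
      then have "cmod (f (U p + U r)) = cmod (f (U p)) + cmod (f (U r))"
        by (simp del: of_real_add)
      then have "K * (2 * (1 - d)) \<le> K * norm (U p + U r)"
        using lo[of p] lo[of r] that f_le[of "U p + U r"] by (simp add: algebra_simps)
      then have ge: "2 * (1 - d) \<le> norm (U p + U r)" using K by simp
      have "4 - 8 * d < (norm (U p + U r))\<^sup>2"
      proof (cases "d < 1")
        case True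
        then have "(2 * (1 - d))\<^sup>2 \<le> (norm (U p + U r))\<^sup>2" using ge by (intro power_mono) auto
        moreover have "(2 * (1 - d))\<^sup>2 = 4 - 8 * d + 4 * d\<^sup>2"
          by (simp add: power2_eq_square algebra_simps)
        moreover have "d\<^sup>2 > 0" using d by simp
        ultimately show ?thesis by linarith
      next
        case False
        then show ?thesis using zero_le_power2[of "norm (U p + U r)"] by linarith
      qed
      then have "(norm (U p - U r))\<^sup>2 < e\<^sup>2"
        using parallelogram[of "U p" "U r"] U(1) by (simp add: d_def)
      then show ?thesis using e by (simp add: power2_less_imp_less)
    qed
    then show "\<exists>m. \<forall>p\<ge>m. \<forall>r\<ge>m. norm (U p - U r) < e" by blast
  qed
  then obtain u where u: "U \<longlonglongrightarrow> u" using Cauchy_convergent_iff convergent_def by blast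
  have nu: "norm u = 1"
    using tendsto_norm[OF u] U(1) by (simp add: LIMSEQ_const_iff)
  have "(\<lambda>n. f (U n)) \<longlonglongrightarrow> f u"
    using bounded_linear.tendsto[OF bl u] .
  then have fu: "f u = of_real K" using fU LIMSEQ_unique by blast
  \<comment> \<open>After division by K the functional is bounded by the norm and takes the value
    one at the unit vector u, so it is determined by u.\<close>
  have "f y / of_real K = cinner y u" for y
  proof (rule cinner.norm_attaining_functional[where f = "\<lambda>y. f y / of_real K"])
    show "f (y + z) / of_real K = f y / of_real K + f z / of_real K" for y z
      using linear_add[OF bounded_linear.linear[OF bl]] by (simp add: add_divide_distrib)
    show "cmod (f y / of_real K) \<le> norm y" for y
      using f_le[of y] K by (simp add: norm_divide field_simps)
  qed (use nu fu K f_scale in auto)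
  then have "f y = cinner y (scaleC (of_real K) u)" for y
    using K by (simp add: cinner.ip_scale_right field_simps)
  then show ?thesis by blast
qed

section \<open>Adjoints of complex linear bounded operators\<close>

definition clinear_operators :: "('h::complex_hilbert \<Rightarrow>\<^sub>L 'h) set" where
  "clinear_operators = {A. \<forall>c u. blinfun_apply A (scaleC c u) = scaleC c (blinfun_apply A u)}"

lemma clinearD: "A \<in> clinear_operators \<Longrightarrow> blinfun_apply A (scaleC c u) = scaleC c (blinfun_apply A u)"
  by (simp add: clinear_operators_def)

text \<open>\<open>adj\<close> is a definite description, so existence must be shown: Riesz supplies
  a vector for each v, and testing against all u makes the resulting map linear, bounded and
  unique.\<close>

lemma cinner_adj:
  assumes "A \<in> clinear_operators"
  shows "cinner (blinfun_apply A u) v = cinner u (blinfun_apply (adj A) v)"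
proof -
  have "\<exists>w. \<forall>u. cinner (A u) v = cinner u w" for v
  proof (rule Riesz_representation)
    show "bounded_linear (\<lambda>u. cinner (A u) v)"
    proof (rule bounded_linear_intro)
      fix u :: 'a
      have "cmod (cinner (A u) v) \<le> norm (A u) * norm v" using cinner.Cauchy_Schwarz by simp
      also have "\<dots> \<le> (norm A * norm u) * norm v" by (intro mult_right_mono norm_blinfun) auto
      finally show "cmod (cinner (A u) v) \<le> norm u * (norm A * norm v)" by (simp add: mult_ac)
    qed (simp_all add: blinfun.add_right blinfun.scaleR_right cinner_add_left scaleR_eq_scaleC
        cinner_scaleC_left scaleR_conv_of_real assms clinearD)
    show "cinner (A (scaleC c u)) v = c * cinner (A u) v" for c u
      using assms by (simp add: clinearD cinner_scaleC_left)
  qed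
  then obtain B where B: "\<And>u v. cinner (A u) v = cinner u (B v)" by metis
  have "bounded_linear B"
  proof (rule bounded_linear_intro)
    show "B (x + y) = B x + B y" for x y
      by (rule cinner_eqI) (simp add: B[symmetric] cinner.ip_add_right)
    show "B (r *\<^sub>R x) = r *\<^sub>R B x" for r x
      by (rule cinner_eqI) (simp add: B[symmetric] cinner.ip_scale_right scaleR_eq_scaleC)
    fix x
    show "norm (B x) \<le> norm x * norm A"
    proof (rule norm_le_cinnerI)
      show "0 \<le> norm x * norm A" by simp
      fix v
      have "cmod (cinner (B x) v) = cmod (cinner (A v) x)"
        using B[of v x] cinner_commute[of "B x" v] by simp
      also have "\<dots> \<le> norm (A v) * norm x" using cinner.Cauchy_Schwarz by simp
      also have "\<dots> \<le> (norm A * norm v) * norm x" by (intro mult_right_mono norm_blinfun) auto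
      finally show "cmod (cinner (B x) v) \<le> norm x * norm A * norm v" by (simp add: mult_ac)
    qed
  qed
  then have ex: "\<forall>u v. cinner (A u) v = cinner u (Blinfun B v)"
    using B by (simp add: bounded_linear_Blinfun_apply)
  have "\<forall>u v. cinner (A u) v = cinner u (adj A v)"
    unfolding adj_def
  proof (rule theI)
    fix C assume C: "\<forall>u v. cinner (A u) v = cinner u (blinfun_apply C v)"
    show "C = Blinfun B"
      by (rule blinfun_eqI, rule cinner_eqI) (metis C ex)
  qed (rule ex)
  then show ?thesis by blast
qed

text \<open>Once a candidate is at hand, uniqueness alone identifies the adjoint; this is how
  adjoints of concrete operators are computed.\<close>

lemma adj_eqI:
  assumes "\<And>u v. cinner (blinfun_apply A u) v = cinner u (blinfun_apply B v)"
  shows "adj A = B"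
  unfolding adj_def
proof (rule the_equality)
  show "C = B" if "\<forall>u v. cinner (blinfun_apply A u) v = cinner u (blinfun_apply C v)" for C
    by (rule blinfun_eqI, rule cinner_eqI) (metis assms that)
qed (use assms in blast)


section \<open>Spaces of square summable columns\<close>

lemma L2_set_reindex: "inj_on h F \<Longrightarrow> L2_set f (h ` F) = L2_set (\<lambda>x. f (h x)) F"
  by (simp add: L2_set_def sum.reindex)

definition unit_at :: "nat \<Rightarrow> 'b::zero \<Rightarrow> nat \<Rightarrow> 'b" where
  "unit_at m a = (\<lambda>j. if j = m then a else 0)"

definition truncation :: "nat \<Rightarrow> (nat \<Rightarrow> 'b) \<Rightarrow> nat \<Rightarrow> 'b::zero" where
  "truncation n x = (\<lambda>j. if j < n then x j else 0)"

text \<open>Links the interval sums of the Cauchy criterion to the arbitrary finite index sets used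
  for column spaces, which can be pushed forward and pulled back along \<open>Suc\<close>.\<close>

lemma sum_tail_set_le:
  fixes f :: "nat \<Rightarrow> real"
  assumes "\<And>j. 0 \<le> f j" "\<And>n. (\<Sum>j=N..<n. f j) \<le> e" "finite F" "F \<subseteq> {N..}"
  shows "sum f F \<le> e"
proof -
  have "F \<subseteq> {N..<Suc (Max F)}"
    using assms(3,4) Max_ge[of F] by (auto simp: less_Suc_eq_le)
  then have "sum f F \<le> (\<Sum>j=N..<Suc (Max F). f j)"
    using assms by (intro sum_mono2) auto
  then show ?thesis using assms(2)[of "Suc (Max F)"] by linarith
qed

text \<open>
  Common description of \<open>l2\<close> and of the standard Hilbert module: the norm is a supremum of
  Hilbert norms of scalar sequences.  For the module, \<open>q u A\<close> will be \<open>norm (A u) / norm u\<close>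
  (which is 0 at \<open>u = 0\<close>).
\<close>

locale column_space =
  fixes X :: "(nat \<Rightarrow> 'b::real_normed_vector) cns" and K :: "'b set"
    and sc :: "complex \<Rightarrow> 'b \<Rightarrow> 'b" and q :: "'i \<Rightarrow> 'b \<Rightarrow> real"
  assumes sc: "vector_space sc" and K: "module.subspace sc K"
    and sc_real: "sc (of_real r) a = r *\<^sub>R a"
    and q_nonneg: "0 \<le> q i a"
    and q_add: "q i (a + b) \<le> q i a + q i b"
    and q_scale: "q i (sc c a) = cmod c * q i a"
    and q_le: "q i a \<le> norm a"
    and norm_leI: "(\<And>i. q i a \<le> r) \<Longrightarrow> norm a \<le> r"
    and cscale: "cscale X = (\<lambda>c x j. sc c (x j))"
    and carrier_iff: "x \<in> carrier X \<longleftrightarrow> (\<forall>j. x j \<in> K) \<and>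
        (\<forall>\<epsilon>>0. \<exists>N. \<forall>F i. finite F \<longrightarrow> F \<subseteq> {N..} \<longrightarrow> L2_set (\<lambda>j. q i (x j)) F \<le> \<epsilon>)"
    and nrm_nonneg: "x \<in> carrier X \<Longrightarrow> 0 \<le> nrm X x"
    and nrm_le_iff: "x \<in> carrier X \<Longrightarrow> 0 \<le> r \<Longrightarrow>
        nrm X x \<le> r \<longleftrightarrow> (\<forall>F i. finite F \<longrightarrow> L2_set (\<lambda>j. q i (x j)) F \<le> r)"
begin

sublocale sc: vector_space sc by (rule sc)

lemma vector_space_cscale: "vector_space (cscale X)"
  unfolding cscale
  by unfold_locales
    (auto simp: fun_eq_iff sc.scale_right_distrib sc.scale_left_distrib)

sublocale cs: vector_space "cscale X" by (rule vector_space_cscale)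

lemma K_closed: "a \<in> K \<Longrightarrow> b \<in> K \<Longrightarrow> a + b \<in> K" "a \<in> K \<Longrightarrow> sc c a \<in> K" "0 \<in> K"
  using K by (auto simp: sc.subspace_add sc.subspace_scale sc.subspace_0)

lemma K_scaleR: "a \<in> K \<Longrightarrow> r *\<^sub>R a \<in> K"
  using K_closed(2)[of a "of_real r"] by (simp add: sc_real)

lemma q_0 [simp]: "q i 0 = 0"
  using q_le[of i 0] q_nonneg[of i 0] by simp

lemma L2_q_add:
  "L2_set (\<lambda>j. q i ((x + y) j)) F \<le> L2_set (\<lambda>j. q i (x j)) F + L2_set (\<lambda>j. q i (y j)) F"
proof -
  have "L2_set (\<lambda>j. q i ((x + y) j)) F \<le> L2_set (\<lambda>j. q i (x j) + q i (y j)) F"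
    by (intro L2_set_mono) (auto simp: q_add q_nonneg)
  also have "\<dots> \<le> L2_set (\<lambda>j. q i (x j)) F + L2_set (\<lambda>j. q i (y j)) F"
    by (rule L2_set_triangle_ineq)
  finally show ?thesis .
qed

lemma L2_q_scale: "L2_set (\<lambda>j. q i (cscale X c x j)) F = cmod c * L2_set (\<lambda>j. q i (x j)) F"
  by (simp add: cscale q_scale L2_set_right_distrib)

lemma carrierI:
  assumes "\<And>j. x j \<in> K"
    "\<And>\<epsilon>. \<epsilon> > 0 \<Longrightarrow> \<exists>N. \<forall>F i. finite F \<longrightarrow> F \<subseteq> {N..} \<longrightarrow> L2_set (\<lambda>j. q i (x j)) F \<le> \<epsilon>"
  shows "x \<in> carrier X"
  using assms by (auto simp: carrier_iff)

lemma carrierD: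
  assumes "x \<in> carrier X" "\<epsilon> > 0"
  obtains N where "\<And>F i. finite F \<Longrightarrow> F \<subseteq> {N..} \<Longrightarrow> L2_set (\<lambda>j. q i (x j)) F \<le> \<epsilon>"
  using assms unfolding carrier_iff by blast

lemma carrier_coord: "x \<in> carrier X \<Longrightarrow> x j \<in> K"
  by (simp add: carrier_iff)

lemma carrier_add:
  assumes x: "x \<in> carrier X" and y: "y \<in> carrier X"
  shows "x + y \<in> carrier X"
proof (rule carrierI)
  fix \<epsilon> :: real assume "\<epsilon> > 0"
  then have "\<epsilon> / 2 > 0" by simp
  obtain N1 where N1: "\<And>F i. finite F \<Longrightarrow> F \<subseteq> {N1..} \<Longrightarrow> L2_set (\<lambda>j. q i (x j)) F \<le> \<epsilon> / 2"
    using carrierD[OF x \<open>\<epsilon> / 2 > 0\<close>] by blast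
  obtain N2 where N2: "\<And>F i. finite F \<Longrightarrow> F \<subseteq> {N2..} \<Longrightarrow> L2_set (\<lambda>j. q i (y j)) F \<le> \<epsilon> / 2"
    using carrierD[OF y \<open>\<epsilon> / 2 > 0\<close>] by blast
  show "\<exists>N. \<forall>F i. finite F \<longrightarrow> F \<subseteq> {N..} \<longrightarrow> L2_set (\<lambda>j. q i ((x + y) j)) F \<le> \<epsilon>"
  proof (intro exI[of _ "max N1 N2"] allI impI)
    fix F i assume F: "finite F" "F \<subseteq> {max N1 N2..}"
    then have "F \<subseteq> {N1..}" "F \<subseteq> {N2..}" by auto
    then show "L2_set (\<lambda>j. q i ((x + y) j)) F \<le> \<epsilon>"
      using L2_q_add[of i x y F] N1[OF F(1), of i] N2[OF F(1), of i] by linarith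
  qed
qed (use x y in \<open>auto simp: K_closed carrier_coord\<close>)

lemma carrier_cscale:
  assumes x: "x \<in> carrier X"
  shows "cscale X c x \<in> carrier X"
proof (rule carrierI)
  fix \<epsilon> :: real assume \<epsilon>: "\<epsilon> > 0"
  then have "\<epsilon> / (cmod c + 1) > 0" by (simp add: add_nonneg_pos)
  then obtain N where N: "\<And>F i. finite F \<Longrightarrow> F \<subseteq> {N..} \<Longrightarrow> L2_set (\<lambda>j. q i (x j)) F \<le> \<epsilon> / (cmod c + 1)"
    using carrierD[OF x] by blast
  have "\<epsilon> * cmod c \<le> \<epsilon> * (cmod c + 1)"
    using \<epsilon> by (intro mult_left_mono) auto
  then have "cmod c * (\<epsilon> / (cmod c + 1)) \<le> \<epsilon>"
    by (simp add: divide_le_eq add_nonneg_pos mult.commute)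
  then show "\<exists>N. \<forall>F i. finite F \<longrightarrow> F \<subseteq> {N..} \<longrightarrow> L2_set (\<lambda>j. q i (cscale X c x j)) F \<le> \<epsilon>"
    unfolding L2_q_scale using N mult_left_mono[OF N norm_ge_zero[of c]] by (meson order_trans)
qed (use x in \<open>auto simp: cscale K_closed carrier_coord\<close>)

lemma carrier_eventually_zero:
  assumes "\<And>j. x j \<in> K" "\<And>j. j \<ge> N \<Longrightarrow> x j = 0"
  shows "x \<in> carrier X"
proof (rule carrierI)
  fix \<epsilon> :: real assume "\<epsilon> > 0"
  have "L2_set (\<lambda>j. q i (x j)) F = L2_set (\<lambda>j. 0) F" if "F \<subseteq> {N..}" for F i
    using that assms(2) by (intro L2_set_cong) auto
  then show "\<exists>N. \<forall>F i. finite F \<longrightarrow> F \<subseteq> {N..} \<longrightarrow> L2_set (\<lambda>j. q i (x j)) F \<le> \<epsilon>"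
    using \<open>\<epsilon> > 0\<close> by (intro exI[of _ N]) (simp add: L2_set_def)
qed (rule assms)

lemma carrier_subspace: "cs.subspace (carrier X)"
  unfolding cs.subspace_def
  using carrier_add carrier_cscale carrier_eventually_zero[of 0] K_closed by auto

lemma carrier_diff: "x \<in> carrier X \<Longrightarrow> y \<in> carrier X \<Longrightarrow> x - y \<in> carrier X"
  using cs.subspace_diff carrier_subspace by blast

lemma carrier_0: "0 \<in> carrier X"
  using cs.subspace_0 carrier_subspace by blast

lemma nrm_leI:
  assumes "x \<in> carrier X" "0 \<le> r" "\<And>F i. finite F \<Longrightarrow> L2_set (\<lambda>j. q i (x j)) F \<le> r"
  shows "nrm X x \<le> r"
  using assms nrm_le_iff by blast

lemma L2_le_nrm:
  assumes "x \<in> carrier X" "finite F"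
  shows "L2_set (\<lambda>j. q i (x j)) F \<le> nrm X x"
  using assms nrm_le_iff[of x "nrm X x"] nrm_nonneg by blast

lemma nrm_triangle:
  assumes "x \<in> carrier X" "y \<in> carrier X"
  shows "nrm X (x + y) \<le> nrm X x + nrm X y"
proof (rule nrm_leI)
  fix F i assume "finite (F :: nat set)"
  then show "L2_set (\<lambda>j. q i ((x + y) j)) F \<le> nrm X x + nrm X y"
    using L2_q_add[of i x y F] L2_le_nrm[OF assms(1), of F i] L2_le_nrm[OF assms(2), of F i] by linarith
qed (use assms in \<open>auto simp: carrier_add nrm_nonneg\<close>)

lemma norm_coord_le:
  assumes "x \<in> carrier X"
  shows "norm (x j) \<le> nrm X x"
proof (rule norm_leI)
  fix i
  show "q i (x j) \<le> nrm X x"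
    using L2_le_nrm[OF assms, of "{j}" i] by (simp add: q_nonneg)
qed

lemma nrm_eq_0:
  assumes "x \<in> carrier X"
  shows "nrm X x = 0 \<longleftrightarrow> x = 0"
proof
  assume "nrm X x = 0"
  then show "x = 0" using norm_coord_le[OF assms] by (auto simp: fun_eq_iff)
next
  assume "x = 0"
  then have "nrm X x \<le> 0" using assms by (intro nrm_leI) (auto simp: L2_set_def)
  then show "nrm X x = 0" using nrm_nonneg[OF assms] by simp
qed

lemma nrm_cscale:
  assumes "x \<in> carrier X"
  shows "nrm X (cscale X c x) = cmod c * nrm X x"
proof -
  have le: "nrm X (cscale X c y) \<le> cmod c * nrm X y" if y: "y \<in> carrier X" for c y
    unfolding nrm_le_iff[OF carrier_cscale[OF y] mult_nonneg_nonneg[OF norm_ge_zero nrm_nonneg[OF y]]]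
    unfolding L2_q_scale using L2_le_nrm[OF y] by (auto intro!: mult_left_mono)
  show ?thesis
  proof (cases "c = 0")
    case True
    then show ?thesis using nrm_eq_0[OF carrier_0] by simp
  next
    case False
    then have "nrm X x \<le> cmod (inverse c) * nrm X (cscale X c x)"
      using le[OF carrier_cscale[OF assms], of "inverse c" c] by simp
    then have "cmod c * nrm X x \<le> nrm X (cscale X c x)"
      using False by (simp add: norm_inverse pos_le_divide_eq mult.commute flip: divide_inverse_commute)
    then show ?thesis using le[OF assms, of c] by linarith
  qed
qed

lemma cscale_of_real: "cscale X (of_real r) x j = r *\<^sub>R x j"
  by (simp add: cscale sc_real)

lemma nrm_minus: "x \<in> carrier X \<Longrightarrow> nrm X (- x) = nrm X x"
  using nrm_cscale[of x "-1"] by simp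

lemma nrm_diff_commute: "x \<in> carrier X \<Longrightarrow> y \<in> carrier X \<Longrightarrow> nrm X (x - y) = nrm X (y - x)"
  using nrm_minus[of "x - y"] carrier_diff[of x y] by simp

lemma nrm_triangle_diff:
  "x \<in> carrier X \<Longrightarrow> y \<in> carrier X \<Longrightarrow> z \<in> carrier X \<Longrightarrow> nrm X (x - z) \<le> nrm X (x - y) + nrm X (y - z)"
  using nrm_triangle[of "x - y" "y - z"] carrier_diff by simp

sublocale ms: Metric_space "carrier X" "cns_dist X"
proof
  show "cns_dist X x y = 0 \<longleftrightarrow> x = y" if "x \<in> carrier X" "y \<in> carrier X" for x y
    using that nrm_eq_0[OF carrier_diff[OF that]] by (simp add: cns_dist_def)
qed (auto simp: cns_dist_def nrm_nonneg carrier_diff nrm_diff_commute nrm_triangle_diff)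

lemma mem_mball_iff: "y \<in> ms.mball x r \<longleftrightarrow> x \<in> carrier X \<and> y \<in> carrier X \<and> nrm X (x - y) < r"
  by (auto simp: ms.mball_def cns_dist_def)

lemma in_closure_iff:
  "x \<in> norm_topology X closure_of S \<longleftrightarrow>
     x \<in> carrier X \<and> (\<forall>r>0. \<exists>y\<in>S. y \<in> carrier X \<and> nrm X (x - y) < r)"
  unfolding ms.metric_closure_of mem_Collect_eq Bex_def mem_mball_iff
  by (metis zero_less_one)

text \<open>A crude l1 estimate that suffices wherever a column is explicit: for single entries, and
  for the geometrically small errors in the supercyclicity proof.\<close>

lemma carrier_summable:
  assumes x: "\<And>j. x j \<in> K" and s: "summable (\<lambda>j. norm (x j))"
  shows "x \<in> carrier X" and "nrm X x \<le> (\<Sum>j. norm (x j))"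
proof -
  have L: "L2_set (\<lambda>j. q i (x j)) F \<le> (\<Sum>j\<in>F. norm (x j))" for i F
  proof -
    have "L2_set (\<lambda>j. q i (x j)) F \<le> (\<Sum>j\<in>F. \<bar>q i (x j)\<bar>)" by (rule L2_set_le_sum_abs)
    also have "\<dots> \<le> (\<Sum>j\<in>F. norm (x j))" by (intro sum_mono) (simp add: q_nonneg q_le)
    finally show ?thesis .
  qed
  show xc: "x \<in> carrier X"
  proof (rule carrierI)
    fix \<epsilon> :: real assume "\<epsilon> > 0"
    then obtain N where N: "\<And>m n. m \<ge> N \<Longrightarrow> norm (\<Sum>j=m..<n. norm (x j)) < \<epsilon>"
      using s unfolding summable_Cauchy by blast
    show "\<exists>N. \<forall>F i. finite F \<longrightarrow> F \<subseteq> {N..} \<longrightarrow> L2_set (\<lambda>j. q i (x j)) F \<le> \<epsilon>"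
    proof (intro exI[of _ N] allI impI)
      fix F i assume F: "finite F" "F \<subseteq> {N..}"
      have "(\<Sum>j=N..<n. norm (x j)) \<le> \<epsilon>" for n
        using N[of N n] by simp
      then have "(\<Sum>j\<in>F. norm (x j)) \<le> \<epsilon>"
        by (intro sum_tail_set_le[OF _ _ F]) auto
      then show "L2_set (\<lambda>j. q i (x j)) F \<le> \<epsilon>"
        using L[of i F] by simp
    qed
  qed (rule x)
  show "nrm X x \<le> (\<Sum>j. norm (x j))"
  proof (rule nrm_leI[OF xc])
    show "0 \<le> (\<Sum>j. norm (x j))" using s by (simp add: suminf_nonneg)
    show "L2_set (\<lambda>j. q i (x j)) F \<le> (\<Sum>j. norm (x j))" if "finite F" for F i
      using L[of i F] sum_le_suminf[OF s that] by simp
  qed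
qed

lemma unit_at_carrier: "a \<in> K \<Longrightarrow> unit_at m a \<in> carrier X"
  by (rule carrier_eventually_zero[of _ "Suc m"]) (auto simp: unit_at_def K_closed)

lemma nrm_unit_at_le:
  assumes "a \<in> K"
  shows "nrm X (unit_at m a) \<le> norm a"
proof -
  have s: "(\<lambda>j. norm (unit_at m a j)) sums norm a"
    using sums_single[of m "\<lambda>_. norm a"] by (simp add: unit_at_def if_distrib cong: if_cong)
  have "nrm X (unit_at m a) \<le> (\<Sum>j. norm (unit_at m a j))"
    using assms s by (intro carrier_summable) (auto simp: unit_at_def K_closed sums_iff)
  then show ?thesis using s by (simp add: sums_iff)
qed

lemma truncation_carrier: "x \<in> carrier X \<Longrightarrow> truncation n x \<in> carrier X"
  by (rule carrier_eventually_zero[of _ n]) (auto simp: truncation_def carrier_coord K_closed)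

lemma truncation_approx:
  assumes x: "x \<in> carrier X" and "\<epsilon> > 0"
  shows "\<exists>N. \<forall>n\<ge>N. nrm X (truncation n x - x) \<le> \<epsilon>"
proof -
  obtain N where N: "\<And>F i. finite F \<Longrightarrow> F \<subseteq> {N..} \<Longrightarrow> L2_set (\<lambda>j. q i (x j)) F \<le> \<epsilon>"
    using carrierD[OF x \<open>\<epsilon> > 0\<close>] by blast
  have "nrm X (truncation n x - x) \<le> \<epsilon>" if "n \<ge> N" for n
    unfolding nrm_diff_commute[OF truncation_carrier[OF x] x]
  proof (rule nrm_leI)
    fix F i assume F: "finite (F :: nat set)"
    have "L2_set (\<lambda>j. q i ((x - truncation n x) j)) F \<le> L2_set (\<lambda>j. q i (x j)) (F \<inter> {n..})"
      unfolding L2_set_def truncation_def using F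
      by (intro real_sqrt_le_mono) (simp add: sum.inter_restrict if_distrib cong: if_cong, intro sum_mono, auto)
    also have "\<dots> \<le> \<epsilon>" using F that by (intro N) auto
    finally show "L2_set (\<lambda>j. q i ((x - truncation n x) j)) F \<le> \<epsilon>" .
  qed (use x \<open>\<epsilon> > 0\<close> in \<open>auto simp: carrier_diff truncation_carrier\<close>)
  then show ?thesis by blast
qed

text \<open>Perturbations leave the unit sphere and have to be scaled back. Going from x to z costs
  s, and rescaling z costs its deviation from norm one, again at most s; hence the factor 2.\<close>

lemma normalise:
  assumes x: "x \<in> carrier X" "nrm X x = 1" and z: "z \<in> carrier X" "nrm X (z - x) \<le> s" "s < 1"
  shows "nrm X z > 0" "\<bar>nrm X z - 1\<bar> \<le> s"
    "cscale X (of_real (1 / nrm X z)) z \<in> unit_sphere X"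
    "nrm X (x - cscale X (of_real (1 / nrm X z)) z) \<le> 2 * s"
proof -
  have "nrm X z \<le> nrm X (z - x) + nrm X x" "nrm X x \<le> nrm X (x - z) + nrm X z"
    using nrm_triangle[OF carrier_diff[OF z(1) x(1)] x(1)] nrm_triangle[OF carrier_diff[OF x(1) z(1)] z(1)]
    by auto
  then show n: "\<bar>nrm X z - 1\<bar> \<le> s" and pos: "nrm X z > 0"
    using x z nrm_diff_commute[OF x(1) z(1)] by auto
  let ?z = "cscale X (of_real (1 / nrm X z)) z"
  show "?z \<in> unit_sphere X"
    using z pos by (simp add: unit_sphere_def carrier_cscale nrm_cscale norm_divide)
  have "z - ?z = cscale X (of_real (1 - 1 / nrm X z)) z"
    by (simp add: cs.scale_left_diff_distrib)
  then have "nrm X (z - ?z) = \<bar>1 - 1 / nrm X z\<bar> * nrm X z"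
    by (simp only: nrm_cscale[OF z(1)] norm_of_real)
  also have "\<dots> = \<bar>nrm X z - 1\<bar>"
    using pos by (simp add: abs_if field_simps)
  finally have "nrm X (z - ?z) \<le> s" using n by simp
  then show "nrm X (x - ?z) \<le> 2 * s"
    using nrm_triangle_diff[OF x(1) z(1) carrier_cscale[OF z(1)], of "of_real (1 / nrm X z)"] z
      nrm_diff_commute[OF x(1) z(1)] by simp
qed

end


section \<open>Shift operators\<close>

definition dshift :: "(nat \<Rightarrow> 'b::real_vector) \<Rightarrow> nat \<Rightarrow> 'b" where
  "dshift x = (\<lambda>j. if j = 0 then 0 else 2 *\<^sub>R x (j - 1))"

definition bshift :: "(nat \<Rightarrow> 'b) \<Rightarrow> nat \<Rightarrow> 'b" where
  "bshift x = (\<lambda>j. x (Suc j))"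

lemma dshift_funpow: "(dshift ^^ n) x j = (if j < n then 0 else 2 ^ n *\<^sub>R x (j - n))"
  by (induction n arbitrary: j) (auto simp: dshift_def)

lemma bshift_funpow: "(bshift ^^ n) x j = x (j + n)"
  by (induction n arbitrary: j) (auto simp: bshift_def)

text \<open>The orbit consists of the multiples with scalar 1. Thus one negative result on
  supercyclicity of \<open>dshift\<close> serves both spaces.\<close>

lemma subspace_hypercyclic_imp_supercyclic:
  assumes "vector_space (cscale X)" "subspace_hypercyclic X T"
  shows "subspace_supercyclic X T"
proof -
  interpret vector_space "cscale X" by (rule assms)
  obtain M x where M: "closed_subspace_dim_ge2 X M" "x \<in> carrier X"
      "dense_in X ({(T ^^ n) x | n. True} \<inter> M) M"
    using assms by (auto simp: subspace_hypercyclic_def)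
  have "{(T ^^ n) x | n. True} \<inter> M \<subseteq> {cscale X c ((T ^^ n) x) | c n. True} \<inter> M"
    by clarsimp (metis scale_one)
  then have "dense_in X ({cscale X c ((T ^^ n) x) | c n. True} \<inter> M) M"
    using M(3) closure_of_mono unfolding dense_in_def by blast
  then show ?thesis using M by (auto simp: subspace_supercyclic_def)
qed

context column_space
begin

lemma q_scaleR: "q i (r *\<^sub>R a) = \<bar>r\<bar> * q i a"
  using q_scale[of i "of_real r" a] by (simp add: sc_real)

lemma L2_dshift:
  "L2_set (\<lambda>j. q i (dshift x j)) F = 2 * L2_set (\<lambda>j. q i (x j)) (Suc -` F)"
proof -
  have im: "Suc ` (Suc -` F) = F \<inter> {0<..}"
    by (simp only: image_vimage_eq greaterThan_0)
  show ?thesis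
  proof (cases "finite F")
    case True
    have "(\<Sum>j\<in>F. (q i (dshift x j))\<^sup>2) = (\<Sum>j\<in>Suc ` (Suc -` F). (q i (dshift x j))\<^sup>2)"
      unfolding im using True by (intro sum.mono_neutral_right) (auto simp: dshift_def)
    also have "\<dots> = (\<Sum>j\<in>Suc -` F. (2 * q i (x j))\<^sup>2)"
      unfolding sum.reindex[OF inj_Suc] by (simp add: dshift_def q_scaleR)
    finally have "L2_set (\<lambda>j. q i (dshift x j)) F = L2_set (\<lambda>j. 2 * q i (x j)) (Suc -` F)"
      by (simp add: L2_set_def)
    then show ?thesis by (simp add: L2_set_right_distrib)
  next
    \<comment> \<open>\<open>L2_set\<close> is 0 over an infinite set. The preimage under
      \<open>Suc\<close> stays infinite because at most the index 0 is lost, so both sides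
      vanish.\<close>
    case False
    have "F \<subseteq> insert 0 (F \<inter> {0<..})" by auto
    then have "infinite (Suc ` (Suc -` F))" unfolding im using False finite_subset by blast
    then have "infinite (Suc -` F)" by blast
    then show ?thesis using False by simp
  qed
qed

lemma dshift_carrier:
  assumes x: "x \<in> carrier X"
  shows "dshift x \<in> carrier X"
proof (rule carrierI)
  show "dshift x j \<in> K" for j
    using carrier_coord[OF x] by (simp add: dshift_def K_closed K_scaleR)
  fix \<epsilon> :: real assume "\<epsilon> > 0"
  then have "\<epsilon> / 2 > 0" by simp
  then obtain N where N: "\<And>F i. finite F \<Longrightarrow> F \<subseteq> {N..} \<Longrightarrow> L2_set (\<lambda>j. q i (x j)) F \<le> \<epsilon> / 2"
    using carrierD[OF x] by blast
  show "\<exists>N. \<forall>F i. finite F \<longrightarrow> F \<subseteq> {N..} \<longrightarrow> L2_set (\<lambda>j. q i (dshift x j)) F \<le> \<epsilon>"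
  proof (intro exI[of _ "Suc N"] allI impI)
    fix F i assume F: "finite F" "F \<subseteq> {Suc N..}"
    then have "finite (Suc -` F)" "Suc -` F \<subseteq> {N..}" by (auto intro: finite_vimageI)
    then show "L2_set (\<lambda>j. q i (dshift x j)) F \<le> \<epsilon>"
      using N[of "Suc -` F" i] by (simp add: L2_dshift)
  qed
qed

lemma dshift_bounded: "dshift \<in> bounded_operators X"
proof -
  have add: "dshift (x + y) = dshift x + dshift y" for x y :: "nat \<Rightarrow> 'b"
    by (rule ext) (simp add: dshift_def scaleR_add_right)
  have scale: "dshift (cscale X c x) = cscale X c (dshift x)" for c x
  proof (rule ext)
    fix j
    have "sc c (2 *\<^sub>R a) = 2 *\<^sub>R sc c a" for a
      using sc.scale_left_commute[of c "of_real 2" a] by (simp only: sc_real)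
    then show "dshift (cscale X c x) j = cscale X c (dshift x) j"
      by (simp add: dshift_def cscale)
  qed
  have "nrm X (dshift x) \<le> 2 * nrm X x" if x: "x \<in> carrier X" for x
    using nrm_nonneg[OF x]
    by (intro nrm_leI) (auto simp: dshift_carrier x L2_dshift L2_le_nrm finite_vimageI)
  then show ?thesis
    using dshift_carrier add scale by (auto simp: bounded_operators_def)
qed

lemma bshift_carrier:
  assumes x: "x \<in> carrier X"
  shows "bshift x \<in> carrier X"
proof (rule carrierI)
  show "bshift x j \<in> K" for j
    using carrier_coord[OF x] by (simp add: bshift_def)
  fix \<epsilon> :: real assume "\<epsilon> > 0"
  then obtain N where N: "\<And>F i. finite F \<Longrightarrow> F \<subseteq> {N..} \<Longrightarrow> L2_set (\<lambda>j. q i (x j)) F \<le> \<epsilon>"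
    using carrierD[OF x] by blast
  show "\<exists>N. \<forall>F i. finite F \<longrightarrow> F \<subseteq> {N..} \<longrightarrow> L2_set (\<lambda>j. q i (bshift x j)) F \<le> \<epsilon>"
  proof (intro exI[of _ N] allI impI)
    fix F i assume F: "finite F" "F \<subseteq> {N..}"
    then have "finite (Suc ` F)" "Suc ` F \<subseteq> {N..}" by auto
    then show "L2_set (\<lambda>j. q i (bshift x j)) F \<le> \<epsilon>"
      using N[of "Suc ` F" i] by (simp add: L2_set_reindex bshift_def)
  qed
qed

lemma nrm_bshift_le:
  assumes x: "x \<in> carrier X"
  shows "nrm X (bshift x) \<le> nrm X x"
proof (rule nrm_leI)
  fix F :: "nat set" and i assume "finite F"
  then show "L2_set (\<lambda>j. q i (bshift x j)) F \<le> nrm X x"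
    using L2_le_nrm[OF x, of "Suc ` F" i] by (simp add: L2_set_reindex bshift_def)
qed (use x in \<open>auto simp: bshift_carrier nrm_nonneg\<close>)

lemma bshift_bounded: "bshift \<in> bounded_operators X"
proof -
  have "\<forall>x\<in>carrier X. nrm X (bshift x) \<le> 1 * nrm X x"
    using nrm_bshift_le by simp
  then show ?thesis
    using bshift_carrier unfolding bounded_operators_def
    by (intro CollectI conjI exI[of _ 1]) (auto simp: bshift_def cscale fun_eq_iff)
qed

text \<open>The coefficients of approximating multiples form a Cauchy sequence, since the norm of u
  times the distance of two coefficients is at most the sum of the two distances to y. The limit
  coefficient then reproduces y.\<close>

lemma line_closed:
  assumes u: "u \<in> carrier X" and y: "y \<in> carrier X"
    and approx: "\<And>r. r > 0 \<Longrightarrow> \<exists>c. nrm X (y - cscale X c u) < r"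
  shows "y \<in> cs.span {u}"
proof (cases "u = 0")
  case True
  have "nrm X y < r" if "r > 0" for r
    using approx[OF that] True by simp
  then have "nrm X y = 0" using nrm_nonneg[OF y] by (metis less_irrefl order_le_less)
  then have "y = 0" using nrm_eq_0[OF y] by simp
  then show ?thesis using cs.span_zero by simp
next
  case False
  then have nu: "nrm X u > 0" using nrm_nonneg[OF u] nrm_eq_0[OF u] by (simp add: less_eq_real_def)
  have "\<forall>n. \<exists>c. nrm X (y - cscale X c u) < inverse (real (Suc n))"
    using approx by simp
  then obtain c where c: "\<And>n. nrm X (y - cscale X (c n) u) < inverse (real (Suc n))"
    by metis
  note closed = carrier_cscale[OF u] carrier_diff
  have scale_diff: "cmod (a - b) * nrm X u \<le> nrm X (y - cscale X a u) + nrm X (y - cscale X b u)" for a b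
  proof -
    have "cmod (a - b) * nrm X u = nrm X (cscale X a u - cscale X b u)"
      by (simp add: nrm_cscale[OF u, symmetric] cs.scale_left_diff_distrib)
    also have "\<dots> \<le> nrm X (cscale X a u - y) + nrm X (y - cscale X b u)"
      by (rule nrm_triangle_diff) (use y closed in auto)
    finally show ?thesis using nrm_diff_commute[OF y closed(1)[of a]] by simp
  qed
  have "Cauchy c"
  proof (rule CauchyI)
    fix e :: real assume "e > 0"
    then have "e * nrm X u / 2 > 0" using nu by simp
    then obtain m where m: "inverse (real (Suc m)) < e * nrm X u / 2" using reals_Archimedean by blast
    have "cmod (c p - c r) < e" if "p \<ge> m" "r \<ge> m" for p r
    proof -
      have "inverse (real (Suc n)) \<le> inverse (real (Suc m))" if "n \<ge> m" for n
        using that by (intro le_imp_inverse_le) auto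
      then have lt: "nrm X (y - cscale X (c n) u) < e * nrm X u / 2" if "n \<ge> m" for n
        using c[of n] m that by (meson less_le_trans less_trans)
      have "cmod (c p - c r) * nrm X u < e * nrm X u"
        using scale_diff[of "c p" "c r"] lt[OF \<open>p \<ge> m\<close>] lt[OF \<open>r \<ge> m\<close>] by linarith
      then show ?thesis using nu by simp
    qed
    then show "\<exists>m. \<forall>p\<ge>m. \<forall>r\<ge>m. cmod (c p - c r) < e" by blast
  qed
  then obtain d where d: "c \<longlonglongrightarrow> d" using Cauchy_convergent_iff convergent_def by blast
  have "nrm X (y - cscale X d u) \<le> inverse (real (Suc n)) + cmod (c n - d) * nrm X u" for n
  proof -
    have "nrm X (cscale X (c n) u - cscale X d u) = cmod (c n - d) * nrm X u"
      by (simp add: nrm_cscale[OF u, symmetric] cs.scale_left_diff_distrib)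
    then show ?thesis
      using nrm_triangle_diff[OF y closed(1)[of "c n"] closed(1)[of d]] c[of n] by simp
  qed
  moreover have "(\<lambda>n. inverse (real (Suc n)) + cmod (c n - d) * nrm X u) \<longlonglongrightarrow> 0 + cmod (d - d) * nrm X u"
    by (intro tendsto_intros LIMSEQ_inverse_real_of_nat d)
  ultimately have "nrm X (y - cscale X d u) \<le> 0 + cmod (d - d) * nrm X u"
    by (intro LIMSEQ_le_const) auto
  then have "y - cscale X d u = 0"
    using nrm_nonneg[OF closed(2)[OF y closed(1)[of d]]] nrm_eq_0[OF closed(2)[OF y closed(1)[of d]]] by simp
  then have "y = cscale X d u" by simp
  then show ?thesis by (simp add: cs.span_base cs.span_scale)
qed

text \<open>
  In a supercyclic subspace, let \<open>u\<close> be the multiple of an iterate of \<open>x\<close> with the smallest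
  exponent, and \<open>p\<close> its first nonzero coordinate.  Later iterates vanish at \<open>p\<close>, so every vector
  that does not vanish at \<open>p\<close> lies in the closed line spanned by \<open>u\<close>.
\<close>

lemma dshift_not_subspace_supercyclic: "\<not> subspace_supercyclic X dshift"
proof
  assume "subspace_supercyclic X dshift"
  then obtain M x where M: "closed_subspace_dim_ge2 X M" and x: "x \<in> carrier X"
    and dense: "dense_in X ({cscale X c ((dshift ^^ n) x) | c n. True} \<inter> M) M"
    by (auto simp: subspace_supercyclic_def)
  have Msub: "cs.subspace M" and "closedin (norm_topology X) M"
    using M by (auto simp: closed_subspace_dim_ge2_def)
  then have Mc: "M \<subseteq> carrier X" using closedin_subset ms.topspace_mtopology by metis
  obtain B where B: "B \<subseteq> M" "card B = 2" "cs.independent B"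
    using M by (auto simp: closed_subspace_dim_ge2_def)
  have approx: "\<exists>c n. cscale X c ((dshift ^^ n) x) \<in> M \<and> nrm X (y - cscale X c ((dshift ^^ n) x)) < r"
    if "y \<in> M" "r > 0" for y r
    using dense that unfolding dense_in_def subset_iff in_closure_iff by fastforce
  have approx_nz: "\<exists>c n. cscale X c ((dshift ^^ n) x) \<in> M \<and> cscale X c ((dshift ^^ n) x) p \<noteq> 0 \<and>
      nrm X (y - cscale X c ((dshift ^^ n) x)) < r"
    if y: "y \<in> M" "y p \<noteq> 0" and r: "r > 0" for y p r
  proof -
    \<comment> \<open>An approximant closer to y than the size of \<open>y p\<close> cannot vanish
      at p, because coordinates are dominated by the norm.\<close>
    obtain c n where cn: "cscale X c ((dshift ^^ n) x) \<in> M"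
        "nrm X (y - cscale X c ((dshift ^^ n) x)) < min r (norm (y p))"
      using approx[OF y(1), of "min r (norm (y p))"] y r by auto
    have "norm (y p - cscale X c ((dshift ^^ n) x) p) < norm (y p)"
      using norm_coord_le[OF carrier_diff, of y "cscale X c ((dshift ^^ n) x)" p] cn y(1) Mc by fastforce
    then have "cscale X c ((dshift ^^ n) x) p \<noteq> 0" by auto
    then show ?thesis using cn by auto
  qed
  define hit where "hit n \<longleftrightarrow> (\<exists>c. cscale X c ((dshift ^^ n) x) \<in> M \<and> cscale X c ((dshift ^^ n) x) \<noteq> 0)" for n
  have "\<not> B \<subseteq> {0}"
  proof
    assume "B \<subseteq> {0}"
    then have "card B \<le> card {0 :: nat \<Rightarrow> 'b}" by (intro card_mono) auto
    then show False using B by simp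
  qed
  then obtain w where w: "w \<in> M" "w \<noteq> 0" using B by blast
  then obtain p0 where "w p0 \<noteq> 0" by (auto simp: fun_eq_iff)
  then obtain c n where "cscale X c ((dshift ^^ n) x) \<in> M" "cscale X c ((dshift ^^ n) x) p0 \<noteq> 0"
    using approx_nz[OF w(1), of p0 1] by auto
  then have "hit n" unfolding hit_def by (intro exI[of _ c]) auto
  define n0 where "n0 = Least hit"
  have n0: "hit n0" "\<And>n. hit n \<Longrightarrow> n0 \<le> n"
    using LeastI[of hit n] \<open>hit n\<close> Least_le[of hit] by (auto simp: n0_def)
  then obtain c0 where c0: "cscale X c0 ((dshift ^^ n0) x) \<in> M" "cscale X c0 ((dshift ^^ n0) x) \<noteq> 0"
    by (auto simp: hit_def)
  define u where "u = cscale X c0 ((dshift ^^ n0) x)"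
  have u: "u \<in> M" "u \<noteq> 0" using c0 by (auto simp: u_def)
  have "c0 \<noteq> 0" using c0(2) by auto
  have ex: "\<exists>k. x k \<noteq> 0"
  proof (rule ccontr)
    assume "\<not> (\<exists>k. x k \<noteq> 0)"
    then have "u = 0" by (simp add: u_def cscale fun_eq_iff dshift_funpow)
    then show False using u by simp
  qed
  define k where "k = (LEAST j. x j \<noteq> 0)"
  have k: "x k \<noteq> 0" "\<And>j. x j \<noteq> 0 \<Longrightarrow> k \<le> j"
    using LeastI_ex[OF ex] Least_le[of "\<lambda>j. x j \<noteq> 0"] by (auto simp: k_def)
  define p where "p = n0 + k"
  have up: "u p \<noteq> 0"
    using k \<open>c0 \<noteq> 0\<close> by (simp add: u_def cscale dshift_funpow p_def)
  have line: "y \<in> cs.span {u}" if y: "y \<in> M" "y p \<noteq> 0" for y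
  proof (rule line_closed)
    fix r :: real assume "r > 0"
    from approx_nz[OF y this] obtain c n where cn: "cscale X c ((dshift ^^ n) x) \<in> M"
      "cscale X c ((dshift ^^ n) x) p \<noteq> 0" "nrm X (y - cscale X c ((dshift ^^ n) x)) < r" by blast
    then have "hit n" unfolding hit_def by (intro exI[of _ c]) auto
    then have "n0 \<le> n" using n0 by blast
    moreover have "(dshift ^^ n) x p \<noteq> 0" using cn(2) by (auto simp: cscale)
    then have "p \<ge> n" "x (p - n) \<noteq> 0" by (auto simp: dshift_funpow split: if_splits)
    then have "k \<le> p - n" using k by blast
    \<comment> \<open>Since \<open>p = n0 + k\<close>, the bound \<open>k \<le> p - n\<close> says
      that n is at most \<open>n0\<close>; minimality of \<open>n0\<close> gives the
      reverse.\<close>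
    ultimately have "n = n0" using \<open>p \<ge> n\<close> by (simp add: p_def)
    then have "cscale X c ((dshift ^^ n) x) = cscale X (c / c0) u"
      using \<open>c0 \<noteq> 0\<close> by (simp add: u_def)
    then show "\<exists>c. nrm X (y - cscale X c u) < r" using cn(3) by metis
  qed (use u y Mc in auto)
  have "M \<subseteq> cs.span {u}"
  proof
    fix y assume y: "y \<in> M"
    show "y \<in> cs.span {u}"
    proof (cases "y p = 0")
      case True
      \<comment> \<open>Vectors vanishing at p are reached by translation: adding u makes the
        coordinate at p nonzero without leaving M or changing membership in the line.\<close>
      then have "(y + u) p \<noteq> 0" using up by simp
      moreover have "y + u \<in> M" using y u Msub by (simp add: cs.subspace_add)
      ultimately have "y + u \<in> cs.span {u}" using line by blast
      then show ?thesis by (metis add_diff_cancel cs.span_base cs.span_diff insertI1)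
    qed (use line y in blast)
  qed
  then have "card B \<le> card {u}"
    using cs.independent_span_bound[of "{u}" B] B by auto
  then show False using B by simp
qed

text \<open>The coordinatewise limit is the only candidate. For each finite index set the Cauchy
  bound passes to the limit by continuity of finitely many coordinates; only afterwards are index
  sets and seminorms varied, so no limit is exchanged with a series.\<close>

lemma mcomplete_if_complete:
  assumes "complete K"
  shows "ms.mcomplete"
  unfolding ms.mcomplete_def
proof (intro allI impI)
  fix \<sigma> assume \<sigma>: "ms.MCauchy \<sigma>"
  then have \<sigma>c: "\<sigma> n \<in> carrier X" for n by (auto simp: ms.MCauchy_def)
  have \<sigma>_Cauchy: "\<exists>N. \<forall>n\<ge>N. \<forall>n'\<ge>N. nrm X (\<sigma> n - \<sigma> n') < \<epsilon>" if "\<epsilon> > 0" for \<epsilon>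
    using \<sigma> that \<sigma>c unfolding ms.MCauchy_def cns_dist_def by simp
  have "Cauchy (\<lambda>n. \<sigma> n j)" for j
  proof (rule CauchyI)
    fix e :: real assume "e > 0"
    then obtain N where N: "\<And>n n'. n \<ge> N \<Longrightarrow> n' \<ge> N \<Longrightarrow> nrm X (\<sigma> n - \<sigma> n') < e"
      using \<sigma>_Cauchy by blast
    then have "norm (\<sigma> n j - \<sigma> n' j) < e" if "n \<ge> N" "n' \<ge> N" for n n'
      using norm_coord_le[OF carrier_diff[OF \<sigma>c[of n] \<sigma>c[of n']], of j] that by fastforce
    then show "\<exists>N. \<forall>m\<ge>N. \<forall>n\<ge>N. norm (\<sigma> m j - \<sigma> n j) < e" by blast
  qed
  then have "\<exists>l. l \<in> K \<and> (\<lambda>n. \<sigma> n j) \<longlonglongrightarrow> l" for j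
    using completeE[OF assms, of "\<lambda>n. \<sigma> n j"] carrier_coord[OF \<sigma>c, of _ j] by blast
  then have "\<forall>j. \<exists>l. l \<in> K \<and> (\<lambda>n. \<sigma> n j) \<longlonglongrightarrow> l" by blast
  from choice[OF this] obtain y where "\<forall>j. y j \<in> K \<and> (\<lambda>n. \<sigma> n j) \<longlonglongrightarrow> y j" by blast
  then have y: "y j \<in> K" "(\<lambda>n. \<sigma> n j) \<longlonglongrightarrow> y j" for j by blast+
  have key: "L2_set (\<lambda>j. q i ((y - \<sigma> n) j)) F \<le> \<epsilon>"
    if N: "\<And>n n'. n \<ge> N \<Longrightarrow> n' \<ge> N \<Longrightarrow> nrm X (\<sigma> n - \<sigma> n') < \<epsilon>" and n: "n \<ge> N" and F: "finite F"
    for \<epsilon> N n F i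
  proof -
    have "L2_set (\<lambda>j. q i ((y - \<sigma> n) j)) F \<le> (\<Sum>j\<in>F. norm (y j - \<sigma> n' j)) + \<epsilon>" if "n' \<ge> N" for n'
    proof -
      have "L2_set (\<lambda>j. q i ((y - \<sigma> n') j)) F \<le> (\<Sum>j\<in>F. \<bar>q i ((y - \<sigma> n') j)\<bar>)"
        by (rule L2_set_le_sum_abs)
      also have "\<dots> \<le> (\<Sum>j\<in>F. norm (y j - \<sigma> n' j))"
        by (intro sum_mono) (simp add: q_nonneg q_le)
      finally have "L2_set (\<lambda>j. q i ((y - \<sigma> n') j)) F \<le> (\<Sum>j\<in>F. norm (y j - \<sigma> n' j))" .
      moreover have "L2_set (\<lambda>j. q i ((\<sigma> n' - \<sigma> n) j)) F \<le> \<epsilon>"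
        using L2_le_nrm[OF carrier_diff[OF \<sigma>c[of n'] \<sigma>c[of n]] F, of i] N[OF that n] by simp
      ultimately show ?thesis
        using L2_q_add[of i "y - \<sigma> n'" "\<sigma> n' - \<sigma> n" F] by simp
    qed
    moreover have "(\<lambda>n'. (\<Sum>j\<in>F. norm (y j - \<sigma> n' j)) + \<epsilon>) \<longlonglongrightarrow> (\<Sum>j\<in>F. norm (y j - y j)) + \<epsilon>"
      by (intro tendsto_intros y)
    ultimately have "L2_set (\<lambda>j. q i ((y - \<sigma> n) j)) F \<le> (\<Sum>j\<in>F. norm (y j - y j)) + \<epsilon>"
      by (intro LIMSEQ_le_const) auto
    then show ?thesis by simp
  qed
  have yc: "y \<in> carrier X"
  proof (rule carrierI)
    fix \<epsilon> :: real assume "\<epsilon> > 0"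
    then have e2: "\<epsilon> / 2 > 0" by simp
    obtain n where N: "\<And>m n'. m \<ge> n \<Longrightarrow> n' \<ge> n \<Longrightarrow> nrm X (\<sigma> m - \<sigma> n') < \<epsilon> / 2"
      using \<sigma>_Cauchy[OF e2] by blast
    obtain N' where N': "\<And>F i. finite F \<Longrightarrow> F \<subseteq> {N'..} \<Longrightarrow> L2_set (\<lambda>j. q i (\<sigma> n j)) F \<le> \<epsilon> / 2"
      using carrierD[OF \<sigma>c e2] by blast
    show "\<exists>N. \<forall>F i. finite F \<longrightarrow> F \<subseteq> {N..} \<longrightarrow> L2_set (\<lambda>j. q i (y j)) F \<le> \<epsilon>"
    proof (intro exI[of _ N'] allI impI)
      fix F i assume F: "finite F" "F \<subseteq> {N'..}"
      have "L2_set (\<lambda>j. q i ((y - \<sigma> n) j)) F \<le> \<epsilon> / 2"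
        by (rule key[OF N order_refl F(1)])
      then show "L2_set (\<lambda>j. q i (y j)) F \<le> \<epsilon>"
        using L2_q_add[of i "y - \<sigma> n" "\<sigma> n" F] N'[OF F, of i] by simp
    qed
  qed (rule y)
  have "limitin ms.mtopology \<sigma> y sequentially"
    unfolding ms.limit_metric_sequentially
  proof (intro conjI yc allI impI)
    fix \<epsilon> :: real assume "\<epsilon> > 0"
    then have e2: "\<epsilon> / 2 > 0" by simp
    obtain N where N: "\<And>m n'. m \<ge> N \<Longrightarrow> n' \<ge> N \<Longrightarrow> nrm X (\<sigma> m - \<sigma> n') < \<epsilon> / 2"
      using \<sigma>_Cauchy[OF e2] by blast
    have "nrm X (y - \<sigma> n) \<le> \<epsilon> / 2" if "n \<ge> N" for n
      using key[OF N that] e2 by (intro nrm_leI) (auto simp: carrier_diff yc \<sigma>c)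
    then show "\<exists>N. \<forall>n\<ge>N. \<sigma> n \<in> carrier X \<and> cns_dist X (\<sigma> n) y < \<epsilon>"
      using \<sigma>c yc \<open>\<epsilon> > 0\<close> nrm_diff_commute[OF yc \<sigma>c]
      by (intro exI[of _ N]) (fastforce simp: cns_dist_def)
  qed
  then show "\<exists>x. limitin ms.mtopology \<sigma> x sequentially" by blast
qed

end


section \<open>The numerically transitive operator\<close>

definition l2 :: "(nat \<Rightarrow> complex) cns" where
  "l2 = \<lparr>carrier = {x. summable (\<lambda>j. (cmod (x j))\<^sup>2)},
         cscale = (\<lambda>c x j. c * x j),
         nrm = (\<lambda>x. sqrt (\<Sum>j. (cmod (x j))\<^sup>2))\<rparr>"

lemma l2_carrier: "x \<in> carrier l2 \<longleftrightarrow> summable (\<lambda>j. (cmod (x j))\<^sup>2)"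
  by (simp add: l2_def)

lemma l2_cscale: "cscale l2 = (\<lambda>c x j. c * x j)"
  by (simp add: l2_def)

lemma l2_nrm: "nrm l2 x = sqrt (\<Sum>j. (cmod (x j))\<^sup>2)"
  by (simp add: l2_def)

lemma l2_nrm_nonneg: "x \<in> carrier l2 \<Longrightarrow> 0 \<le> nrm l2 x"
  by (simp add: l2_nrm l2_carrier suminf_nonneg)

lemma L2_set_le_iff: "0 \<le> r \<Longrightarrow> L2_set f F \<le> r \<longleftrightarrow> (\<Sum>j\<in>F. (f j)\<^sup>2) \<le> r\<^sup>2"
  by (metis L2_set_def abs_of_nonneg real_sqrt_abs real_sqrt_le_iff)

text \<open>Here the family of seminorms consists of \<open>cmod\<close> alone, hence the index type
  \<open>unit\<close>.\<close>

interpretation l2: column_space l2 UNIV "(*)" "\<lambda>_::unit. cmod"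
proof
  show "module.subspace (*) (UNIV :: complex set)"
    by (rule module.subspace_UNIV) (unfold_locales, auto simp: algebra_simps)
  fix x :: "nat \<Rightarrow> complex"
  let ?s = "\<lambda>j. (cmod (x j))\<^sup>2"
  show "x \<in> carrier l2 \<longleftrightarrow> (\<forall>j. x j \<in> UNIV) \<and>
        (\<forall>\<epsilon>>0. \<exists>N. \<forall>F (i::unit). finite F \<longrightarrow> F \<subseteq> {N..} \<longrightarrow> L2_set (\<lambda>j. cmod (x j)) F \<le> \<epsilon>)"
    (is "_ \<longleftrightarrow> _ \<and> ?R")
  proof -
    have "?R" if s: "summable ?s"
    proof (intro allI impI)
      fix \<epsilon> :: real assume "\<epsilon> > 0"
      then have "\<epsilon>\<^sup>2 > 0" by simp
      then obtain N where N: "\<And>m n. m \<ge> N \<Longrightarrow> norm (\<Sum>j=m..<n. ?s j) < \<epsilon>\<^sup>2"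
        using s[unfolded summable_Cauchy] by blast
      have "(\<Sum>j=N..<n. ?s j) \<le> \<epsilon>\<^sup>2" for n
        using N[of N n] by (simp add: sum_nonneg)
      then have "(\<Sum>j\<in>F. ?s j) \<le> \<epsilon>\<^sup>2" if "finite F" "F \<subseteq> {N..}" for F
        by (rule sum_tail_set_le[OF _ _ that, rotated]) auto
      then show "\<exists>N. \<forall>F (i::unit). finite F \<longrightarrow> F \<subseteq> {N..} \<longrightarrow> L2_set (\<lambda>j. cmod (x j)) F \<le> \<epsilon>"
        using \<open>\<epsilon> > 0\<close> by (auto simp: L2_set_le_iff)
    qed
    moreover have "summable ?s" if R: ?R
      unfolding summable_Cauchy
    proof (intro allI impI)
      fix e :: real assume e: "e > 0"
      \<comment> \<open>The square of this bound is e / 2, which leaves room for the strict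
        inequality in the Cauchy criterion.\<close>
      then have "sqrt (e / 2) > 0" by simp
      from R[rule_format, OF this] obtain N
        where N: "\<forall>F (i::unit). finite F \<longrightarrow> F \<subseteq> {N..} \<longrightarrow> L2_set (\<lambda>j. cmod (x j)) F \<le> sqrt (e / 2)" ..
      have "norm (\<Sum>j=m..<n. ?s j) < e" if "m \<ge> N" for m n
      proof -
        have "{m..<n} \<subseteq> {N..}" using that by auto
        then have "(\<Sum>j=m..<n. ?s j) \<le> (sqrt (e / 2))\<^sup>2"
          using N e by (subst L2_set_le_iff[symmetric]) auto
        then show ?thesis using e by (simp add: sum_nonneg)
      qed
      then show "\<exists>N. \<forall>m\<ge>N. \<forall>n. norm (\<Sum>j=m..<n. ?s j) < e" by blast
    qed
    ultimately show ?thesis by (auto simp: l2_carrier)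
  qed
  assume x: "x \<in> carrier l2"
  then have s: "summable ?s" by (simp add: l2_carrier)
  show "0 \<le> nrm l2 x" by (rule l2_nrm_nonneg[OF x])
  fix r :: real assume r: "0 \<le> r"
  have "nrm l2 x \<le> r \<longleftrightarrow> suminf ?s \<le> r\<^sup>2"
    using r by (metis l2_nrm real_sqrt_le_iff real_sqrt_unique)
  also have "\<dots> \<longleftrightarrow> (\<forall>F. finite F \<longrightarrow> (\<Sum>j\<in>F. ?s j) \<le> r\<^sup>2)"
  proof
    show "suminf ?s \<le> r\<^sup>2" if "\<forall>F. finite F \<longrightarrow> (\<Sum>j\<in>F. ?s j) \<le> r\<^sup>2"
      using that s by (intro suminf_le_const) auto
    show "\<forall>F. finite F \<longrightarrow> (\<Sum>j\<in>F. ?s j) \<le> r\<^sup>2" if "suminf ?s \<le> r\<^sup>2"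
      using sum_le_suminf[OF s] that by (meson order_trans zero_le_power2)
  qed
  finally show "nrm l2 x \<le> r \<longleftrightarrow> (\<forall>F (i::unit). finite F \<longrightarrow> L2_set (\<lambda>j. cmod (x j)) F \<le> r)"
    using r by (simp add: L2_set_le_iff)
qed (auto simp: l2_cscale norm_triangle_ineq norm_mult scaleR_conv_of_real
      vector_space_def algebra_simps)

lemma complex_banach_l2: "complex_banach l2"
  unfolding complex_banach_def
  using l2.vector_space_cscale l2.carrier_subspace l2.nrm_nonneg l2.nrm_eq_0 l2.nrm_triangle
    l2.nrm_cscale l2.mcomplete_if_complete complete_UNIV by blast

section \<open>The inner product of \<open>l2\<close> and the identification of its set Pi with the
  unit sphere\<close>

definition l2_ip :: "(nat \<Rightarrow> complex) \<Rightarrow> (nat \<Rightarrow> complex) \<Rightarrow> complex" where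
  "l2_ip x y = (\<Sum>j. x j * cnj (y j))"

lemma l2_ip_summable:
  assumes "x \<in> carrier l2" "y \<in> carrier l2"
  shows "summable (\<lambda>j. x j * cnj (y j))"
proof (rule summable_comparison_test')
  show "summable (\<lambda>j. (cmod (x j))\<^sup>2 + (cmod (y j))\<^sup>2)"
    using assms by (intro summable_add) (auto simp: l2_carrier)
  fix n :: nat
  have "cmod (x n) * cmod (y n) \<le> (cmod (x n))\<^sup>2 + (cmod (y n))\<^sup>2"
    using sum_squares_bound[of "cmod (x n)" "cmod (y n)"]
      mult_nonneg_nonneg[OF norm_ge_zero[of "x n"] norm_ge_zero[of "y n"]] by linarith
  then show "norm (x n * cnj (y n)) \<le> (cmod (x n))\<^sup>2 + (cmod (y n))\<^sup>2"
    by (simp add: norm_mult)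
qed

interpretation l2_ip: complex_inner_space "cscale l2" "carrier l2" l2_ip "nrm l2"
proof (unfold_locales)
  fix x y z assume xyz: "x \<in> carrier l2" "y \<in> carrier l2" "z \<in> carrier l2"
  show "l2_ip (x + y) z = l2_ip x z + l2_ip y z"
    using suminf_add[OF l2_ip_summable[OF xyz(1,3)] l2_ip_summable[OF xyz(2,3)]]
    by (simp add: l2_ip_def algebra_simps)
next
  fix x y assume xy: "x \<in> carrier l2" "y \<in> carrier l2"
  have "cnj (l2_ip y x) = (\<Sum>j. cnj (y j * cnj (x j)))"
    unfolding l2_ip_def
    using bounded_linear.suminf[OF bounded_linear_cnj l2_ip_summable[OF xy(2,1)]] .
  then show "l2_ip x y = cnj (l2_ip y x)" by (simp add: l2_ip_def mult.commute)
  show "l2_ip (cscale l2 a x) y = a * l2_ip x y" for a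
    using suminf_mult[OF l2_ip_summable[OF xy], of a] by (simp add: l2_ip_def l2_cscale mult.assoc)
next
  fix x assume x: "x \<in> carrier l2"
  then have s: "summable (\<lambda>j. (cmod (x j))\<^sup>2)" by (simp add: l2_carrier)
  have "l2_ip x x = (\<Sum>j. complex_of_real ((cmod (x j))\<^sup>2))"
    by (simp only: l2_ip_def complex_norm_square)
  also have "\<dots> = complex_of_real (\<Sum>j. (cmod (x j))\<^sup>2)"
    by (rule suminf_of_real[OF s, symmetric])
  also have "(\<Sum>j. (cmod (x j))\<^sup>2) = (nrm l2 x)\<^sup>2"
    using s by (simp add: l2_nrm suminf_nonneg)
  finally show "l2_ip x x = complex_of_real ((nrm l2 x)\<^sup>2)" .
qed (use l2.carrier_subspace l2.nrm_nonneg l2.nrm_eq_0 in auto)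

text \<open>Cauchy-Schwarz bounds the supremum and the normalised w attains it. Only the values of g
  on the carrier are prescribed, so that the lemma also covers differences of extensional
  functionals, which need not be extensional.\<close>

lemma dual_norm_l2_ip:
  assumes w: "w \<in> carrier l2" and g: "\<And>z. z \<in> carrier l2 \<Longrightarrow> g z = l2_ip z w"
  shows "dual_norm l2 g = nrm l2 w"
proof -
  let ?B = "{z \<in> carrier l2. nrm l2 z \<le> 1}"
  have le: "cmod (g z) \<le> nrm l2 w" if "z \<in> ?B" for z
  proof -
    have "cmod (g z) \<le> nrm l2 z * nrm l2 w"
      using l2_ip.Cauchy_Schwarz[of z w] that w g by simp
    also have "\<dots> \<le> 1 * nrm l2 w"
      using that l2.nrm_nonneg[OF w] by (intro mult_right_mono) auto
    finally show ?thesis by simp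
  qed
  have bdd: "bdd_above ((\<lambda>z. cmod (g z)) ` ?B)"
    using le by (intro bdd_aboveI2)
  have zero: "0 \<in> ?B" using l2.carrier_0 l2.nrm_eq_0[OF l2.carrier_0] by simp
  have "dual_norm l2 g \<le> nrm l2 w"
    unfolding dual_norm_def
    by (rule cSUP_least) (use zero in blast, rule le)
  moreover have "nrm l2 w \<le> dual_norm l2 g"
  proof (cases "nrm l2 w = 0")
    case True
    have "0 \<le> cmod (g 0)" by simp
    also have "\<dots> \<le> dual_norm l2 g"
      unfolding dual_norm_def by (rule cSUP_upper[OF zero bdd])
    finally show ?thesis using True by simp
  next
    case False
    then have n: "nrm l2 w > 0" using l2.nrm_nonneg[OF w] by simp
    let ?w = "cscale l2 (of_real (1 / nrm l2 w)) w"
    have wB: "?w \<in> ?B" using w n by (simp add: l2.carrier_cscale l2.nrm_cscale norm_divide)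
    have "g ?w = of_real (1 / nrm l2 w) * of_real ((nrm l2 w)\<^sup>2)"
      using g[of ?w] wB w by (simp only: l2_ip.ip_scale_left l2_ip.ip_self) simp
    then have "g ?w = of_real (nrm l2 w)"
      using n by (simp add: power2_eq_square)
    then have "nrm l2 w = cmod (g ?w)" using n by simp
    also have "\<dots> \<le> dual_norm l2 g"
      unfolding dual_norm_def by (rule cSUP_upper[OF wB bdd])
    finally show ?thesis .
  qed
  ultimately show ?thesis by simp
qed

definition l2_functional :: "(nat \<Rightarrow> complex) \<Rightarrow> (nat \<Rightarrow> complex) \<Rightarrow> complex" where
  "l2_functional x = restrict (\<lambda>z. l2_ip z x) (carrier l2)"

text \<open>A functional of norm one that takes the value one at a unit vector x annihilates the
  orthogonal complement of x, so x determines it.\<close>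

lemma Pi_set_l2: "Pi_set l2 = (\<lambda>x. (x, l2_functional x)) ` unit_sphere l2"
proof (intro equalityI subsetI)
  fix p assume p: "p \<in> Pi_set l2"
  obtain x f where pxf: "p = (x, f)" by force
  have x: "x \<in> carrier l2" "nrm l2 x = 1" and f: "f \<in> dual l2" "dual_norm l2 f = 1" "f x = 1"
    using p by (auto simp: pxf Pi_set_def unit_sphere_def)
  have f_ext: "f \<in> extensional (carrier l2)"
    and f_add: "\<And>y z. y \<in> carrier l2 \<Longrightarrow> z \<in> carrier l2 \<Longrightarrow> f (y + z) = f y + f z"
    and f_scale: "\<And>c y. y \<in> carrier l2 \<Longrightarrow> f (cscale l2 c y) = c * f y"
    using f(1) by (auto simp: dual_def)
  obtain K where K: "\<And>z. z \<in> carrier l2 \<Longrightarrow> cmod (f z) \<le> K * nrm l2 z"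
    using f(1) unfolding dual_def by blast
  let ?B = "{z \<in> carrier l2. nrm l2 z \<le> 1}"
  have bdd: "bdd_above ((\<lambda>z. cmod (f z)) ` ?B)"
  proof (rule bdd_aboveI2)
    fix z assume z: "z \<in> ?B"
    \<comment> \<open>K may be negative, hence the absolute value. Boundedness has to be known
      before the real supremum in \<open>dual_norm\<close> can serve as an upper bound.\<close>
    have "K * nrm l2 z \<le> \<bar>K\<bar> * 1"
      using z l2.nrm_nonneg[of z] by (intro mult_mono) auto
    then show "cmod (f z) \<le> \<bar>K\<bar>" using K[of z] z by simp
  qed
  have f_le: "cmod (f z) \<le> nrm l2 z" if z: "z \<in> carrier l2" for z
  proof (cases "nrm l2 z = 0")
    case True
    then show ?thesis using K[OF z] by simp
  next
    case False
    then have n: "nrm l2 z > 0" using l2.nrm_nonneg[OF z] by simp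
    let ?z = "cscale l2 (of_real (1 / nrm l2 z)) z"
    have "?z \<in> ?B" using z n by (simp add: l2.carrier_cscale l2.nrm_cscale norm_divide)
    then have "cmod (f ?z) \<le> dual_norm l2 f"
      unfolding dual_norm_def by (rule cSUP_upper[OF _ bdd])
    then have "cmod (f z) / nrm l2 z \<le> 1"
      using f(2) n by (simp add: f_scale[OF z] norm_mult norm_divide)
    then show ?thesis using n by (simp add: divide_le_eq)
  qed
  have "f = l2_functional x"
  proof (rule extensionalityI[OF f_ext])
    show "l2_functional x \<in> extensional (carrier l2)" by (simp add: l2_functional_def)
    fix z assume z: "z \<in> carrier l2"
    have "f z = l2_ip z x"
      by (rule l2_ip.norm_attaining_functional[of f x z, OF f_add f_scale f_le x f(3) z])
    then show "f z = l2_functional x z" using z by (simp add: l2_functional_def)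
  qed
  then show "p \<in> (\<lambda>x. (x, l2_functional x)) ` unit_sphere l2"
    using x pxf by (auto simp: unit_sphere_def)
next
  fix p assume "p \<in> (\<lambda>x. (x, l2_functional x)) ` unit_sphere l2"
  then obtain x where p: "p = (x, l2_functional x)" and x: "x \<in> carrier l2" "nrm l2 x = 1"
    by (auto simp: unit_sphere_def)
  have bound: "cmod (l2_functional x z) \<le> 1 * nrm l2 z" if "z \<in> carrier l2" for z
    using l2_ip.Cauchy_Schwarz[OF that x(1)] that x by (simp add: l2_functional_def)
  have "dual_norm l2 (l2_functional x) = 1"
    using dual_norm_l2_ip[OF x(1), of "l2_functional x"] x by (simp add: l2_functional_def)
  moreover have "l2_functional x x = 1"
    using x l2_ip.ip_self[OF x(1)] by (simp add: l2_functional_def)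
  moreover from bound have "l2_functional x \<in> dual l2"
    unfolding dual_def using x
    by (intro CollectI conjI exI[of _ 1])
      (auto simp: l2_functional_def l2.carrier_add l2.carrier_cscale
        l2_ip.ip_add_left l2_ip.ip_scale_left simp del: plus_fun_apply)
  ultimately show "p \<in> Pi_set l2"
    using x by (auto simp: Pi_set_def p unit_sphere_def)
qed

text \<open>The two functionals differ by the inner product with x - y, whose norm is that of x - y,
  so both entries of the maximum coincide and Pi is isometric to the sphere.\<close>

lemma Pi_dist_l2:
  assumes "x \<in> unit_sphere l2" "y \<in> unit_sphere l2"
  shows "Pi_dist l2 (x, l2_functional x) (y, l2_functional y) = nrm l2 (x - y)"
proof -
  have xy: "x \<in> carrier l2" "y \<in> carrier l2" using assms by (auto simp: unit_sphere_def)
  have "dual_norm l2 (\<lambda>z. l2_functional x z - l2_functional y z) = nrm l2 (x - y)"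
  proof (rule dual_norm_l2_ip)
    fix z assume z: "z \<in> carrier l2"
    have "l2_ip z x = l2_ip z (x - y) + l2_ip z y"
      using l2_ip.ip_add_right[of z "x - y" y] z xy by simp
    then show "l2_functional x z - l2_functional y z = l2_ip z (x - y)"
      using z by (simp add: l2_functional_def)
  qed (use xy in simp)
  then show ?thesis using assms by (simp add: Pi_dist_def Pi_set_l2)
qed

interpretation Pi_l2: Metric_space "Pi_set l2" "Pi_dist l2"
proof
  show "0 \<le> Pi_dist l2 p q" for p q
  proof (cases "p \<in> Pi_set l2 \<and> q \<in> Pi_set l2")
    case True
    then show ?thesis
      by (auto simp: Pi_set_l2 Pi_dist_l2 unit_sphere_def intro!: l2.nrm_nonneg l2.carrier_diff)
  qed (auto simp: Pi_dist_def)
  show "Pi_dist l2 p q = Pi_dist l2 q p" for p q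
  proof (cases "p \<in> Pi_set l2 \<and> q \<in> Pi_set l2")
    case True
    then show ?thesis
      by (auto simp: Pi_set_l2 Pi_dist_l2 unit_sphere_def intro!: l2.nrm_diff_commute)
  qed (auto simp: Pi_dist_def)
  show "Pi_dist l2 p q = 0 \<longleftrightarrow> p = q" if "p \<in> Pi_set l2" "q \<in> Pi_set l2" for p q
    using that l2.nrm_eq_0[OF l2.carrier_diff]
    by (fastforce simp: Pi_set_l2 Pi_dist_l2 unit_sphere_def)
  show "Pi_dist l2 p r \<le> Pi_dist l2 p q + Pi_dist l2 q r"
    if "p \<in> Pi_set l2" "q \<in> Pi_set l2" "r \<in> Pi_set l2" for p q r
    using that by (auto simp: Pi_set_l2 Pi_dist_l2 unit_sphere_def intro!: l2.nrm_triangle_diff)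
qed

text \<open>Controls the factor by which normalising two perturbed vectors distorts their pairing.
  The constant arises from \<open>\<bar>1 - t * t'\<bar> \<le> (5/2) * s\<close> and
  \<open>t * t' \<ge> 1/4\<close>.\<close>

lemma inverse_product_near_1:
  fixes t t' s :: real
  assumes "\<bar>t - 1\<bar> \<le> s" "\<bar>t' - 1\<bar> \<le> s" "s \<le> 1/2"
  shows "\<bar>1 / t * (1 / t') - 1\<bar> \<le> 10 * s"
proof -
  have t: "1/2 \<le> t" "1/2 \<le> t'" using assms by (simp_all add: abs_le_iff)
  have "1/4 \<le> t * t'" using mult_mono[of "1/2" t "1/2" t'] t by simp
  have "\<bar>1 - t * t'\<bar> = \<bar>(1 - t) + t * (1 - t')\<bar>" by (simp add: algebra_simps)
  also have "\<dots> \<le> \<bar>1 - t\<bar> + \<bar>t\<bar> * \<bar>1 - t'\<bar>"       using abs_triangle_ineq[of "1 - t" "t * (1 - t')"] by (simp only: abs_mult)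
  also have "\<dots> \<le> s + (3/2) * s"
    using assms t by (intro add_mono mult_mono) (auto simp: abs_le_iff)
  also have "\<dots> = 10 * s * (1/4)" by simp
  also have "\<dots> \<le> 10 * s * (t * t')"
    using \<open>1/4 \<le> t * t'\<close> assms by (intro mult_left_mono) auto
  finally have "\<bar>1 - t * t'\<bar> / (t * t') \<le> 10 * s"
    using t by (simp add: divide_le_eq)
  moreover have "1 / t * (1 / t') - 1 = (1 - t * t') / (t * t')"
    using t by (simp add: diff_divide_distrib)
  moreover have "t * t' > 0" using \<open>1/4 \<le> t * t'\<close> by linarith
  ultimately show ?thesis by (simp only: abs_divide abs_of_pos)
qed

text \<open>
  Perturb \<open>x\<close> to \<open>z\<close> = (truncation of \<open>x\<close>) + \<open>c e\<^sub>N + \<delta> e\<^sub>n\<^sub>+\<^sub>N\<close>.  The supports of \<open>z\<close> and of its \<open>n\<close>-th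
  iterate meet only at \<open>n + N\<close>, where they contribute \<open>2\<^sup>n c \<delta>\<close>.
\<close>

lemma dshift_numerically_transitive: "topologically_numerically_transitive l2 dshift"
  unfolding topologically_numerically_transitive_def
proof (intro allI impI, elim conjE)
  fix U and V :: "complex set"
  assume U: "openin Pi_l2.mtopology U" "U \<noteq> {}" and V: "open V" "V \<noteq> {}"
  obtain p where p: "p \<in> U" using U by blast
  have "U \<subseteq> Pi_set l2" using U(1) unfolding Pi_l2.openin_mtopology by blast
  then obtain x where px: "p = (x, l2_functional x)" and xS: "x \<in> unit_sphere l2"
    using p by (auto simp: Pi_set_l2)
  then have x: "x \<in> carrier l2" "nrm l2 x = 1" by (auto simp: unit_sphere_def)
  obtain r where r: "r > 0" "Pi_l2.mball p r \<subseteq> U"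
    using U(1) p unfolding Pi_l2.openin_mtopology by blast
  obtain v where "v \<in> V" using V by blast
  then obtain \<epsilon> where \<epsilon>: "\<epsilon> > 0" "ball v \<epsilon> \<subseteq> V" using V(1) open_contains_ball by blast
  \<comment> \<open>Normalisation distorts the value v by at most 10 s times its modulus; this bound
    for s keeps that below half of \<open>\<epsilon>\<close>. The summand 1 covers v = 0.\<close>
  define t where "t = \<epsilon> / (20 * (cmod v + 1))"
  have "t > 0" using \<epsilon> by (simp add: t_def add_nonneg_pos)
  \<comment> \<open>The bound 1/2 is required by \<open>inverse_product_near_1\<close>, and r/4
    leaves room for the factor 2 in \<open>normalise\<close>.\<close>
  define s where "s = min (1/2) (min (r/4) t)"
  have s: "s > 0" "s \<le> 1/2" "s \<le> r/4" "s \<le> t"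
    using r(1) \<open>t > 0\<close> unfolding s_def by linarith+
  \<comment> \<open>Three errors share s: the truncation and the two added unit vectors.\<close>
  define \<delta> where "\<delta> = s / 3"
  have \<delta>: "\<delta> > 0" using s by (simp add: \<delta>_def)
  obtain N where N: "nrm l2 (truncation N x - x) \<le> \<delta>"
    using l2.truncation_approx[OF x(1) \<delta>] by blast
  obtain m :: nat where m: "cmod v / \<delta>\<^sup>2 < 2 ^ m"
    using real_arch_pow[of "2::real" "cmod v / \<delta>\<^sup>2"] by auto
  \<comment> \<open>The part \<open>m\<close> makes \<open>2 ^ n\<close> large enough for the
    coefficient c to be at most \<open>\<delta>\<close>. The part \<open>Suc N\<close> moves the
    shifted support, which starts at n, beyond all indices up to N.\<close>
  define n where "n = max m (Suc N)"
  have "n > N" "(2::real) ^ m \<le> 2 ^ n" by (auto simp: n_def intro!: power_increasing)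
  then have n: "n > N" "cmod v / \<delta>\<^sup>2 \<le> 2 ^ n" using m by linarith+
  define c where "c = v / of_real (2 ^ n * \<delta>)"
  have c: "cmod c \<le> \<delta>"
  proof -
    have "cmod v \<le> 2 ^ n * \<delta>\<^sup>2" using n \<delta> by (simp add: divide_le_eq)
    then show ?thesis
      using \<delta> by (simp add: c_def norm_divide norm_mult norm_power divide_le_eq power2_eq_square mult_ac)
  qed
  define z where "z = truncation N x + unit_at N c + unit_at (n + N) (of_real \<delta>)"
  note c' = l2.unit_at_carrier[OF UNIV_I] l2.carrier_add l2.truncation_carrier[OF x(1)]
  have z: "z \<in> carrier l2" unfolding z_def by (intro c')
  have "nrm l2 (z - x) \<le> s"
  proof -
    have "z - x = (truncation N x - x) + (unit_at N c + unit_at (n + N) (of_real \<delta>))"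
      by (simp add: z_def algebra_simps)
    then have "nrm l2 (z - x) \<le> nrm l2 (truncation N x - x)
        + nrm l2 (unit_at N c + unit_at (n + N) (of_real \<delta>))"
      by (simp only:) (intro l2.nrm_triangle l2.carrier_diff c' x(1))
    also have "\<dots> \<le> \<delta> + (nrm l2 (unit_at N c) + nrm l2 (unit_at (n + N) (complex_of_real \<delta>)))"
      by (intro add_mono N l2.nrm_triangle c')
    also have "\<dots> \<le> \<delta> + (\<delta> + \<delta>)"
      using l2.nrm_unit_at_le[OF UNIV_I, of N c] c \<delta>
        l2.nrm_unit_at_le[OF UNIV_I, of "n + N" "complex_of_real \<delta>"] by simp
    finally show ?thesis by (simp add: \<delta>_def)
  qed
  note nz = l2.normalise[OF x z this]
  define a where "a = 1 / nrm l2 z"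
  define y where "y = cscale l2 (of_real a) z"
  have y: "y \<in> unit_sphere l2" "nrm l2 (x - y) \<le> 2 * s"
    using nz s by (auto simp: y_def a_def)
  have "(dshift ^^ n) y j * cnj (y j) = (if j = n + N then of_real (a\<^sup>2) * v else 0)" for j
  proof (cases "j < n")
    case True
    then show ?thesis by (simp add: dshift_funpow)
  next
    case False
    show ?thesis
    proof (cases "j = n + N")
      case True
      have "(dshift ^^ n) y j * cnj (y j) = of_real (a\<^sup>2) * (2 ^ n * c * of_real \<delta>)"
        using n by (simp add: True dshift_funpow y_def l2_cscale z_def unit_at_def truncation_def scaleR_conv_of_real
            power2_eq_square)
      then show ?thesis using \<delta> True by (simp add: c_def)
    next
      case jN: False
      then have "y j = 0" using False n by (simp add: y_def l2_cscale z_def unit_at_def truncation_def)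
      then show ?thesis using jN by simp
    qed
  qed
  then have "l2_ip ((dshift ^^ n) y) y = (\<Sum>j. if j = n + N then of_real (a\<^sup>2) * v else 0)"
    by (simp add: l2_ip_def)
  also have "\<dots> = of_real (a\<^sup>2) * v"
    using sums_single[of "n + N" "\<lambda>_. of_real (a\<^sup>2) * v"] by (simp add: sums_iff)
  finally have ip: "l2_ip ((dshift ^^ n) y) y = of_real (a\<^sup>2) * v" .
  have "(dshift ^^ n) y \<in> carrier l2"
    by (induction n) (use y in \<open>auto simp: unit_sphere_def l2.dshift_carrier\<close>)
  then have "l2_functional y ((dshift ^^ n) y) = of_real (a\<^sup>2) * v"
    using ip by (simp add: l2_functional_def)
  moreover have "of_real (a\<^sup>2) * v \<in> V"
  proof -
    have "of_real (a\<^sup>2) * v - v = of_real (a\<^sup>2 - 1) * v" by (simp add: algebra_simps)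
    then have "cmod (of_real (a\<^sup>2) * v - v) = \<bar>a\<^sup>2 - 1\<bar> * cmod v"
      by (simp only: norm_mult norm_of_real)
    also have "\<dots> \<le> 10 * s * (cmod v + 1)"
      using inverse_product_near_1[of "nrm l2 z" s "nrm l2 z"] nz s
      by (intro mult_mono) (auto simp: a_def power2_eq_square)
    also have "\<dots> \<le> \<epsilon> / 2"
    proof -
      have "s * (20 * (cmod v + 1)) \<le> \<epsilon>" using s(4)
        by (simp add: t_def pos_le_divide_eq add_nonneg_pos del: distrib_left_numeral)
      then show ?thesis by (simp add: algebra_simps)
    qed
    also have "\<dots> < \<epsilon>" using \<epsilon> by simp
    finally show ?thesis using \<epsilon>(2) by (auto simp: dist_norm norm_minus_commute subset_iff)
  qed
  moreover have "(y, l2_functional y) \<in> U"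
  proof -
    have "nrm l2 (x - y) < r" using y s r by simp
    then have "(y, l2_functional y) \<in> Pi_l2.mball p r"
      using y(1) xS unfolding Pi_l2.in_mball px Pi_dist_l2[OF xS y(1)] by (simp add: Pi_set_l2)
    then show ?thesis using r by blast
  qed
  ultimately show "\<exists>n. \<exists>(x, f)\<in>U. f ((dshift ^^ n) x) \<in> V"
    by (intro exI[of _ n] bexI[of _ "(y, l2_functional y)"]) auto
qed


section \<open>Compact operators and the standard Hilbert module\<close>

lemma blinfun_scaleC_apply [simp]:
  "blinfun_apply (blinfun_scaleC c A) u = scaleC c (blinfun_apply A u)"
  by (simp add: blinfun_scaleC.rep_eq)

lemma blinfun_scaleC_of_real: "blinfun_scaleC (of_real r) A = r *\<^sub>R (A :: 'h::complex_hilbert \<Rightarrow>\<^sub>L 'h)"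
  by (rule blinfun_eqI) (simp add: scaleC_of_real blinfun.scaleR_left)

interpretation blinfun_scaleC: vector_space "blinfun_scaleC :: complex \<Rightarrow> ('h::complex_hilbert \<Rightarrow>\<^sub>L 'h) \<Rightarrow> _"
proof
  fix x y :: "'h \<Rightarrow>\<^sub>L 'h" and a b :: complex
  show "blinfun_scaleC a (x + y) = blinfun_scaleC a x + blinfun_scaleC a y"
    by (rule blinfun_eqI) (simp add: blinfun.add_left scaleC_add_right)
  show "blinfun_scaleC (a + b) x = blinfun_scaleC a x + blinfun_scaleC b x"
    by (rule blinfun_eqI) (simp add: blinfun.add_left scaleC_add_left)
  show "blinfun_scaleC a (blinfun_scaleC b x) = blinfun_scaleC (a * b) x"
    by (rule blinfun_eqI) (simp add: scaleC_scaleC)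
  show "blinfun_scaleC 1 x = x"
    by (rule blinfun_eqI) simp
qed

lemma bounded_linear_scaleC_left: "bounded_linear (\<lambda>c. scaleC c (u :: 'h::complex_hilbert))"
  by (rule bounded_linear_intro[where K = "norm u"])
    (simp_all add: scaleC_add_left norm_scaleC scaleR_eq_scaleC scaleC_scaleC scaleR_conv_of_real)

lemma bounded_linear_cinner_left: "bounded_linear (\<lambda>u. cinner u (v :: 'h::complex_hilbert))"
  by (rule bounded_linear_intro[where K = "norm v"])
    (use cinner.Cauchy_Schwarz in \<open>auto simp: cinner_add_left scaleR_eq_scaleC cinner_scaleC_left scaleR_conv_of_real\<close>)

lemma compact_operatorI:
  assumes "\<And>c u. blinfun_apply A (scaleC c u) = scaleC c (blinfun_apply A u)"
    and "compact S" "blinfun_apply A ` cball 0 1 \<subseteq> S"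
  shows "A \<in> compact_operators"
proof -
  have "closure (blinfun_apply A ` cball 0 1) \<subseteq> S"
    using assms by (simp add: closure_minimal compact_imp_closed)
  then have "compact (closure (blinfun_apply A ` cball 0 1))"
    using compact_Int_closed[OF assms(2) closed_closure] by (metis Int_absorb1)
  then show ?thesis using assms(1) by (simp add: compact_operators_def)
qed

lemma compact_operators_clinear: "A \<in> compact_operators \<Longrightarrow> A \<in> clinear_operators"
  by (simp add: compact_operators_def clinear_operators_def)

lemma compact_operator_compact: "A \<in> compact_operators \<Longrightarrow> compact (closure (blinfun_apply A ` cball 0 1))"
  by (simp add: compact_operators_def)

lemma compact_operators_add:
  assumes "A \<in> compact_operators" "B \<in> compact_operators"
  shows "A + B \<in> compact_operators"
proof (rule compact_operatorI)
  show "blinfun_apply (A + B) (scaleC c u) = scaleC c (blinfun_apply (A + B) u)" for c u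
    using assms[THEN compact_operators_clinear] by (simp add: blinfun.add_left clinearD scaleC_add_right)
  show "compact {x + y | x y. x \<in> closure (blinfun_apply A ` cball 0 1) \<and> y \<in> closure (blinfun_apply B ` cball 0 1)}"
    using assms by (intro compact_sums compact_operator_compact)
  show "blinfun_apply (A + B) ` cball 0 1 \<subseteq> {x + y | x y. x \<in> closure (blinfun_apply A ` cball 0 1) \<and> y \<in> closure (blinfun_apply B ` cball 0 1)}"
  proof
    fix w assume "w \<in> blinfun_apply (A + B) ` cball 0 1"
    then obtain u where u: "u \<in> cball 0 1" "w = blinfun_apply A u + blinfun_apply B u"
      by (auto simp: blinfun.add_left)
    then show "w \<in> {x + y | x y. x \<in> closure (blinfun_apply A ` cball 0 1) \<and> y \<in> closure (blinfun_apply B ` cball 0 1)}"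
      using closure_subset[THEN subsetD, OF imageI[OF u(1), of "blinfun_apply A"]]
        closure_subset[THEN subsetD, OF imageI[OF u(1), of "blinfun_apply B"]] by blast
  qed
qed

lemma compact_operators_compose:
  assumes "A \<in> clinear_operators" "B \<in> compact_operators"
  shows "A o\<^sub>L B \<in> compact_operators"
proof (rule compact_operatorI)
  show "blinfun_apply (A o\<^sub>L B) (scaleC c u) = scaleC c (blinfun_apply (A o\<^sub>L B) u)" for c u
    using assms(1) compact_operators_clinear[OF assms(2)] by (simp add: clinearD)
  show "compact (blinfun_apply A ` closure (blinfun_apply B ` cball 0 1))"
    by (intro compact_continuous_image compact_operator_compact assms
        linear_continuous_on blinfun.bounded_linear_right)
  show "blinfun_apply (A o\<^sub>L B) ` cball 0 1 \<subseteq> blinfun_apply A ` closure (blinfun_apply B ` cball 0 1)"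
    unfolding blinfun_apply_blinfun_compose image_comp[symmetric, unfolded comp_def]
    by (intro image_mono closure_subset)
qed

lemma compact_operators_scaleC:
  assumes "A \<in> compact_operators"
  shows "blinfun_scaleC c A \<in> compact_operators"
proof -
  have "blinfun_scaleC c id_blinfun \<in> clinear_operators"
    by (simp add: clinear_operators_def scaleC_scaleC mult.commute)
  then have "blinfun_scaleC c id_blinfun o\<^sub>L A \<in> compact_operators"
    using assms by (rule compact_operators_compose)
  also have "blinfun_scaleC c id_blinfun o\<^sub>L A = blinfun_scaleC c A"
    by (rule blinfun_eqI) simp
  finally show ?thesis .
qed

lemma compact_operators_0: "0 \<in> compact_operators"
  by (rule compact_operatorI[of _ "{0}"]) auto

lemma compact_operators_subspace: "blinfun_scaleC.subspace compact_operators"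
  unfolding blinfun_scaleC.subspace_def
  using compact_operators_0 compact_operators_add compact_operators_scaleC by blast

lemma compact_operators_scaleR: "A \<in> compact_operators \<Longrightarrow> r *\<^sub>R A \<in> compact_operators"
  using compact_operators_scaleC[of A "of_real r"] by (simp add: blinfun_scaleC_of_real)

section \<open>Norm estimates for the operator sums in the inner product of the module\<close>

lemma cinner_sum_adj:
  assumes "\<And>j. x j \<in> clinear_operators" "\<And>j. y j \<in> clinear_operators"
  shows "cinner (blinfun_apply (\<Sum>j\<in>F. adj (y j) o\<^sub>L x j) u) v = (\<Sum>j\<in>F. cinner (x j u) (y j v))"
proof -
  have "cinner (adj (y j) (x j u)) v = cinner (x j u) (y j v)" for j
    using cinner_adj[OF assms(2)[of j], of v "x j u"] cinner_commute[of v]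
      cinner_commute[of "y j v"] by (metis complex_cnj_cancel_iff)
  then show ?thesis by (simp add: blinfun.sum_left cinner_sum_left)
qed

text \<open>Testing the operator against v leaves a sum of inner products; Cauchy-Schwarz is applied
  in the Hilbert space to each term and then to the finite sum.\<close>

lemma norm_sum_adj_le:
  assumes "\<And>j. x j \<in> clinear_operators" "\<And>j. y j \<in> clinear_operators"
    and a: "0 \<le> a" "\<And>u. L2_set (\<lambda>j. norm (blinfun_apply (x j) u)) F \<le> a * norm u"
    and b: "0 \<le> b" "\<And>u. L2_set (\<lambda>j. norm (blinfun_apply (y j) u)) F \<le> b * norm u"
  shows "norm (\<Sum>j\<in>F. adj (y j) o\<^sub>L x j) \<le> a * b"
proof (rule norm_blinfun_bound)
  show "0 \<le> a * b" using a b by simp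
  fix u
  show "norm (blinfun_apply (\<Sum>j\<in>F. adj (y j) o\<^sub>L x j) u) \<le> a * b * norm u"
  proof (rule norm_le_cinnerI)
    show "0 \<le> a * b * norm u" using a b by simp
    fix v
    have "cmod (cinner (blinfun_apply (\<Sum>j\<in>F. adj (y j) o\<^sub>L x j) u) v)
        \<le> (\<Sum>j\<in>F. cmod (cinner (x j u) (y j v)))"
      unfolding cinner_sum_adj[OF assms(1,2)] by (rule norm_sum)
    also have "\<dots> \<le> (\<Sum>j\<in>F. \<bar>norm (x j u)\<bar> * \<bar>norm (y j v)\<bar>)"
      using cinner.Cauchy_Schwarz by (intro sum_mono) simp
    also have "\<dots> \<le> L2_set (\<lambda>j. norm (x j u)) F * L2_set (\<lambda>j. norm (y j v)) F"
      by (rule L2_set_mult_ineq)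
    also have "\<dots> \<le> (a * norm u) * (b * norm v)"
      using a b by (intro mult_mono) (auto simp: L2_set_nonneg)
    finally show "cmod (cinner (blinfun_apply (\<Sum>j\<in>F. adj (y j) o\<^sub>L x j) u) v) \<le> a * b * norm u * norm v"
      by (simp add: mult_ac)
  qed
qed

lemma Re_cinner_adj_self:
  assumes "A \<in> clinear_operators"
  shows "Re (cinner (blinfun_apply (adj A o\<^sub>L A) u) u) = (norm (blinfun_apply A u))\<^sup>2"
  using cinner_sum_adj[of "\<lambda>_. A" "\<lambda>_. A" "{()}" u u] assms by (simp add: cinner_self)

lemma Re_cinner_blinfun_le: "Re (cinner (blinfun_apply S u) u) \<le> norm S * (norm u)\<^sup>2"
proof -
  have "Re (cinner (blinfun_apply S u) u) \<le> norm (S u) * norm u"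
    using complex_Re_le_cmod cinner.Cauchy_Schwarz order_trans UNIV_I by metis
  also have "\<dots> \<le> (norm S * norm u) * norm u"
    by (intro mult_right_mono norm_blinfun) auto
  finally show ?thesis by (simp add: power2_eq_square mult.assoc)
qed

text \<open>The left side is the quadratic form of the operator sum at u. Together with
  \<open>norm_sum_adj_le\<close> this makes the norm of the operator sum the supremum of these
  scalar sums over unit vectors.\<close>

lemma sum_norm_le_norm_sum_adj:
  assumes "\<And>j. x j \<in> clinear_operators"
  shows "(\<Sum>j\<in>F. (norm (blinfun_apply (x j) u))\<^sup>2) \<le> norm (\<Sum>j\<in>F. adj (x j) o\<^sub>L x j) * (norm u)\<^sup>2"
proof -
  have "(\<Sum>j\<in>F. (norm (blinfun_apply (x j) u))\<^sup>2) = Re (cinner (blinfun_apply (\<Sum>j\<in>F. adj (x j) o\<^sub>L x j) u) u)"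
    using Re_cinner_adj_self[OF assms] by (simp add: blinfun.sum_left cinner_sum_left del: blinfun_apply_blinfun_compose)
  then show ?thesis using Re_cinner_blinfun_le by metis
qed

text \<open>Clears the denominator in the seminorms of the module. At u = 0 the quotients are 0 by
  the convention for division, and both sides hold.\<close>

lemma L2_set_quotient_le_iff:
  assumes "0 \<le> a"
  shows "L2_set (\<lambda>j. norm (blinfun_apply (x j) u) / norm u) F \<le> a \<longleftrightarrow>
         (\<Sum>j\<in>F. (norm (blinfun_apply (x j) u))\<^sup>2) \<le> a\<^sup>2 * (norm u)\<^sup>2"
proof (cases "u = 0")
  case True
  then show ?thesis using assms by (simp add: L2_set_def)
next
  case False
  have "L2_set (\<lambda>j. norm (blinfun_apply (x j) u) / norm u) F \<le> a
      \<longleftrightarrow> (\<Sum>j\<in>F. (norm (blinfun_apply (x j) u) / norm u)\<^sup>2) \<le> a\<^sup>2"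
    using assms unfolding L2_set_def by (metis abs_of_nonneg real_sqrt_abs real_sqrt_le_iff)
  also have "(\<Sum>j\<in>F. (norm (blinfun_apply (x j) u) / norm u)\<^sup>2)
      = (\<Sum>j\<in>F. (norm (blinfun_apply (x j) u))\<^sup>2) / (norm u)\<^sup>2"
    by (simp add: power_divide sum_divide_distrib)
  finally show ?thesis using False by (simp add: pos_divide_le_eq)
qed

lemma L2_set_quotient_le_iff':
  assumes "0 \<le> a"
  shows "L2_set (\<lambda>j. norm (blinfun_apply (x j) u) / norm u) F \<le> a \<longleftrightarrow>
         L2_set (\<lambda>j. norm (blinfun_apply (x j) u)) F \<le> a * norm u"
  unfolding L2_set_quotient_le_iff[OF assms] using assms
  by (metis L2_set_def abs_of_nonneg mult_nonneg_nonneg norm_ge_zero power_mult_distrib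
      real_sqrt_abs real_sqrt_le_iff)

lemma l2_B0_carrier:
  "x \<in> carrier l2_B0 \<longleftrightarrow> (\<forall>j. x j \<in> compact_operators) \<and> summable (\<lambda>j. adj (x j) o\<^sub>L x j)"
  by (simp add: l2_B0_def)

lemma l2_B0_cscale: "cscale l2_B0 = (\<lambda>c x j. blinfun_scaleC c (x j))"
  by (simp add: l2_B0_def)

lemma l2_B0_nrm: "nrm l2_B0 x = sqrt (norm (\<Sum>j. adj (x j) o\<^sub>L x j))"
  by (simp add: l2_B0_def module_ip_def)

text \<open>The tail bound is uniform in u. That uniformity expresses convergence of the operator
  series in norm, and not merely at each vector.\<close>

interpretation l2_B0: column_space "l2_B0 :: (nat \<Rightarrow> ('h::complex_hilbert \<Rightarrow>\<^sub>L 'h)) cns"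
  compact_operators blinfun_scaleC "\<lambda>u A. norm (blinfun_apply A u) / norm u"
proof
  fix i :: 'h and a b :: "'h \<Rightarrow>\<^sub>L 'h"
  show "norm (blinfun_apply (a + b) i) / norm i \<le> norm (blinfun_apply a i) / norm i + norm (blinfun_apply b i) / norm i"
    by (simp add: blinfun.add_left norm_triangle_ineq divide_right_mono flip: add_divide_distrib)
  show "norm (blinfun_apply a i) / norm i \<le> norm a"
    using norm_blinfun[of a i] by (cases "i = 0") (auto simp: divide_le_eq)
next
  fix a :: "'h \<Rightarrow>\<^sub>L 'h" and r :: real
  assume r: "\<And>u. norm (blinfun_apply a u) / norm u \<le> r"
  have "0 \<le> r" using r[of 0] by simp
  moreover have "norm (blinfun_apply a u) \<le> r * norm u" for u
    using r[of u] by (cases "u = 0") (auto simp: divide_le_eq)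
  ultimately show "norm a \<le> r" by (rule norm_blinfun_bound)
next
  fix x :: "nat \<Rightarrow> 'h \<Rightarrow>\<^sub>L 'h"
  let ?g = "\<lambda>j. adj (x j) o\<^sub>L x j"
  let ?R = "\<forall>\<epsilon>>0. \<exists>N. \<forall>F u. finite F \<longrightarrow> F \<subseteq> {N..} \<longrightarrow> L2_set (\<lambda>j. norm (blinfun_apply (x j) u) / norm u) F \<le> \<epsilon>"
  have "?R \<longleftrightarrow> summable ?g" if xc: "\<forall>j. x j \<in> compact_operators"
  proof
    have x: "x j \<in> clinear_operators" for j using xc compact_operators_clinear by blast
    show ?R if s: "summable ?g"
    proof (intro allI impI)
      fix \<epsilon> :: real assume \<epsilon>: "\<epsilon> > 0"
      then have "\<epsilon>\<^sup>2 > 0" by simp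
      then obtain N where N: "\<And>m n. m \<ge> N \<Longrightarrow> norm (\<Sum>j=m..<n. ?g j) < \<epsilon>\<^sup>2"
        using s[unfolded summable_Cauchy] by blast
      have "(\<Sum>j=N..<n. (norm (blinfun_apply (x j) u))\<^sup>2) \<le> \<epsilon>\<^sup>2 * (norm u)\<^sup>2" for n u
      proof -
        have "norm (\<Sum>j=N..<n. ?g j) * (norm u)\<^sup>2 \<le> \<epsilon>\<^sup>2 * (norm u)\<^sup>2"
          using N[of N n] by (intro mult_right_mono) auto
        then show ?thesis using sum_norm_le_norm_sum_adj[of x u "{N..<n}", OF x] by linarith
      qed
      then have "(\<Sum>j\<in>F. (norm (blinfun_apply (x j) u))\<^sup>2) \<le> \<epsilon>\<^sup>2 * (norm u)\<^sup>2" if "finite F" "F \<subseteq> {N..}" for F u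
        by (rule sum_tail_set_le[OF _ _ that, rotated]) auto
      then show "\<exists>N. \<forall>F u. finite F \<longrightarrow> F \<subseteq> {N..} \<longrightarrow> L2_set (\<lambda>j. norm (blinfun_apply (x j) u) / norm u) F \<le> \<epsilon>"
        using \<epsilon> by (intro exI[of _ N]) (simp add: L2_set_quotient_le_iff)
    qed
    show "summable ?g" if R: ?R
      unfolding summable_Cauchy
    proof (intro allI impI)
      fix e :: real assume e: "e > 0"
      then have "sqrt (e / 2) > 0" by simp
      from R[rule_format, OF this] obtain N where N: "\<forall>F u. finite F \<longrightarrow> F \<subseteq> {N..} \<longrightarrow>
          L2_set (\<lambda>j. norm (blinfun_apply (x j) u) / norm u) F \<le> sqrt (e / 2)" ..
      have "norm (\<Sum>j=m..<n. ?g j) < e" if "m \<ge> N" for m n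
      proof -
        have "{m..<n} \<subseteq> {N..}" using that by auto
        then have "L2_set (\<lambda>j. norm (blinfun_apply (x j) u)) {m..<n} \<le> sqrt (e / 2) * norm u" for u
          using N e by (subst L2_set_quotient_le_iff'[symmetric]) auto
        then have "norm (\<Sum>j=m..<n. ?g j) \<le> sqrt (e / 2) * sqrt (e / 2)"
          using e by (intro norm_sum_adj_le x) auto
        then show ?thesis using e by simp
      qed
      then show "\<exists>N. \<forall>m\<ge>N. \<forall>n. norm (\<Sum>j=m..<n. ?g j) < e" by blast
    qed
  qed
  then show "x \<in> carrier l2_B0 \<longleftrightarrow> (\<forall>j. x j \<in> compact_operators) \<and> ?R"
    unfolding l2_B0_carrier by blast
  assume "x \<in> carrier l2_B0"
  then have s: "summable ?g" and x: "\<And>j. x j \<in> clinear_operators"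
    by (auto simp: l2_B0_carrier compact_operators_clinear)
  show "0 \<le> nrm l2_B0 x" by (simp add: l2_B0_nrm)
  fix r :: real assume r: "0 \<le> r"
  show "nrm l2_B0 x \<le> r \<longleftrightarrow> (\<forall>F u. finite F \<longrightarrow> L2_set (\<lambda>j. norm (blinfun_apply (x j) u) / norm u) F \<le> r)"
  proof
    assume R: "\<forall>F u. finite F \<longrightarrow> L2_set (\<lambda>j. norm (blinfun_apply (x j) u) / norm u) F \<le> r"
    then have "L2_set (\<lambda>j. norm (blinfun_apply (x j) u)) {..<n} \<le> r * norm u" for n u
      using r by (subst L2_set_quotient_le_iff'[symmetric]) auto
    then have "norm (\<Sum>j<n. ?g j) \<le> r * r" for n
      using r by (intro norm_sum_adj_le x) auto
    moreover have "(\<lambda>n. norm (\<Sum>j<n. ?g j)) \<longlonglongrightarrow> norm (suminf ?g)"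
      using summable_LIMSEQ[OF s] by (rule tendsto_norm)
    ultimately have "norm (suminf ?g) \<le> r * r"
      by (intro LIMSEQ_le_const2) auto
    then show "nrm l2_B0 x \<le> r"
      using r by (simp add: l2_B0_nrm real_le_lsqrt power2_eq_square)
  next
    assume "nrm l2_B0 x \<le> r"
    then have le: "norm (suminf ?g) \<le> r\<^sup>2"
      using r by (simp add: l2_B0_nrm sqrt_le_D)
    show "\<forall>F u. finite F \<longrightarrow> L2_set (\<lambda>j. norm (blinfun_apply (x j) u) / norm u) F \<le> r"
      unfolding L2_set_quotient_le_iff[OF r]
    proof (intro allI impI)
      fix F :: "nat set" and u :: 'h assume F: "finite F"
      \<comment> \<open>Applying this functional termwise turns the operator series into a scalar
        series with nonnegative terms, so every finite partial sum lies below the total.\<close>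
      have bl: "bounded_linear (\<lambda>A. Re (cinner (blinfun_apply A u) u))"
        by (intro bounded_linear_compose[OF bounded_linear_Re]
            bounded_linear_compose[OF bounded_linear_cinner_left] blinfun.bounded_linear_left)
      have sums: "(\<lambda>j. (norm (blinfun_apply (x j) u))\<^sup>2) sums Re (cinner (blinfun_apply (suminf ?g) u) u)"
        using bounded_linear.sums[OF bl summable_sums[OF s]] by (simp only: Re_cinner_adj_self[OF x])
      have "(\<Sum>j\<in>F. (norm (blinfun_apply (x j) u))\<^sup>2) \<le> Re (cinner (blinfun_apply (suminf ?g) u) u)"
        using sum_le_suminf[OF sums_summable[OF sums] F] sums_unique[OF sums] by simp
      also have "\<dots> \<le> norm (suminf ?g) * (norm u)\<^sup>2" by (rule Re_cinner_blinfun_le)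
      also have "\<dots> \<le> r\<^sup>2 * (norm u)\<^sup>2" using le by (intro mult_right_mono) auto
      finally show "(\<Sum>j\<in>F. (norm (blinfun_apply (x j) u))\<^sup>2) \<le> r\<^sup>2 * (norm u)\<^sup>2" .
    qed
  qed
qed (simp_all add: blinfun_scaleC.vector_space_axioms compact_operators_subspace
      blinfun_scaleC_of_real norm_scaleC l2_B0_cscale)

text \<open>The Cauchy-Schwarz inequality of the Hilbert module. The series must first be shown to
  converge; its tails are at most the product of the tails of x and y. The bound then passes from
  partial sums to the limit.\<close>

lemma norm_module_ip_le:
  assumes x: "x \<in> carrier l2_B0" and y: "y \<in> carrier l2_B0"
  shows "norm (module_ip x y) \<le> nrm l2_B0 x * nrm l2_B0 (y :: nat \<Rightarrow> 'h::complex_hilbert \<Rightarrow>\<^sub>L 'h)"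
proof -
  let ?g = "\<lambda>j. adj (y j) o\<^sub>L x j"
  have cl: "x j \<in> clinear_operators" "y j \<in> clinear_operators" for j
    using x y by (auto simp: l2_B0_carrier compact_operators_clinear)
  have s: "summable ?g"
    unfolding summable_Cauchy
  proof (intro allI impI)
    fix e :: real assume e: "e > 0"
    then have e': "sqrt (e / 2) > 0" by simp
    from l2_B0.carrierD[OF x e'] obtain N1 where N1: "\<And>F u. finite F \<Longrightarrow> F \<subseteq> {N1..} \<Longrightarrow>
        L2_set (\<lambda>j. norm (blinfun_apply (x j) u) / norm u) F \<le> sqrt (e / 2)" by blast
    from l2_B0.carrierD[OF y e'] obtain N2 where N2: "\<And>F u. finite F \<Longrightarrow> F \<subseteq> {N2..} \<Longrightarrow>
        L2_set (\<lambda>j. norm (blinfun_apply (y j) u) / norm u) F \<le> sqrt (e / 2)" by blast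
    have "norm (\<Sum>j=m..<n. ?g j) < e" if "m \<ge> max N1 N2" for m n
    proof -
      have "{m..<n} \<subseteq> {N1..}" "{m..<n} \<subseteq> {N2..}" using that by auto
      then have "L2_set (\<lambda>j. norm (blinfun_apply (x j) u)) {m..<n} \<le> sqrt (e / 2) * norm u"
          "L2_set (\<lambda>j. norm (blinfun_apply (y j) u)) {m..<n} \<le> sqrt (e / 2) * norm u" for u
        using N1 N2 e by (auto simp flip: L2_set_quotient_le_iff')
      then have "norm (\<Sum>j=m..<n. ?g j) \<le> sqrt (e / 2) * sqrt (e / 2)"
        using e by (intro norm_sum_adj_le cl) auto
      then show ?thesis using e by simp
    qed
    then show "\<exists>N. \<forall>m\<ge>N. \<forall>n. norm (\<Sum>j=m..<n. ?g j) < e" by blast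
  qed
  have nn: "0 \<le> nrm l2_B0 x" "0 \<le> nrm l2_B0 y" using x y l2_B0.nrm_nonneg by auto
  have "norm (\<Sum>j<n. ?g j) \<le> nrm l2_B0 x * nrm l2_B0 y" for n
    by (intro norm_sum_adj_le cl nn)
      (use l2_B0.L2_le_nrm[OF x] l2_B0.L2_le_nrm[OF y] nn in \<open>auto simp flip: L2_set_quotient_le_iff'\<close>)
  moreover have "(\<lambda>n. norm (\<Sum>j<n. ?g j)) \<longlonglongrightarrow> norm (suminf ?g)"
    using summable_LIMSEQ[OF s] by (rule tendsto_norm)
  ultimately have "norm (suminf ?g) \<le> nrm l2_B0 x * nrm l2_B0 y"
    by (intro LIMSEQ_le_const2) auto
  then show ?thesis by (simp add: module_ip_def)
qed


section \<open>The C*-transitive operator\<close>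

context column_space
begin

lemma openin_unit_sphereD:
  assumes "openin (subtopology (norm_topology X) (unit_sphere X)) U" "x \<in> U"
  shows "x \<in> carrier X" "nrm X x = 1"
    "\<exists>r>0. \<forall>z\<in>unit_sphere X. nrm X (x - z) < r \<longrightarrow> z \<in> U"
proof -
  obtain T where T: "openin (norm_topology X) T" "U = T \<inter> unit_sphere X"
    using assms(1) by (auto simp: openin_subtopology)
  then show x: "x \<in> carrier X" "nrm X x = 1" using assms(2) by (auto simp: unit_sphere_def)
  obtain r where r: "r > 0" "ms.mball x r \<subseteq> T"
    using T assms(2) unfolding ms.openin_mtopology by blast
  have "z \<in> U" if z: "z \<in> unit_sphere X" "nrm X (x - z) < r" for z
  proof -
    have "z \<in> ms.mball x r" unfolding mem_mball_iff using z x by (auto simp: unit_sphere_def)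
    then show ?thesis using r z T by blast
  qed
  then show "\<exists>r>0. \<forall>z\<in>unit_sphere X. nrm X (x - z) < r \<longrightarrow> z \<in> U" using r(1) by blast
qed

end

section \<open>Rank one operators and finite rank projections as approximate units for compact
  operators\<close>

lift_definition rank_one :: "'h::complex_hilbert \<Rightarrow> ('h \<Rightarrow>\<^sub>L 'h)" is "\<lambda>e u. scaleC (cinner u e) e"
  by (rule bounded_linear_compose[OF bounded_linear_scaleC_left bounded_linear_cinner_left])

lemma rank_one_apply [simp]: "blinfun_apply (rank_one e) u = scaleC (cinner u e) e"
  by (simp add: rank_one.rep_eq)

lemma compact_rank_one: "rank_one e \<in> compact_operators"
proof (rule compact_operatorI)
  show "compact ((\<lambda>c. scaleC c e) ` cball 0 (norm e))"
    by (intro compact_continuous_image linear_continuous_on bounded_linear_scaleC_left) simp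
  show "blinfun_apply (rank_one e) ` cball 0 1 \<subseteq> (\<lambda>c. scaleC c e) ` cball 0 (norm e)"
  proof (rule image_subsetI)
    fix u :: 'a assume u: "u \<in> cball 0 1"
    have "cmod (cinner u e) \<le> norm u * norm e" using cinner.Cauchy_Schwarz by simp
    also have "\<dots> \<le> 1 * norm e" using u by (intro mult_right_mono) auto
    finally show "blinfun_apply (rank_one e) u \<in> (\<lambda>c. scaleC c e) ` cball 0 (norm e)"
      unfolding rank_one_apply by (intro imageI) simp
  qed
qed (simp add: cinner_scaleC_left scaleC_scaleC)

definition basis_projection :: "('i \<Rightarrow> 'h::complex_hilbert) \<Rightarrow> 'i set \<Rightarrow> ('h \<Rightarrow>\<^sub>L 'h)" where
  "basis_projection e F = (\<Sum>i\<in>F. rank_one (e i))"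

lemma basis_projection_apply:
  "blinfun_apply (basis_projection e F) u = (\<Sum>i\<in>F. scaleC (cinner u (e i)) (e i))"
  by (simp add: basis_projection_def blinfun.sum_left)

lemma compact_basis_projection: "basis_projection e F \<in> compact_operators"
  unfolding basis_projection_def
  by (rule blinfun_scaleC.subspace_sum[OF compact_operators_subspace]) (rule compact_rank_one)

lemma basis_projection_selfadjoint:
  "cinner (blinfun_apply (basis_projection e F) u) v = cinner u (blinfun_apply (basis_projection e F) v)"
proof -
  have "cnj (cinner v (e i)) = cinner (e i) v" for i
    using cinner_commute[of "e i" v] by simp
  then show ?thesis
    by (simp add: basis_projection_apply cinner_sum_left cinner_sum_right cinner_scaleC_left
        cinner.ip_scale_right mult.commute)
qed

lemma adj_scaleR_basis_projection: "adj (r *\<^sub>R basis_projection e F) = r *\<^sub>R basis_projection e F"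
  by (rule adj_eqI)
    (simp add: blinfun.scaleR_left scaleR_eq_scaleC cinner_scaleC_left cinner.ip_scale_right
      basis_projection_selfadjoint)

lemma basis_projection_on_span:
  assumes e: "orthonormal_basis e" and F: "finite F" and w: "w \<in> scaleC.span (e ` F)"
  shows "blinfun_apply (basis_projection e F) w = w"
proof -
  let ?P = "basis_projection e F"
  have "scaleC.subspace {w. blinfun_apply ?P w = w}"
    unfolding scaleC.subspace_def
    by (auto simp: blinfun.add_right clinearD[OF compact_operators_clinear[OF compact_basis_projection]])
  moreover have "e ` F \<subseteq> {w. blinfun_apply ?P w = w}"
  proof (rule image_subsetI, rule CollectI)
    fix k assume k: "k \<in> F"
    have "blinfun_apply ?P (e k) = (\<Sum>i\<in>F. if i = k then e i else 0)"
      unfolding basis_projection_apply using e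
      by (intro sum.cong) (auto simp: orthonormal_basis_def)
    then show "blinfun_apply ?P (e k) = e k" using F k by simp
  qed
  ultimately show ?thesis using scaleC.span_minimal w by blast
qed

text \<open>P is idempotent and self-adjoint, so the square of the norm of P u is the inner product
  of P u with u, and Cauchy-Schwarz applies.\<close>

lemma norm_basis_projection_le:
  assumes e: "orthonormal_basis e" and F: "finite F"
  shows "norm (basis_projection e F) \<le> 1"
proof (rule norm_blinfun_bound)
  fix u
  let ?P = "basis_projection e F"
  have "blinfun_apply ?P u \<in> scaleC.span (e ` F)"
    unfolding basis_projection_apply
    by (intro scaleC.span_sum scaleC.span_scale scaleC.span_base) auto
  then have PP: "blinfun_apply ?P (blinfun_apply ?P u) = blinfun_apply ?P u"
    by (rule basis_projection_on_span[OF e F])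
  have "(norm (blinfun_apply ?P u))\<^sup>2 = cmod (cinner (blinfun_apply ?P u) (blinfun_apply ?P u))"
    by (simp add: cinner_self norm_power)
  also have "\<dots> = cmod (cinner (blinfun_apply ?P u) u)"
    using basis_projection_selfadjoint[of e F "blinfun_apply ?P u" u] by (simp add: PP)
  also have "\<dots> \<le> norm (blinfun_apply ?P u) * norm u" using cinner.Cauchy_Schwarz by simp
  finally have "norm (blinfun_apply ?P u) * norm (blinfun_apply ?P u) \<le> norm (blinfun_apply ?P u) * norm u"
    by (simp add: power2_eq_square)
  then show "norm (blinfun_apply ?P u) \<le> 1 * norm u"
    by (cases "blinfun_apply ?P u = 0") auto
qed simp

lemma in_span_finite_image:
  assumes "w \<in> scaleC.span (range e)"
  obtains F where "finite F" "w \<in> scaleC.span (e ` F)"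
proof -
  obtain t r where t: "finite t" "t \<subseteq> range e" and w: "w = (\<Sum>a\<in>t. scaleC (r a) a)"
    using assms unfolding scaleC.span_explicit by blast
  obtain F where F: "finite F" "t = e ` F"
    using finite_subset_image[OF t] by blast
  have "w \<in> scaleC.span t"
    unfolding w by (intro scaleC.span_sum scaleC.span_scale scaleC.span_base)
  then show ?thesis using F that by blast
qed

text \<open>
  The image of the unit ball is totally bounded, so it suffices that the projection almost
  fixes the finitely many centres of an \<open>\<epsilon>\<close>-net.
\<close>

lemma compact_operator_approx:
  assumes e: "orthonormal_basis (e :: 'i \<Rightarrow> 'h::complex_hilbert)" and C: "C \<in> compact_operators" and "\<epsilon> > 0"
  shows "\<exists>F. finite F \<and> norm ((basis_projection e F o\<^sub>L C) - C) \<le> \<epsilon>"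
proof -
  \<comment> \<open>Each y is within \<open>2 * \<delta>\<close> of a vector w fixed by the
    projection, through a centre v of the net; the error at y involves w - y and its image, which
    doubles this.\<close>
  define \<delta> where "\<delta> = \<epsilon> / 4"
  have \<delta>: "\<delta> > 0" using \<open>\<epsilon> > 0\<close> by (simp add: \<delta>_def)
  let ?K = "closure (blinfun_apply C ` cball 0 1)"
  obtain k where k: "finite k" "?K \<subseteq> (\<Union>v\<in>k. ball v \<delta>)"
    using compact_operator_compact[OF C] \<delta> unfolding compact_eq_totally_bounded by blast
  have "\<exists>F. finite F \<and> (\<exists>w\<in>scaleC.span (e ` F). dist w v < \<delta>)" for v
  proof -
    have "v \<in> closure (scaleC.span (range e))" using e by (simp add: orthonormal_basis_def)
    then obtain w where w: "w \<in> scaleC.span (range e)" "dist w v < \<delta>"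
      using \<delta> unfolding closure_approachable by blast
    obtain F where "finite F" "w \<in> scaleC.span (e ` F)"
      by (rule in_span_finite_image[OF w(1)])
    then show ?thesis using w(2) by blast
  qed
  then have "\<forall>v. \<exists>F. finite F \<and> (\<exists>w\<in>scaleC.span (e ` F). dist w v < \<delta>)" by blast
  from choice[OF this] obtain G where
    G: "\<And>v. finite (G v)" "\<And>v. \<exists>w\<in>scaleC.span (e ` G v). dist w v < \<delta>" by blast
  define F where "F = (\<Union>v\<in>k. G v)"
  have F: "finite F" using k G by (simp add: F_def)
  let ?P = "basis_projection e F"
  have P_le: "norm (blinfun_apply ?P u) \<le> norm u" for u
  proof -
    have "norm (blinfun_apply ?P u) \<le> norm ?P * norm u" by (rule norm_blinfun)
    also have "\<dots> \<le> 1 * norm u"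
      by (intro mult_right_mono norm_basis_projection_le e F) simp
    finally show ?thesis by simp
  qed
  have near: "norm (blinfun_apply ?P y - y) \<le> \<epsilon>" if y: "y \<in> ?K" for y
  proof -
    obtain v where v: "v \<in> k" "dist v y < \<delta>" using k(2) y by auto
    obtain w where w: "w \<in> scaleC.span (e ` G v)" "dist w v < \<delta>" using G(2) by blast
    have "e ` G v \<subseteq> e ` F" using v(1) by (auto simp: F_def)
    then have "w \<in> scaleC.span (e ` F)" using w(1) scaleC.span_mono by blast
    then have Pw: "blinfun_apply ?P w = w" by (rule basis_projection_on_span[OF e F])
    have wy: "norm (w - y) < 2 * \<delta>"
      using dist_triangle[of w y v] v w by (simp add: dist_norm)
    have "blinfun_apply ?P y - y = (w - y) - blinfun_apply ?P (w - y)"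
      by (simp add: blinfun.diff_right Pw)
    then have "norm (blinfun_apply ?P y - y) \<le> norm (w - y) + norm (blinfun_apply ?P (w - y))"
      by (simp only: norm_triangle_ineq4)
    also have "\<dots> \<le> \<epsilon>" using P_le[of "w - y"] wy by (simp add: \<delta>_def)
    finally show ?thesis .
  qed
  have "norm ((?P o\<^sub>L C) - C) \<le> \<epsilon>"
  proof (rule norm_blinfun_bound)
    fix u :: 'h
    show "norm (blinfun_apply ((?P o\<^sub>L C) - C) u) \<le> \<epsilon> * norm u"
    proof (cases "u = 0")
      case False
      define u1 where "u1 = (1 / norm u) *\<^sub>R u"
      have u1: "u1 \<in> cball 0 1" "u = norm u *\<^sub>R u1" using False by (auto simp: u1_def)
      have "blinfun_apply C u1 \<in> ?K"
        using closure_subset imageI[OF u1(1)] by (rule subsetD)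
      then have "norm (blinfun_apply ((?P o\<^sub>L C) - C) u1) \<le> \<epsilon>"
        using near by (simp add: blinfun.diff_left)
      moreover have "norm (blinfun_apply ((?P o\<^sub>L C) - C) u) = norm u * norm (blinfun_apply ((?P o\<^sub>L C) - C) u1)"
        by (subst u1(2)) (simp only: blinfun.scaleR_right norm_scaleR abs_norm_cancel)
      ultimately show ?thesis by (metis mult.commute mult_left_mono norm_ge_zero)
    qed (simp add: blinfun.zero_right)
  qed (use \<open>\<epsilon> > 0\<close> in simp)
  then show ?thesis using F by blast
qed

lemma adj_zero: "adj (0 :: 'h::complex_hilbert \<Rightarrow>\<^sub>L 'h) = 0"
  by (rule adj_eqI) simp

lemma dshift_Cstar_transitive:
  assumes e: "orthonormal_basis (e :: int \<Rightarrow> 'h::complex_hilbert)"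
  shows "Cstar_transitive (dshift :: (nat \<Rightarrow> 'h \<Rightarrow>\<^sub>L 'h) \<Rightarrow> _)"
  unfolding Cstar_transitive_def Let_def
proof (intro allI impI, elim conjE)
  let ?X = "l2_B0 :: (nat \<Rightarrow> 'h \<Rightarrow>\<^sub>L 'h) cns"
  let ?S = "subtopology (norm_topology ?X) (unit_sphere ?X)"
  fix W and Q :: "('h \<Rightarrow>\<^sub>L 'h) set"
  assume W: "openin (prod_topology ?S ?S) W" "W \<noteq> {}"
    and Q: "openin (top_of_set compact_operators) Q" "Q \<noteq> {}"
  obtain x y where xy: "(x, y) \<in> W" using W(2) by fastforce
  from W(1)[unfolded openin_prod_topology_alt, rule_format, OF xy] obtain U1 U2
    where U: "openin ?S U1" "openin ?S U2" "x \<in> U1" "y \<in> U2" "U1 \<times> U2 \<subseteq> W"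
    by blast
  note x = l2_B0.openin_unit_sphereD[OF U(1,3)] and y = l2_B0.openin_unit_sphereD[OF U(2,4)]
  obtain r1 where r1: "r1 > 0" "\<And>z. z \<in> unit_sphere ?X \<Longrightarrow> nrm ?X (x - z) < r1 \<Longrightarrow> z \<in> U1"
    using x(3) by blast
  obtain r2 where r2: "r2 > 0" "\<And>z. z \<in> unit_sphere ?X \<Longrightarrow> nrm ?X (y - z) < r2 \<Longrightarrow> z \<in> U2"
    using y(3) by blast
  obtain C where C: "C \<in> Q" "C \<in> compact_operators"
    using Q openin_imp_subset by blast
  then obtain \<epsilon> where \<epsilon>: "\<epsilon> > 0" "\<And>D. D \<in> compact_operators \<Longrightarrow> dist D C < \<epsilon> \<Longrightarrow> D \<in> Q"
    using Q(1) unfolding openin_euclidean_subtopology_iff by blast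
  \<comment> \<open>A quarter of \<open>\<epsilon>\<close> pays for replacing C by P C; a half is
    reserved for the normalising factors, and the rest gives strictness.\<close>
  have "\<epsilon> / 4 > 0" using \<epsilon>(1) by simp
  from compact_operator_approx[OF e C(2) this] obtain F
    where F: "finite F" "norm ((basis_projection e F o\<^sub>L C) - C) \<le> \<epsilon> / 4" by blast
  define P where "P = basis_projection e F"
  have nP: "norm P \<le> 1" unfolding P_def by (rule norm_basis_projection_le[OF e F(1)])
  have P: "P \<in> compact_operators" unfolding P_def by (rule compact_basis_projection)
  define t where "t = \<epsilon> / (20 * (norm C + 1))"
  have "t > 0" using \<epsilon>(1) by (simp add: t_def add_nonneg_pos)
  \<comment> \<open>Each of the two vectors now suffers only two errors, truncation and one added
    entry, so s is split into halves.\<close>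
  define s where "s = min (min (1/2) t) (min (r1/4) (r2/4))"
  have s: "s > 0" "s \<le> 1/2" "s \<le> t" "s \<le> r1/4" "s \<le> r2/4"
    using r1(1) r2(1) \<open>t > 0\<close> unfolding s_def by linarith+
  define \<delta> where "\<delta> = s / 2"
  have \<delta>: "\<delta> > 0" using s by (simp add: \<delta>_def)
  obtain N1 where N1: "\<forall>n\<ge>N1. nrm ?X (truncation n x - x) \<le> \<delta>"
    using l2_B0.truncation_approx[OF x(1) \<delta>] by blast
  obtain N2 where N2: "\<forall>n\<ge>N2. nrm ?X (truncation n y - y) \<le> \<delta>"
    using l2_B0.truncation_approx[OF y(1) \<delta>] by blast
  define N where "N = max N1 N2"
  have N: "nrm ?X (truncation N x - x) \<le> \<delta>" "nrm ?X (truncation N y - y) \<le> \<delta>"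
    using N1 N2 by (simp_all add: N_def)
  obtain m :: nat where m: "norm C / \<delta>\<^sup>2 < 2 ^ m"
    using real_arch_pow[of "2::real" "norm C / \<delta>\<^sup>2"] by auto
  define n where "n = max m (Suc N)"
  have "n > N" "(2::real) ^ m \<le> 2 ^ n" by (auto simp: n_def intro!: power_increasing)
  then have n: "n > N" "norm C / \<delta>\<^sup>2 \<le> 2 ^ n" using m by linarith+
  \<comment> \<open>Chosen so that the growth \<open>2 ^ n\<close> and both small coefficients
    multiply to exactly 1; the size of n keeps \<open>\<tau> *\<^sub>R C\<close> within
    \<open>\<delta>\<close>.\<close>
  define \<tau> where "\<tau> = 1 / (2 ^ n * \<delta>)"
  have \<tau>: "\<tau> > 0" "\<tau> * norm C \<le> \<delta>" "2 ^ n * \<tau> * \<delta> = 1"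
  proof -
    have "norm C \<le> 2 ^ n * \<delta>\<^sup>2" using n \<delta> by (simp add: divide_le_eq)
    then show "\<tau> * norm C \<le> \<delta>"
      using \<delta> by (simp add: \<tau>_def divide_le_eq power2_eq_square mult_ac)
  qed (use \<delta> in \<open>simp_all add: \<tau>_def\<close>)
  have closed: "\<tau> *\<^sub>R C \<in> compact_operators" "\<delta> *\<^sub>R P \<in> compact_operators"
    using C P by (simp_all add: compact_operators_scaleR)
  define z1 where "z1 = truncation N x + unit_at N (\<tau> *\<^sub>R C)"
  define z2 where "z2 = truncation N y + unit_at (n + N) (\<delta> *\<^sub>R P)"
  note tr = l2_B0.truncation_carrier[OF x(1)] l2_B0.truncation_carrier[OF y(1)]
  note un = l2_B0.unit_at_carrier[OF closed(1)] l2_B0.unit_at_carrier[OF closed(2)]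
  have z: "z1 \<in> carrier ?X" "z2 \<in> carrier ?X"
    unfolding z1_def z2_def by (intro l2_B0.carrier_add tr un)+
  have "z1 - x = (truncation N x - x) + unit_at N (\<tau> *\<^sub>R C)" by (simp add: z1_def)
  then have "nrm ?X (z1 - x) \<le> nrm ?X (truncation N x - x) + nrm ?X (unit_at N (\<tau> *\<^sub>R C))"
    by (simp only:) (intro l2_B0.nrm_triangle l2_B0.carrier_diff tr un x(1))
  also have "\<dots> \<le> \<delta> + \<delta>"
    using N(1) l2_B0.nrm_unit_at_le[OF closed(1), of N] \<tau> by simp
  finally have z1s: "nrm ?X (z1 - x) \<le> s" by (simp add: \<delta>_def)
  have "z2 - y = (truncation N y - y) + unit_at (n + N) (\<delta> *\<^sub>R P)" by (simp add: z2_def)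
  then have "nrm ?X (z2 - y) \<le> nrm ?X (truncation N y - y) + nrm ?X (unit_at (n + N) (\<delta> *\<^sub>R P))"
    by (simp only:) (intro l2_B0.nrm_triangle l2_B0.carrier_diff tr un y(1))
  also have "\<dots> \<le> \<delta> + \<delta>"
  proof -
    have "norm (\<delta> *\<^sub>R P) \<le> \<delta>" using nP \<delta> by (simp add: mult_left_le)
    then show ?thesis using N(2) l2_B0.nrm_unit_at_le[OF closed(2), of "n + N"] by linarith
  qed
  finally have z2s: "nrm ?X (z2 - y) \<le> s" by (simp add: \<delta>_def)
  have "s < 1" using s by simp
  note n1 = l2_B0.normalise[OF x(1,2) z(1) z1s this] and n2 = l2_B0.normalise[OF y(1,2) z(2) z2s this]
  define a where "a = 1 / nrm ?X z1"
  define b where "b = 1 / nrm ?X z2"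
  define x' where "x' = cscale ?X (of_real a) z1"
  define y' where "y' = cscale ?X (of_real b) z2"
  have x': "x' \<in> U1" using r1 n1(3,4) s by (simp add: x'_def a_def)
  have y': "y' \<in> U2" using r2 n2(3,4) s by (simp add: y'_def b_def)
  have "adj (y' j) o\<^sub>L ((dshift ^^ n) x') j = (if j = n + N then (a * b) *\<^sub>R (P o\<^sub>L C) else 0)" for j
  proof (cases "j < n")
    case True
    then show ?thesis by (simp add: dshift_funpow)
  next
    case False
    show ?thesis
    proof (cases "j = n + N")
      case True
      have "y' j = (b * \<delta>) *\<^sub>R P"
        using n by (simp add: True y'_def l2_B0.cscale_of_real z2_def unit_at_def truncation_def)
      then have "adj (y' j) = (b * \<delta>) *\<^sub>R P"
        by (simp only: P_def adj_scaleR_basis_projection)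
      moreover have "((dshift ^^ n) x') j = (2 ^ n * a * \<tau>) *\<^sub>R C"
        by (simp add: True dshift_funpow x'_def l2_B0.cscale_of_real z1_def unit_at_def truncation_def)
      ultimately have "adj (y' j) o\<^sub>L ((dshift ^^ n) x') j = (a * b * (2 ^ n * \<tau> * \<delta>)) *\<^sub>R (P o\<^sub>L C)"
        by (intro blinfun_eqI) (simp add: blinfun.scaleR_left blinfun.scaleR_right mult_ac)
      then show ?thesis using \<tau>(3) True by simp
    next
      case jN: False
      then have "y' j = 0"
        using False n by (simp add: y'_def l2_B0.cscale_of_real z2_def unit_at_def truncation_def)
      then show ?thesis using jN by (simp add: adj_zero)
    qed
  qed
  then have "module_ip ((dshift ^^ n) x') y' = (\<Sum>j. if j = n + N then (a * b) *\<^sub>R (P o\<^sub>L C) else 0)"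
    by (simp add: module_ip_def)
  also have "\<dots> = (a * b) *\<^sub>R (P o\<^sub>L C)"
    using sums_single[of "n + N" "\<lambda>_. (a * b) *\<^sub>R (P o\<^sub>L C)"] by (simp add: sums_iff)
  finally have ip: "module_ip ((dshift ^^ n) x') y' = (a * b) *\<^sub>R (P o\<^sub>L C)" .
  have PC: "P o\<^sub>L C \<in> compact_operators"
    using compact_operators_compose[OF compact_operators_clinear[OF P] C(2)] .
  have nPC: "norm (P o\<^sub>L C) \<le> norm C"
  proof -
    have "norm (P o\<^sub>L C) \<le> norm P * norm C" by (rule norm_blinfun_compose)
    also have "\<dots> \<le> 1 * norm C" using nP by (intro mult_right_mono) auto
    finally show ?thesis by simp
  qed
  have "(a * b) *\<^sub>R (P o\<^sub>L C) - C = (a * b - 1) *\<^sub>R (P o\<^sub>L C) + ((P o\<^sub>L C) - C)"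
    by (simp add: scaleR_left_diff_distrib)
  then have "norm ((a * b) *\<^sub>R (P o\<^sub>L C) - C) \<le> \<bar>a * b - 1\<bar> * norm (P o\<^sub>L C) + norm ((P o\<^sub>L C) - C)"
    by (metis norm_scaleR norm_triangle_ineq)
  also have "\<dots> \<le> (10 * s) * (norm C + 1) + \<epsilon> / 4"
  proof (intro add_mono mult_mono)
    show "\<bar>a * b - 1\<bar> \<le> 10 * s"
      unfolding a_def b_def by (rule inverse_product_near_1[OF n1(2) n2(2) s(2)])
  qed (use nPC F(2) s(1) in \<open>auto simp: P_def\<close>)
  also have "\<dots> \<le> \<epsilon> / 2 + \<epsilon> / 4"
  proof -
    have "s * (20 * (norm C + 1)) \<le> \<epsilon>"
      using s(3) by (simp add: t_def pos_le_divide_eq add_nonneg_pos del: distrib_left_numeral)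
    then show ?thesis by (simp add: algebra_simps)
  qed
  finally have "dist ((a * b) *\<^sub>R (P o\<^sub>L C)) C < \<epsilon>" using \<epsilon>(1) by (simp add: dist_norm)
  then have "module_ip ((dshift ^^ n) x') y' \<in> Q"
    unfolding ip by (intro \<epsilon>(2) compact_operators_scaleR PC)
  moreover have "(x', y') \<in> W" using x' y' U(5) by blast
  ultimately show "\<exists>n. \<exists>(x, y)\<in>W. module_ip ((dshift ^^ n) x) y \<in> Q"
    by (intro exI[of _ n] bexI[of _ "(x', y')"]) auto
qed


section \<open>The supercyclic operator\<close>

lemma triangle_mono: "m \<le> n \<Longrightarrow> triangle m \<le> triangle n"
  by (rule lift_Suc_mono_le[of triangle]) simp_all

lemma le_triangle: "n \<le> triangle n"
  by (induction n) auto

text \<open>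
  The blocks of \<open>\<xi>\<close> at the positions \<open>triangle k, \<dots>, triangle k + k\<close> run through a dense set of
  finite sequences \<open>y k\<close>, scaled by \<open>\<alpha> k\<close>.  Since \<open>\<alpha>\<close> decays superexponentially, the part of
  \<open>\<xi>\<close> after the \<open>k\<close>-th block is negligible even after division by \<open>\<alpha> k\<close>.
\<close>

lemma universal_sequence:
  "\<exists>\<xi> :: nat \<Rightarrow> complex. \<exists>K. (\<forall>j. cmod (\<xi> j) \<le> K * (1/2) ^ j) \<and>
     (\<forall>d N \<epsilon>. \<epsilon> > 0 \<longrightarrow> (\<exists>c n. \<forall>j. cmod ((if j < N then d j else 0) - c * \<xi> (j + n)) \<le> \<epsilon> * (1/2) ^ j))"
proof -
  obtain D :: "complex set" where D: "countable D" "\<And>X. open X \<Longrightarrow> X \<noteq> {} \<Longrightarrow> \<exists>d\<in>D. d \<in> X"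
    using countable_dense_exists by blast
  have "D \<noteq> {}" using D(2)[of UNIV] by auto
  define q where "q = from_nat_into D"
  have q: "\<exists>i. cmod (z - q i) < r" if "r > 0" for z r
  proof -
    obtain d where "d \<in> D" "d \<in> ball z r" using D(2)[of "ball z r"] \<open>r > 0\<close> by auto
    moreover obtain i where "q i = d"
      using from_nat_into_surj[OF D(1) \<open>d \<in> D\<close>] by (auto simp: q_def)
    ultimately show ?thesis by (auto simp: dist_norm)
  qed
  \<comment> \<open>The first component of k codes a list of indices into the dense set. The second
    is left free, so that every such list recurs for arbitrarily large k.\<close>
  define y where "y k j = (let l = from_nat (fst (prod_decode k)) :: nat list in
      if j < length l then q (l ! j) else 0)" for k j
  define b where "b k = 1 + (\<Sum>j\<le>k. cmod (y k j))" for k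
  have b: "b k \<ge> 1" for k by (simp add: b_def sum_nonneg)
  have y_le: "cmod (y k j) \<le> b k" if "j \<le> k" for j k
    using member_le_sum[of j "{..k}" "\<lambda>j. cmod (y k j)"] that by (simp add: b_def)
  \<comment> \<open>Division by \<open>b k\<close> cancels the size of the k-th block, and the
    exponent exceeds every position in that block.\<close>
  define \<gamma> where "\<gamma> k = (1/2) ^ triangle (Suc k) / b k" for k
  have \<gamma>: "0 < \<gamma> k" "\<gamma> k \<le> 1" for k
  proof -
    show "0 < \<gamma> k" using b[of k] by (simp add: \<gamma>_def)
    have "(1/2 :: real) ^ triangle (Suc k) \<le> 1" by (rule power_le_one) auto
    then show "\<gamma> k \<le> 1" using b[of k] by (simp add: \<gamma>_def divide_le_eq)
  qed
  define \<alpha> where "\<alpha> k = (\<Prod>i\<le>k. \<gamma> i)" for k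
  have \<alpha>: "0 < \<alpha> k" for k unfolding \<alpha>_def by (intro prod_pos) (simp add: \<gamma>)
  have \<alpha>_Suc: "\<alpha> (Suc k) = \<alpha> k * \<gamma> (Suc k)" for k by (simp add: \<alpha>_def)
  have \<alpha>_antimono: "\<alpha> l \<le> \<alpha> k" if "k \<le> l" for k l
  proof (rule lift_Suc_antimono_le[OF _ that])
    show "\<alpha> (Suc k) \<le> \<alpha> k" for k
      unfolding \<alpha>_Suc using \<alpha>[of k] \<gamma>[of "Suc k"] by (simp add: mult_left_le)
  qed
  have \<alpha>_less: "\<alpha> l \<le> \<alpha> k * \<gamma> l" if kl: "k < l" for k l
  proof -
    obtain l' where l': "l = Suc l'" using kl by (cases l) auto
    then show ?thesis
      using \<alpha>_Suc[of l'] \<alpha>_antimono[of k l'] \<gamma>[of l] kl by (simp add: mult_right_mono)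
  qed
  \<comment> \<open>The pairing function enumerates diagonals: the pair (m, n) sits at position
    \<open>triangle (m + n) + m\<close>, that is, in block m + n with offset m.\<close>
  define \<xi> where "\<xi> p = (case prod_decode p of (m, n) \<Rightarrow> of_real (\<alpha> (m + n)) * y (m + n) m)" for p
  have \<xi>_block: "\<xi> (triangle k + j) = of_real (\<alpha> k) * y k j" if "j \<le> k" for j k
  proof -
    have "triangle k + j = prod_encode (j, k - j)" using that by (simp add: prod_encode_def)
    then show ?thesis using that by (simp add: \<xi>_def)
  qed
  \<comment> \<open>Such a p lies in a block l > k. There
    \<open>\<alpha> l \<le> \<alpha> k * \<gamma> l\<close>, and \<open>\<gamma> l * b l\<close> is
    a power of 1/2 with exponent beyond p.\<close>
  have \<xi>_tail: "cmod (\<xi> p) \<le> \<alpha> k * (1/2) ^ p" if p: "triangle (Suc k) \<le> p" for p k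
  proof -
    obtain m n where mn: "prod_decode p = (m, n)" by force
    then have "p = prod_encode (m, n)" by (metis prod_decode_inverse)
    then have p_eq: "p = triangle (m + n) + m" by (simp add: prod_encode_def)
    then have p_less: "p < triangle (Suc (m + n))" by simp
    have "k < m + n"
    proof (rule ccontr)
      assume "\<not> k < m + n"
      then have "triangle (Suc (m + n)) \<le> triangle (Suc k)" by (intro triangle_mono) simp
      then show False using p p_less by simp
    qed
    have "cmod (\<xi> p) = \<alpha> (m + n) * cmod (y (m + n) m)"
      using \<alpha>[of "m + n"] by (simp add: \<xi>_def mn norm_mult)
    also have "\<dots> \<le> (\<alpha> k * \<gamma> (m + n)) * b (m + n)"
      using \<alpha>_less[OF \<open>k < m + n\<close>] y_le[of m "m + n"] \<alpha>[of k] \<gamma>[of "m + n"]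
      by (intro mult_mono) auto
    also have "\<dots> = \<alpha> k * (1/2) ^ triangle (Suc (m + n))"
      using b[of "m + n"] by (simp add: \<gamma>_def)
    also have "\<dots> \<le> \<alpha> k * (1/2) ^ p"
      using p_less \<alpha>[of k] by (intro mult_left_mono power_decreasing) auto
    finally show ?thesis .
  qed
  \<comment> \<open>The tail estimate with k = 0 starts at \<open>triangle 1 = 1\<close>; the extra
    summand accounts for position 0.\<close>
  have "cmod (\<xi> j) \<le> (\<alpha> 0 + cmod (\<xi> 0)) * (1/2) ^ j" for j
  proof (cases "j = 0")
    case True
    then show ?thesis using \<alpha>[of 0] by simp
  next
    case False
    then have "cmod (\<xi> j) \<le> \<alpha> 0 * (1/2) ^ j" by (intro \<xi>_tail) simp
    also have "\<dots> \<le> (\<alpha> 0 + cmod (\<xi> 0)) * (1/2) ^ j" by (intro mult_right_mono) auto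
    finally show ?thesis .
  qed
  moreover have "\<exists>c n. \<forall>j. cmod ((if j < N then d j else 0) - c * \<xi> (j + n)) \<le> \<epsilon> * (1/2) ^ j"
    if "\<epsilon> > 0" for d :: "nat \<Rightarrow> complex" and N and \<epsilon> :: real
  proof -
    have "\<forall>j. \<exists>i. cmod (d j - q i) < \<epsilon> * (1/2) ^ N" using q \<open>\<epsilon> > 0\<close> by simp
    from choice[OF this] obtain h where h: "\<And>j. cmod (d j - q (h j)) < \<epsilon> * (1/2) ^ N" by blast
    obtain m0 where m0: "(1/2 :: real) ^ m0 < \<epsilon>"
      using real_arch_pow_inv[OF \<open>\<epsilon> > 0\<close>, of "1/2"] by auto
    \<comment> \<open>Since k is at least m, block k has room for all N entries, and
      \<open>(1/2) ^ triangle k\<close> is below \<open>\<epsilon>\<close>.\<close>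
    define m where "m = max N m0"
    define k where "k = prod_encode (to_nat (map h [0..<N]), m)"
    have "m \<le> k" unfolding k_def by (rule le_prod_encode_2)
    have y_k: "y k j = (if j < N then q (h j) else 0)" for j
      by (simp add: y_def k_def)
    have small: "(1/2 :: real) ^ triangle k \<le> \<epsilon>"
    proof -
      have "m0 \<le> triangle k" using le_triangle[of k] \<open>m \<le> k\<close> by (simp add: m_def)
      then have "(1/2 :: real) ^ triangle k \<le> (1/2) ^ m0" by (intro power_decreasing) auto
      then show ?thesis using m0 by linarith
    qed
    \<comment> \<open>Shifting by \<open>triangle k\<close> moves block k to the front and the
      scalar undoes its weight. Inside the block only the approximation of d contributes, beyond it
      only the tail.\<close>
    have "cmod ((if j < N then d j else 0) - of_real (1 / \<alpha> k) * \<xi> (j + triangle k)) \<le> \<epsilon> * (1/2) ^ j" for j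
    proof (cases "j \<le> k")
      case True
      then have eq: "of_real (1 / \<alpha> k) * \<xi> (j + triangle k) = y k j"
        using \<alpha>[of k] \<xi>_block[OF True] by (simp add: add.commute)
      show ?thesis
      proof (cases "j < N")
        case True
        then have "\<epsilon> * (1/2) ^ N \<le> \<epsilon> * (1/2) ^ j"
          using \<open>\<epsilon> > 0\<close> by (intro mult_left_mono power_decreasing) auto
        then show ?thesis unfolding eq y_k using h[of j] True by simp
      next
        case False
        then show ?thesis unfolding eq y_k using \<open>\<epsilon> > 0\<close> by simp
      qed
    next
      case False
      have "cmod (of_real (1 / \<alpha> k) * \<xi> (j + triangle k)) = cmod (\<xi> (j + triangle k)) / \<alpha> k"
        using \<alpha>[of k] by (simp add: norm_mult norm_divide)
      also have "\<dots> \<le> (\<alpha> k * (1/2) ^ (j + triangle k)) / \<alpha> k"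
        using False \<alpha>[of k] by (intro divide_right_mono \<xi>_tail) auto
      also have "\<dots> = (1/2) ^ triangle k * (1/2) ^ j"
        using \<alpha>[of k] by (simp add: power_add)
      also have "\<dots> \<le> \<epsilon> * (1/2) ^ j" using small by (intro mult_right_mono) auto
      finally show ?thesis using False \<open>m \<le> k\<close> by (simp add: m_def)
    qed
    then show ?thesis by blast
  qed
  ultimately show ?thesis by blast
qed

section \<open>The backward shift on the Hilbert module\<close>

lemma norm_blinfun_scaleC: "norm (blinfun_scaleC c A) \<le> cmod c * norm (A :: 'h::complex_hilbert \<Rightarrow>\<^sub>L 'h)"
proof (rule norm_blinfun_bound)
  fix u
  have "cmod c * norm (blinfun_apply A u) \<le> cmod c * (norm A * norm u)"
    by (intro mult_left_mono norm_blinfun) auto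
  then show "norm (blinfun_apply (blinfun_scaleC c A) u) \<le> cmod c * norm A * norm u"
    by (simp add: norm_scaleC mult.assoc)
qed simp

lemma bshift_funpow_carrier:
  assumes "x \<in> carrier l2_B0"
  shows "(bshift ^^ n) x \<in> carrier l2_B0 \<and> nrm l2_B0 ((bshift ^^ n) x) \<le> nrm l2_B0 x"
proof (induction n)
  case (Suc n)
  then show ?case
    using l2_B0.nrm_bshift_le[of "(bshift ^^ n) x"] l2_B0.bshift_carrier[of "(bshift ^^ n) x"] by auto
qed (use assms in simp)

context
  fixes e :: "'h::complex_hilbert"
  assumes e: "cinner e e = 1"
begin

lemma norm_e: "norm e = 1"
proof -
  have "complex_of_real ((norm e)\<^sup>2) = complex_of_real 1" using cinner_self[of e] e by simp
  then have "(norm e)\<^sup>2 = 1" by (simp only: of_real_eq_iff)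
  then show ?thesis using norm_ge_zero[of e] by (auto simp: power2_eq_1_iff simp del: norm_ge_zero)
qed

lemma norm_rank_one_le: "norm (rank_one e) \<le> 1"
proof (rule norm_blinfun_bound)
  show "norm (blinfun_apply (rank_one e) u) \<le> 1 * norm u" for u
    using cinner.Cauchy_Schwarz[of u e] norm_e by (simp add: norm_scaleC)
qed simp

lemma rank_one_nonzero: "rank_one e \<noteq> 0"
proof
  assume "rank_one e = 0"
  then have "blinfun_apply (rank_one e) e = 0" by simp
  then show False using e norm_e by auto
qed

lemma bshift_not_Cstar_transitive: "\<not> Cstar_transitive (bshift :: (nat \<Rightarrow> 'h \<Rightarrow>\<^sub>L 'h) \<Rightarrow> _)"
proof
  let ?X = "l2_B0 :: (nat \<Rightarrow> 'h \<Rightarrow>\<^sub>L 'h) cns"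
  let ?S = "subtopology (norm_topology ?X) (unit_sphere ?X)"
  let ?P = "rank_one e"
  assume T: "Cstar_transitive (bshift :: (nat \<Rightarrow> 'h \<Rightarrow>\<^sub>L 'h) \<Rightarrow> _)"
  define W where "W = topspace (prod_topology ?S ?S)"
  \<comment> \<open>No pairing of unit vectors under powers of the contraction exceeds norm 1, so
    this relatively open set is never hit.\<close>
  define Q where "Q = compact_operators \<inter> {A :: 'h \<Rightarrow>\<^sub>L 'h. 1 < norm A}"
  have W_eq: "W = unit_sphere ?X \<times> unit_sphere ?X"
    by (auto simp: W_def unit_sphere_def)
  have "unit_sphere ?X \<noteq> {}"
  proof -
    let ?x = "unit_at 0 ?P :: nat \<Rightarrow> 'h \<Rightarrow>\<^sub>L 'h"
    have x: "?x \<in> carrier ?X" using compact_rank_one by (rule l2_B0.unit_at_carrier)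
    have "?x 0 \<noteq> 0" using rank_one_nonzero by (simp add: unit_at_def)
    then have "?x \<noteq> 0" by auto
    then have "nrm ?X ?x \<noteq> 0" using l2_B0.nrm_eq_0[OF x] by simp
    then have "nrm ?X (cscale ?X (of_real (1 / nrm ?X ?x)) ?x) = 1"
      using l2_B0.nrm_cscale[OF x] l2_B0.nrm_nonneg[OF x] by (simp add: norm_divide)
    then show ?thesis using l2_B0.carrier_cscale[OF x] by (auto simp: unit_sphere_def)
  qed
  then have "W \<noteq> {}" by (auto simp: W_eq)
  moreover have "openin (prod_topology ?S ?S) W" unfolding W_def by (rule openin_topspace)
  moreover have "openin (top_of_set compact_operators) Q"
    unfolding Q_def by (intro openin_open_Int open_Collect_less continuous_intros)
  moreover have "Q \<noteq> {}"
  proof -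
    have "norm ((2 / norm ?P) *\<^sub>R ?P) = 2" using rank_one_nonzero by simp
    then have "(2 / norm ?P) *\<^sub>R ?P \<in> Q"
      unfolding Q_def by (simp add: compact_operators_scaleR compact_rank_one)
    then show ?thesis by blast
  qed
  ultimately obtain n x y where xy: "(x, y) \<in> W" "module_ip ((bshift ^^ n) x) y \<in> Q"
    using T[unfolded Cstar_transitive_def Let_def, rule_format, of W Q] by blast
  then have x: "x \<in> carrier ?X" "nrm ?X x = 1" and y: "y \<in> carrier ?X" "nrm ?X y = 1"
    by (auto simp: W_eq unit_sphere_def)
  have "norm (module_ip ((bshift ^^ n) x) y) \<le> nrm ?X ((bshift ^^ n) x) * nrm ?X y"
    using bshift_funpow_carrier[OF x(1)] y by (intro norm_module_ip_le) auto
  also have "\<dots> \<le> 1" using bshift_funpow_carrier[OF x(1), of n] x y by simp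
  finally show False using xy(2) by (simp add: Q_def)
qed

definition scalar_columns :: "(nat \<Rightarrow> 'h \<Rightarrow>\<^sub>L 'h) set" where
  "scalar_columns = {x \<in> carrier l2_B0. \<forall>j. \<exists>c. x j = blinfun_scaleC c (rank_one e)}"

lemma scalar_columns_subspace: "l2_B0.cs.subspace scalar_columns"
  unfolding l2_B0.cs.subspace_def
proof (intro conjI ballI allI)
  show "0 \<in> scalar_columns"
    using l2_B0.carrier_0 by (auto simp: scalar_columns_def intro: exI[of _ 0])
  fix x assume x: "x \<in> scalar_columns"
  then obtain f where f: "\<And>j. x j = blinfun_scaleC (f j) (rank_one e)"
    unfolding scalar_columns_def by (auto simp: choice_iff)
  show "x + y \<in> scalar_columns" if y: "y \<in> scalar_columns" for y
  proof -
    obtain g where g: "\<And>j. y j = blinfun_scaleC (g j) (rank_one e)"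
      using y unfolding scalar_columns_def by (auto simp: choice_iff)
    have "(x + y) j = blinfun_scaleC (f j + g j) (rank_one e)" for j
      by (simp add: f g blinfun_scaleC.scale_left_distrib)
    then show ?thesis using x y l2_B0.carrier_add unfolding scalar_columns_def by blast
  qed
  show "cscale l2_B0 c x \<in> scalar_columns" for c
  proof -
    have "cscale l2_B0 c x j = blinfun_scaleC (c * f j) (rank_one e)" for j
      by (simp add: f l2_B0_cscale)
    then show ?thesis using x l2_B0.carrier_cscale unfolding scalar_columns_def by blast
  qed
qed

text \<open>The contractive functional \<open>\<phi>\<close> recovers the coefficient of a multiple
  of the projection. Subtracting the recovered multiple leaves a residual that vanishes exactly on
  such multiples and is continuous, so it vanishes on limits.\<close>

lemma scalar_columns_closed: "closedin (norm_topology l2_B0) scalar_columns"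
proof -
  let ?P = "rank_one e"
  define \<phi> where "\<phi> A = cinner (blinfun_apply A e) e" for A :: "'h \<Rightarrow>\<^sub>L 'h"
  have \<phi>_P: "\<phi> (blinfun_scaleC c ?P) = c" for c
    by (simp add: \<phi>_def cinner_scaleC_left e)
  have "y \<in> scalar_columns" if y: "y \<in> norm_topology l2_B0 closure_of scalar_columns" for y
  proof -
    have yc: "y \<in> carrier l2_B0" using y unfolding l2_B0.in_closure_iff by blast
    have "y j = blinfun_scaleC (\<phi> (y j)) ?P" for j
    proof -
      have le: "norm (y j - blinfun_scaleC (\<phi> (y j)) ?P) \<le> 0 + r" if "r > 0" for r
      proof -
        have "r / 2 > 0" using that by simp
        then obtain z where z: "z \<in> scalar_columns" "nrm l2_B0 (y - z) < r / 2"
          using y unfolding l2_B0.in_closure_iff by blast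
        then obtain c where c: "z j = blinfun_scaleC c ?P" by (auto simp: scalar_columns_def)
        have zc: "z \<in> carrier l2_B0" using z by (simp add: scalar_columns_def)
        let ?D = "y j - z j"
        have D: "norm ?D < r / 2"
          using l2_B0.norm_coord_le[OF l2_B0.carrier_diff[OF yc zc], of j] z(2) by simp
        have "\<phi> (y j) = \<phi> ?D + c"
          using \<phi>_P[of c] by (simp add: \<phi>_def c blinfun.diff_left cinner_diff_left)
        \<comment> \<open>The residual is linear and kills \<open>z j\<close>, so only the small
          difference contributes, and by contractivity at most twice its norm.\<close>
        then have eq: "y j - blinfun_scaleC (\<phi> (y j)) ?P = ?D - blinfun_scaleC (\<phi> ?D) ?P"
          by (simp add: c blinfun_scaleC.scale_left_distrib)
        have "cmod (\<phi> ?D) \<le> norm (blinfun_apply ?D e) * norm e"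
          unfolding \<phi>_def using cinner.Cauchy_Schwarz by simp
        also have "\<dots> \<le> norm ?D"
          using norm_blinfun[of ?D e] norm_e by simp
        finally have "norm (blinfun_scaleC (\<phi> ?D) ?P) \<le> norm ?D * 1"
          using norm_blinfun_scaleC[of "\<phi> ?D" ?P] norm_rank_one_le
          by (meson mult_mono norm_ge_zero order_trans)
        then show ?thesis
          unfolding eq using norm_triangle_ineq4[of ?D "blinfun_scaleC (\<phi> ?D) ?P"] D by simp
      qed
      have "norm (y j - blinfun_scaleC (\<phi> (y j)) ?P) \<le> 0"
        by (rule field_le_epsilon) (rule le)
      then show ?thesis by simp
    qed
    then show ?thesis using yc unfolding scalar_columns_def by blast
  qed
  moreover have "scalar_columns \<subseteq> topspace (norm_topology l2_B0)"
    by (auto simp: scalar_columns_def)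
  ultimately show ?thesis
    using closure_of_subset_eq[of scalar_columns "norm_topology l2_B0"] by blast
qed

lemma scalar_columns_dim_ge2: "closed_subspace_dim_ge2 l2_B0 scalar_columns"
proof -
  let ?P = "rank_one e"
  let ?a = "unit_at 0 ?P :: nat \<Rightarrow> 'h \<Rightarrow>\<^sub>L 'h" and ?b = "unit_at 1 ?P :: nat \<Rightarrow> 'h \<Rightarrow>\<^sub>L 'h"
  have mem: "unit_at m ?P \<in> scalar_columns" for m
  proof -
    have "unit_at m ?P j = blinfun_scaleC (if j = m then 1 else 0) ?P" for j
      by (simp add: unit_at_def)
    then show ?thesis
      using l2_B0.unit_at_carrier[OF compact_rank_one[of e]] unfolding scalar_columns_def by blast
  qed
  have a0: "?a 0 = ?P" "?b 0 = 0" "?b 1 = ?P" by (simp_all add: unit_at_def)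
  have not_span: "?a \<notin> l2_B0.cs.span {?b}"
  proof
    assume "?a \<in> l2_B0.cs.span {?b}"
    then obtain c where "?a = cscale l2_B0 c ?b" by (auto simp: l2_B0.cs.span_singleton)
    then have "?a 0 = blinfun_scaleC c (?b 0)" by (simp add: l2_B0_cscale)
    then show False using rank_one_nonzero unfolding a0 by simp
  qed
  then have ne: "?a \<noteq> ?b" using l2_B0.cs.span_base[of ?b "{?b}"] by auto
  have "?b \<noteq> 0"
  proof
    assume "?b = 0"
    then have "?b 1 = 0" by (simp only: zero_fun_apply)
    then show False unfolding a0 using rank_one_nonzero by simp
  qed
  then have "l2_B0.cs.independent {?a, ?b}"
    using not_span by (simp add: l2_B0.cs.independent_insert l2_B0.cs.span_empty)
  then have "\<exists>B\<subseteq>scalar_columns. card B = 2 \<and> l2_B0.cs.independent B"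
    using mem ne by (intro exI[of _ "{?a, ?b}"]) auto
  then show ?thesis
    unfolding closed_subspace_dim_ge2_def using scalar_columns_subspace scalar_columns_closed by blast
qed

text \<open>The column with coefficients \<open>\<xi>\<close> is the supercyclic vector. Its
  iterates stay in \<open>scalar_columns\<close>, where the scalar approximation of truncated
  sequences, weighted by powers of 1/2, sums to an approximation in norm.\<close>

lemma bshift_subspace_supercyclic: "subspace_supercyclic l2_B0 (bshift :: (nat \<Rightarrow> 'h \<Rightarrow>\<^sub>L 'h) \<Rightarrow> _)"
proof -
  let ?P = "rank_one e"
  obtain \<xi> :: "nat \<Rightarrow> complex" and K where \<xi>: "\<And>j. cmod (\<xi> j) \<le> K * (1/2) ^ j"
    and universal: "\<And>d N \<epsilon>. \<epsilon> > 0 \<Longrightarrow>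
      \<exists>c n. \<forall>j. cmod ((if j < N then d j else 0) - c * \<xi> (j + n)) \<le> \<epsilon> * (1/2) ^ j"
    using universal_sequence by blast
  have norm_le: "norm (blinfun_scaleC c ?P) \<le> cmod c" for c
    using norm_blinfun_scaleC[of c ?P] norm_rank_one_le
    by (meson mult_left_le norm_ge_zero order_trans)
  define x where "x j = blinfun_scaleC (\<xi> j) ?P" for j
  have x: "x \<in> carrier l2_B0"
  proof (rule l2_B0.carrier_summable)
    show "x j \<in> compact_operators" for j
      by (simp add: x_def compact_operators_scaleC compact_rank_one)
    show "summable (\<lambda>j. norm (x j))"
    proof (rule summable_comparison_test')
      show "summable (\<lambda>j. K * (1/2) ^ j)" by (intro summable_mult summable_geometric) simp
      show "norm (norm (x j)) \<le> K * (1/2) ^ j" for j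
        using norm_le[of "\<xi> j"] \<xi>[of j] by (simp add: x_def)
    qed
  qed
  let ?A = "{cscale l2_B0 c ((bshift ^^ n) x) | c n. True} \<inter> scalar_columns"
  have "scalar_columns \<subseteq> norm_topology l2_B0 closure_of ?A"
  proof
    fix y assume y: "y \<in> scalar_columns"
    then have yc: "y \<in> carrier l2_B0" by (simp add: scalar_columns_def)
    obtain d where d: "\<And>j. y j = blinfun_scaleC (d j) ?P"
      using y unfolding scalar_columns_def by (auto simp: choice_iff)
    have "\<exists>w\<in>?A. w \<in> carrier l2_B0 \<and> nrm l2_B0 (y - w) < r" if r: "r > 0" for r
    proof -
      \<comment> \<open>Truncation costs r / 4. The geometric weights sum to 2, so a coefficient
        error of r / 8 costs another r / 4, and the total stays strictly below r.\<close>
      have "r / 4 > 0" "r / 8 > 0" using r by auto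
      obtain N where N: "nrm l2_B0 (truncation N y - y) \<le> r / 4"
        using l2_B0.truncation_approx[OF yc \<open>r / 4 > 0\<close>] by blast
      obtain c n where cn: "\<And>j. cmod ((if j < N then d j else 0) - c * \<xi> (j + n)) \<le> r / 8 * (1/2) ^ j"
        using universal[OF \<open>r / 8 > 0\<close>, of N d] by blast
      define w where "w = cscale l2_B0 c ((bshift ^^ n) x)"
      have w_eq: "w j = blinfun_scaleC (c * \<xi> (j + n)) ?P" for j
        by (simp add: w_def l2_B0_cscale bshift_funpow x_def)
      have wc: "w \<in> carrier l2_B0"
        unfolding w_def using bshift_funpow_carrier[OF x] by (intro l2_B0.carrier_cscale) blast
      then have wA: "w \<in> ?A"
        unfolding scalar_columns_def using w_eq by (auto simp: w_def)
      note tc = l2_B0.truncation_carrier[OF yc, of N]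
      have dc: "truncation N y - w \<in> carrier l2_B0" by (rule l2_B0.carrier_diff[OF tc wc])
      have "(truncation N y - w) j = blinfun_scaleC ((if j < N then d j else 0) - c * \<xi> (j + n)) ?P" for j
        by (simp add: truncation_def d w_eq blinfun_scaleC.scale_left_diff_distrib)
      then have coord: "norm ((truncation N y - w) j) \<le> r / 8 * (1/2) ^ j" for j
        using norm_le cn order_trans by metis
      have geo: "(\<lambda>j. r / 8 * (1/2) ^ j) sums (r / 8 * 2)"
        using sums_mult[OF geometric_sums[of "1/2 :: real"], of "r / 8"] by simp
      have s: "summable (\<lambda>j. norm ((truncation N y - w) j))"
        by (rule summable_comparison_test'[OF sums_summable[OF geo]]) (use coord in simp)
      have "nrm l2_B0 (truncation N y - w) \<le> (\<Sum>j. norm ((truncation N y - w) j))"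
        by (rule l2_B0.carrier_summable[OF l2_B0.carrier_coord[OF dc] s])
      also have "\<dots> \<le> r / 8 * 2"
        using suminf_le[OF coord s sums_summable[OF geo]] sums_unique[OF geo] by simp
      finally have "nrm l2_B0 (y - w) \<le> r / 4 + r / 4"
        using l2_B0.nrm_triangle_diff[OF yc tc wc] N l2_B0.nrm_diff_commute[OF yc tc] by simp
      then have "nrm l2_B0 (y - w) < r" using r by simp
      then show ?thesis using wA wc by blast
    qed
    then show "y \<in> norm_topology l2_B0 closure_of ?A"
      unfolding l2_B0.in_closure_iff using yc by blast
  qed
  then have "dense_in l2_B0 ?A scalar_columns" by (simp add: dense_in_def)
  then show ?thesis
    unfolding subspace_supercyclic_def using scalar_columns_dim_ge2 x by blast
qed

end

theorem proposition4p15: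
  shows "(\<exists>(X :: (nat \<Rightarrow> complex) cns) T.
            complex_banach X \<and> carrier X \<noteq> {0} \<and> T \<in> bounded_operators X \<and>
            topologically_numerically_transitive X T \<and> \<not> subspace_supercyclic X T)
       \<and> (\<forall>e :: int \<Rightarrow> 'h::complex_hilbert. orthonormal_basis e \<longrightarrow>
            (\<exists>T \<in> bounded_operators (l2_B0 :: (nat \<Rightarrow> ('h \<Rightarrow>\<^sub>L 'h)) cns).
               Cstar_transitive T \<and> \<not> subspace_hypercyclic l2_B0 T) \<and>
            (\<exists>T \<in> bounded_operators (l2_B0 :: (nat \<Rightarrow> ('h \<Rightarrow>\<^sub>L 'h)) cns).
               subspace_supercyclic l2_B0 T \<and> \<not> Cstar_transitive T))"
proof (intro conjI allI impI)
  have "unit_at 0 1 \<in> carrier l2" by (rule l2.unit_at_carrier) simp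
  moreover have "unit_at 0 1 \<noteq> (0 :: nat \<Rightarrow> complex)" by (auto simp: unit_at_def fun_eq_iff)
  ultimately have "carrier l2 \<noteq> {0}" by auto
  then show "\<exists>(X :: (nat \<Rightarrow> complex) cns) T.
            complex_banach X \<and> carrier X \<noteq> {0} \<and> T \<in> bounded_operators X \<and>
            topologically_numerically_transitive X T \<and> \<not> subspace_supercyclic X T"
    using complex_banach_l2 l2.dshift_bounded dshift_numerically_transitive
      l2.dshift_not_subspace_supercyclic by blast
next
  fix e :: "int \<Rightarrow> 'h"
  assume e: "orthonormal_basis e"
  show "\<exists>T \<in> bounded_operators (l2_B0 :: (nat \<Rightarrow> ('h \<Rightarrow>\<^sub>L 'h)) cns).
          Cstar_transitive T \<and> \<not> subspace_hypercyclic l2_B0 T"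
    using l2_B0.dshift_bounded dshift_Cstar_transitive[OF e] l2_B0.dshift_not_subspace_supercyclic
      subspace_hypercyclic_imp_supercyclic[OF l2_B0.vector_space_cscale] by blast
  \<comment> \<open>A member of the basis serves as the unit vector that spans the range of the rank
    one projection.\<close>
  have "cinner (e 0) (e 0) = 1" using e by (simp add: orthonormal_basis_def)
  then show "\<exists>T \<in> bounded_operators (l2_B0 :: (nat \<Rightarrow> ('h \<Rightarrow>\<^sub>L 'h)) cns).
          subspace_supercyclic l2_B0 T \<and> \<not> Cstar_transitive T"
    using l2_B0.bshift_bounded bshift_subspace_supercyclic bshift_not_Cstar_transitive by blast
qed

end
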